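(* Let $\Xi$ be a locally compact abelian group with a Heisenberg multiplier $m$, let $(U,\mathcal{H})$ be the associated irreducible projective unitary representation (square-integrable, integrable and strongly continuous), and let $\mathcal{F}_U:\mathcal{T}^2(\mathcal{H})\to L^2(\widehat{\Xi})$ be the Fourier-Weyl transform. Let $F\subset\mathcal{T}^2(\mathcal{H})$ be bounded. Then the following assertions are equivalent: (i) $F$ is precompact in $\mathcal{T}^2(\mathcal{H})$. (ii) $F$ is uniformly $\mathcal{T}^2$-equicontinuous and $\mathcal{F}_U(F)$ is uniformly $L^2(\widehat{\Xi})$-equicontinuous. (iii) $\mathcal{F}_U(F)$ has uniform $L^2(\widehat{\Xi})$-decay and $\mathcal{F}_U(F)$ is uniformly $L^2(\widehat{\Xi})$-equicontinuous.
   Context: Setting. $\Xi$ is a locally compact abelian (LCA) group, written additively with neutral element $0$. $m:\Xi\times\Xi\to\mathbb{T}$ is a separately continuous multiplier (2-cocycle: $m(x,y)m(x+y,z)=m(x,y+z)m(y,z)$) with $m(x,0)=m(0,x)=1$, which is a Heisenberg multiplier: $\sigma(x,y)=m(x,y)/m(y,x)$ is a bicharacter and $x\mapsto\sigma(x,\cdot)$ is a topological isomorphism of $\Xi$ onto its Pontryagin dual. $(U,\mathcal{H})$ is the (unique up to unitary equivalence) irreducible projective unitary representation of $\Xi$ on a complex Hilbert space $\mathcal{H}$ with $U_xU_y=m(x,y)U_{x+y}$ (so $U_xU_y=\sigma(x,y)U_yU_x$ and $U_0=I$). It is assumed to be square-integrable (so Haar measure on $\Xi$ can be normalized so that the orthogonality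 relations for the matrix coefficients $x\mapsto\langle U_x\varphi,\psi\rangle$ hold with constant $1$), integrable (there is $0\neq\varphi\in\mathcal{H}$ with $x\mapsto\langle U_x\varphi,\varphi\rangle\in L^1(\Xi)$), and strongly continuous ($x\mapsto U_x\varphi$ is continuous for every $\varphi\in\mathcal{H}$). $\mathcal{T}^p(\mathcal{H})$, $1\le p<\infty$, is the Schatten $p$-class; $\mathcal{T}^2(\mathcal{H})$ is the Hilbert-Schmidt class. For $x\in\Xi$ and a bounded operator $A$, $\alpha_x(A)=U_xAU_x^*$. $\widehat{\Xi}$ denotes $\Xi$ as a topological group (identified with the dual via $\sigma$, the trivial character being the neutral element), with Haar measure normalized so that the Plancherel theorem below is unitary. For $A\in\mathcal{T}^1(\mathcal{H})$, the Fourier-Weyl transform is $\mathcal{F}_U(A)(\xi)=\operatorname{tr}(AU_\xi^* )$, $\xi\in\widehat{\Xi}$; it extends to a unitary operator $\mathcal{F}_U:\mathcal{T}^2(\mathcal{H})\to L^2(\widehat{\Xi})$ (Plancherel theorem). Definitions. A subset of a metric space is precompact if its closure is compact. $F\subset\mathcal{T}^2(\mathcal{H})$ is uniformly $\mathcal{T}^2$-equicontinuous if for every $\varepsilon>0$ there is an open neighbourhood $V$ of $0\in\Xi$ with $\|\alpha_x(A)-A\|_{\mathcal{T}^2}<\varepsilon$ for all $A\in F$, $x\in V$. $S\subset L^2(\widehat{\Xi})$ is uniformly $L^2(\widehat{\Xi})$-equicontinuous if for every $\varepsilon>0$ there is an open neighbourhood $V$ of the neutral element of $\widehat{\Xi}$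 with $\|L_\eta g-g\|_{L^2}<\varepsilon$ for all $g\in S$, $\eta\in V$, where $L_\eta g(\xi)=g(\xi-\eta)$. $S\subset L^2(\widehat{\Xi})$ has uniform $L^2(\widehat{\Xi})$-decay if for every $\varepsilon>0$ there is a compact $K\subset\widehat{\Xi}$ with $\int_{\widehat{\Xi}\setminus K}|g(\xi)|^2\,d\xi<\varepsilon$ for all $g\in S$. *)

theory Defs
  imports "HOL-Analysis.Analysis"
begin

section \<open>Complex Hilbert spaces and operators\<close>

text \<open>
  A complex Hilbert space is a complete real inner product space carrying a compatible complex
  structure. The complex inner product is linear in its first argument; its real part is the
  underlying real inner product, so that both induce the same norm.
\<close>

class complex_hilbert_space = real_inner + complete_space +
  fixes scaleC :: "complex \<Rightarrow> 'a \<Rightarrow> 'a"  (infixr "*\<^sub>C" 75)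
    and cinner :: "'a \<Rightarrow> 'a \<Rightarrow> complex"
  assumes scaleC_add_right: "c *\<^sub>C (u + v) = c *\<^sub>C u + c *\<^sub>C v"
    and scaleC_add_left: "(c + d) *\<^sub>C u = c *\<^sub>C u + d *\<^sub>C u"
    and scaleC_scaleC: "c *\<^sub>C (d *\<^sub>C u) = (c * d) *\<^sub>C u"
    and scaleR_scaleC: "r *\<^sub>R u = complex_of_real r *\<^sub>C u"
    and cinner_commute: "cinner u v = cnj (cinner v u)"
    and cinner_add_left: "cinner (u + v) w = cinner u w + cinner v w"
    and cinner_scaleC_left: "cinner (c *\<^sub>C u) v = c * cinner u v"
    and inner_eq_Re_cinner: "inner u v = Re (cinner u v)"

definition csubspace :: "'h::complex_hilbert_space set \<Rightarrow> bool" where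
  "csubspace S \<longleftrightarrow> subspace S \<and> (\<forall>c. \<forall>v\<in>S. c *\<^sub>C v \<in> S)"

definition bounded_clinear :: "('h::complex_hilbert_space \<Rightarrow> 'h) \<Rightarrow> bool" where
  "bounded_clinear A \<longleftrightarrow> bounded_linear A \<and> (\<forall>c v. A (c *\<^sub>C v) = c *\<^sub>C A v)"

definition cadjoint :: "('h::complex_hilbert_space \<Rightarrow> 'h) \<Rightarrow> 'h \<Rightarrow> 'h" where
  "cadjoint A = (THE B. \<forall>u v. cinner (A u) v = cinner u (B v))"

definition unitary_op :: "('h::complex_hilbert_space \<Rightarrow> 'h) \<Rightarrow> bool" where
  "unitary_op A \<longleftrightarrow>
     bounded_clinear A \<and> surj A \<and> (\<forall>u v. cinner (A u) (A v) = cinner u v)"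

definition positive_op :: "('h::complex_hilbert_space \<Rightarrow> 'h) \<Rightarrow> bool" where
  "positive_op A \<longleftrightarrow>
     bounded_clinear A \<and> (\<forall>v. Im (cinner (A v) v) = 0 \<and> 0 \<le> Re (cinner (A v) v))"

text \<open>The absolute value: the unique positive square root of \<open>A\<^sup>* A\<close>.\<close>

definition abs_op :: "('h::complex_hilbert_space \<Rightarrow> 'h) \<Rightarrow> 'h \<Rightarrow> 'h" where
  "abs_op A = (THE B. positive_op B \<and> B \<circ> B = cadjoint A \<circ> A)"

definition is_onb :: "'h::complex_hilbert_space set \<Rightarrow> bool" where
  "is_onb E \<longleftrightarrow>
     (\<forall>e\<in>E. \<forall>f\<in>E. cinner e f = (if e = f then 1 else 0)) \<and>
     (\<forall>v. (\<forall>e\<in>E. cinner v e = 0) \<longrightarrow> v = 0)"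

text \<open>
  The Schatten classes, the Hilbert-Schmidt norm and the trace do not depend on the orthonormal
  basis used to compute them, so one basis is fixed once and for all. It may be uncountable.
\<close>

definition some_onb :: "'h::complex_hilbert_space set" where
  "some_onb = (SOME E. is_onb E)"

definition trace_class :: "('h::complex_hilbert_space \<Rightarrow> 'h) set" where
  "trace_class =
     {A. bounded_clinear A \<and> (\<lambda>e. Re (cinner (abs_op A e) e)) summable_on some_onb}"

definition op_trace :: "('h::complex_hilbert_space \<Rightarrow> 'h) \<Rightarrow> complex" where
  "op_trace A = (\<Sum>\<^sub>\<infinity>e\<in>some_onb. cinner (A e) e)"

definition hilbert_schmidt :: "('h::complex_hilbert_space \<Rightarrow> 'h) set" where
  "hilbert_schmidt = {A. bounded_clinear A \<and> (\<lambda>e. (norm (A e))\<^sup>2) summable_on some_onb}"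

definition hs_norm :: "('h::complex_hilbert_space \<Rightarrow> 'h) \<Rightarrow> real" where
  "hs_norm A = sqrt (\<Sum>\<^sub>\<infinity>e\<in>some_onb. (norm (A e))\<^sup>2)"

definition hs_dist :: "('h::complex_hilbert_space \<Rightarrow> 'h) \<Rightarrow> ('h \<Rightarrow> 'h) \<Rightarrow> real" where
  "hs_dist A B = hs_norm (\<lambda>v. A v - B v)"

abbreviation hs_topology :: "('h::complex_hilbert_space \<Rightarrow> 'h) topology" where
  "hs_topology \<equiv> Metric_space.mtopology hilbert_schmidt hs_dist"

abbreviation hs_bounded :: "('h::complex_hilbert_space \<Rightarrow> 'h) set \<Rightarrow> bool" where
  "hs_bounded \<equiv> Metric_space.mbounded hilbert_schmidt hs_dist"

definition hs_precompact :: "('h::complex_hilbert_space \<Rightarrow> 'h) set \<Rightarrow> bool" where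
  "hs_precompact F \<longleftrightarrow> compactin hs_topology (hs_topology closure_of F)"


section \<open>Haar measure and square-integrable functions\<close>

text \<open>
  Haar measures are nonzero translation-invariant Radon measures on the Borel sets: finite on
  compact sets, outer regular on Borel sets and inner regular on open sets. No countability
  assumption is made on the group, so regularity has to be required.
\<close>

definition haar_measure :: "'a::{topological_ab_group_add,t2_space} measure \<Rightarrow> bool" where
  "haar_measure \<mu> \<longleftrightarrow>
     sets \<mu> = sets borel \<and>
     emeasure \<mu> UNIV \<noteq> 0 \<and>
     (\<forall>K. compact K \<longrightarrow> emeasure \<mu> K < \<infinity>) \<and>
     (\<forall>A\<in>sets borel. emeasure \<mu> A = (INF G\<in>{G. open G \<and> A \<subseteq> G}. emeasure \<mu> G)) \<and>
     (\<forall>G. open G \<longrightarrow> emeasure \<mu> G = (SUP K\<in>{K. compact K \<and> K \<subseteq> G}. emeasure \<mu> K)) \<and>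
     (\<forall>x. \<forall>A\<in>sets borel. emeasure \<mu> ((+) x ` A) = emeasure \<mu> A)"

text \<open>Elements of \<open>L\<^sup>2\<close> are represented by functions; all notions below are invariant under
  equality almost everywhere.\<close>

definition L2_functions :: "'a measure \<Rightarrow> ('a \<Rightarrow> complex) set" where
  "L2_functions \<mu> = {g \<in> borel_measurable \<mu>. integrable \<mu> (\<lambda>\<xi>. (norm (g \<xi>))\<^sup>2)}"

definition L2_norm :: "'a measure \<Rightarrow> ('a \<Rightarrow> complex) \<Rightarrow> real" where
  "L2_norm \<mu> g = sqrt (LINT \<xi>|\<mu>. (norm (g \<xi>))\<^sup>2)"

definition L2_equicontinuous ::
    "'a::topological_ab_group_add measure \<Rightarrow> ('a \<Rightarrow> complex) set \<Rightarrow> bool" where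
  "L2_equicontinuous \<mu> S \<longleftrightarrow>
     (\<forall>\<epsilon>>0. \<exists>V. open V \<and> 0 \<in> V \<and>
        (\<forall>g\<in>S. \<forall>\<eta>\<in>V. L2_norm \<mu> (\<lambda>\<xi>. g (\<xi> - \<eta>) - g \<xi>) < \<epsilon>))"

definition L2_decay :: "'a::topological_space measure \<Rightarrow> ('a \<Rightarrow> complex) set \<Rightarrow> bool" where
  "L2_decay \<mu> S \<longleftrightarrow>
     (\<forall>\<epsilon>>0. \<exists>K. compact K \<and> (\<forall>g\<in>S. (LINT \<xi>:-K|\<mu>. (norm (g \<xi>))\<^sup>2) < \<epsilon>))"


section \<open>Heisenberg multipliers\<close>

definition multiplier ::
    "('a::{topological_ab_group_add,t2_space} \<Rightarrow> 'a \<Rightarrow> complex) \<Rightarrow> bool" where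
  "multiplier m \<longleftrightarrow>
     (\<forall>x y. norm (m x y) = 1) \<and>
     (\<forall>x. continuous_on UNIV (\<lambda>y. m x y)) \<and>
     (\<forall>y. continuous_on UNIV (\<lambda>x. m x y)) \<and>
     (\<forall>x y z. m x y * m (x + y) z = m x (y + z) * m y z) \<and>
     (\<forall>x. m x 0 = 1 \<and> m 0 x = 1)"

definition symplectic :: "('a \<Rightarrow> 'a \<Rightarrow> complex) \<Rightarrow> 'a \<Rightarrow> 'a \<Rightarrow> complex" where
  "symplectic m x y = m x y / m y x"

definition characters :: "('a::topological_ab_group_add \<Rightarrow> complex) set" where
  "characters =
     {f. continuous_on UNIV f \<and> (\<forall>x. norm (f x) = 1) \<and> (\<forall>x y. f (x + y) = f x * f y)}"

text \<open>The Pontryagin dual with the compact-open topology.\<close>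

definition dual_topology :: "('a::topological_ab_group_add \<Rightarrow> complex) topology" where
  "dual_topology =
     topology_generated_by {{f\<in>characters. f ` K \<subseteq> G} |K G. compact K \<and> open G}"

definition bicharacter :: "('a::topological_ab_group_add \<Rightarrow> 'a \<Rightarrow> complex) \<Rightarrow> bool" where
  "bicharacter s \<longleftrightarrow>
     (\<forall>x y. norm (s x y) = 1) \<and>
     (\<forall>x y z. s (x + y) z = s x z * s y z) \<and>
     (\<forall>x y z. s x (y + z) = s x y * s x z)"

text \<open>The map \<open>x \<mapsto> \<sigma>(x, \<cdot>)\<close> is a group homomorphism because \<open>\<sigma>\<close> is a bicharacter.\<close>

definition heisenberg_multiplier ::
    "('a::{topological_ab_group_add,t2_space} \<Rightarrow> 'a \<Rightarrow> complex) \<Rightarrow> bool" where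
  "heisenberg_multiplier m \<longleftrightarrow>
     multiplier m \<and>
     bicharacter (symplectic m) \<and>
     homeomorphic_map euclidean dual_topology (symplectic m)"


section \<open>Projective representations\<close>

definition projective_rep ::
    "('a::topological_ab_group_add \<Rightarrow> 'a \<Rightarrow> complex) \<Rightarrow>
     ('a \<Rightarrow> 'h::complex_hilbert_space \<Rightarrow> 'h) \<Rightarrow> bool" where
  "projective_rep m U \<longleftrightarrow>
     (\<forall>x. unitary_op (U x)) \<and> (\<forall>x y v. U x (U y v) = m x y *\<^sub>C U (x + y) v)"

definition irreducible_rep :: "('a \<Rightarrow> 'h::complex_hilbert_space \<Rightarrow> 'h) \<Rightarrow> bool" where
  "irreducible_rep U \<longleftrightarrow>
     (UNIV :: 'h set) \<noteq> {0} \<and>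
     (\<forall>S. csubspace S \<and> closed S \<and> (\<forall>x. U x ` S \<subseteq> S) \<longrightarrow> S = {0} \<or> S = UNIV)"

definition strongly_continuous_rep ::
    "('a::topological_space \<Rightarrow> 'h::complex_hilbert_space \<Rightarrow> 'h) \<Rightarrow> bool" where
  "strongly_continuous_rep U \<longleftrightarrow> (\<forall>v. continuous_on UNIV (\<lambda>x. U x v))"

definition square_integrable_rep ::
    "'a measure \<Rightarrow> ('a \<Rightarrow> 'h::complex_hilbert_space \<Rightarrow> 'h) \<Rightarrow> bool" where
  "square_integrable_rep \<mu> U \<longleftrightarrow>
     (\<exists>u v. u \<noteq> 0 \<and> v \<noteq> 0 \<and> (\<lambda>x. cinner (U x u) v) \<in> L2_functions \<mu>)"

text \<open>
  The orthogonality relations with constant \<open>1\<close>, which fix the normalization of the Haar measure.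
  With this normalization the Plancherel theorem for the Fourier-Weyl transform is unitary for
  the same measure on the dual side: on rank-one operators its isometry is exactly this relation.
\<close>

definition orthogonality_relations ::
    "'a measure \<Rightarrow> ('a \<Rightarrow> 'h::complex_hilbert_space \<Rightarrow> 'h) \<Rightarrow> bool" where
  "orthogonality_relations \<mu> U \<longleftrightarrow>
     (\<forall>u v u' v'.
        has_bochner_integral \<mu> (\<lambda>x. cinner (U x u) v * cnj (cinner (U x u') v'))
          (cinner u u' * cnj (cinner v v')))"

definition integrable_rep ::
    "'a measure \<Rightarrow> ('a \<Rightarrow> 'h::complex_hilbert_space \<Rightarrow> 'h) \<Rightarrow> bool" where
  "integrable_rep \<mu> U \<longleftrightarrow> (\<exists>v. v \<noteq> 0 \<and> integrable \<mu> (\<lambda>x. cinner (U x v) v))"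

definition op_shift ::
    "('a \<Rightarrow> 'h::complex_hilbert_space \<Rightarrow> 'h) \<Rightarrow> 'a \<Rightarrow> ('h \<Rightarrow> 'h) \<Rightarrow> 'h \<Rightarrow> 'h" where
  "op_shift U x A = U x \<circ> A \<circ> cadjoint (U x)"

definition hs_equicontinuous ::
    "('a::topological_ab_group_add \<Rightarrow> 'h::complex_hilbert_space \<Rightarrow> 'h) \<Rightarrow> ('h \<Rightarrow> 'h) set \<Rightarrow> bool"
  where
  "hs_equicontinuous U F \<longleftrightarrow>
     (\<forall>\<epsilon>>0. \<exists>V. open V \<and> 0 \<in> V \<and> (\<forall>A\<in>F. \<forall>x\<in>V. hs_dist (op_shift U x A) A < \<epsilon>))"


section \<open>The Fourier-Weyl transform\<close>

definition fourier_weyl_trace ::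
    "('a \<Rightarrow> 'h::complex_hilbert_space \<Rightarrow> 'h) \<Rightarrow> ('h \<Rightarrow> 'h) \<Rightarrow> 'a \<Rightarrow> complex" where
  "fourier_weyl_trace U A \<xi> = op_trace (A \<circ> cadjoint (U \<xi>))"

text \<open>
  The extension by continuity from the trace class to the Hilbert-Schmidt class: a representative
  of the \<open>L\<^sup>2\<close> limit of the transforms of trace class operators approximating \<open>A\<close> in
  Hilbert-Schmidt norm.
\<close>

definition fourier_weyl ::
    "'a measure \<Rightarrow> ('a \<Rightarrow> 'h::complex_hilbert_space \<Rightarrow> 'h) \<Rightarrow> ('h \<Rightarrow> 'h) \<Rightarrow> 'a \<Rightarrow> complex" where
  "fourier_weyl \<mu> U A =
     (SOME g. g \<in> L2_functions \<mu> \<and>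
        (\<exists>T :: nat \<Rightarrow> 'h \<Rightarrow> 'h.
           (\<forall>n. T n \<in> trace_class \<and> fourier_weyl_trace U (T n) \<in> L2_functions \<mu>) \<and>
           limitin hs_topology T A sequentially \<and>
           (\<lambda>n. L2_norm \<mu> (\<lambda>\<xi>. fourier_weyl_trace U (T n) \<xi> - g \<xi>)) \<longlonglongrightarrow> 0))"

end

theory Submission
  imports Defs
begin

text \<open>
  The Fourier-Weyl transform sends the rank-one operator \<open>v \<mapsto> \<langle>v, w\<rangle> u\<close> to the matrix coefficient
  \<open>\<xi> \<mapsto> \<langle>u, U\<^sub>\<xi> w\<rangle>\<close>, and the orthogonality relations make it isometric. It turns \<open>\<alpha>\<^sub>x\<close> into
  multiplication by \<open>\<sigma>(x, \<cdot>)\<close>, and \<open>A \<mapsto> A U\<^sub>\<eta>\<close> into translation by \<open>\<eta>\<close> up to a phase \<open>m(\<xi> - \<eta>, \<eta>)\<close>,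
  which is uniformly close to \<open>1\<close> on compact sets for small \<open>\<eta>\<close>. Hence decay gives equicontinuity under
  \<open>\<alpha>\<close>; conversely, averaging \<open>\<alpha>\<^sub>x(A) \<approx> A\<close> over a weight concentrated near \<open>0\<close> multiplies the
  transform by a function vanishing at infinity, so equicontinuity gives decay. With decay at hand,
  translation equicontinuity means \<open>A U\<^sub>\<eta> \<approx> A\<close> uniformly on \<open>F\<close>, and then also \<open>U\<^sub>\<eta> A \<approx> A\<close>. The
  average of \<open>U\<^sub>\<eta>\<close> over a concentrated weight is a Hilbert-Schmidt operator \<open>Q\<close>, so that \<open>A \<approx> A Q\<close> is
  uniformly approximated by finite matrices.
\<close>

text \<open>The measure need not be \<sigma>-finite and the basis may be uncountable. Double
  integrals are therefore avoided: operator averages are defined weakly, averages of \<sigma> are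
  replaced by finite sums, and each Hilbert-Schmidt operator supplies the countable part of the
  basis that it sees. The transform \<open>fourier_weyl\<close> is an arbitrary choice of
  representative, so all that is ever used of it is the predicate \<open>represents\<close>: its
  norm and its pairings with matrix coefficients. That the choice satisfies it, whatever trace class
  sequence came with it, requires rearranging a trace into a series of matrix coefficients; square
  roots and resolvents serve this purpose. In the passage from equicontinuity to decay the compact
  set may not depend on the operator, so it is read off from the weight alone, while the finite sum
  replacing the average may vary with the operator. Approximation by finite matrices truncates
  columns and rows, which is why \<open>A\<close> has to be controlled under multiplication by
  \<open>U\<close> on both sides.\<close>

instance complex_hilbert_space \<subseteq> banach ..

section \<open>Hilbert space geometry\<close>

text \<open>Summability of norms would be too strong a criterion: an orthonormal series with
  square-summable coefficients converges unconditionally without it.\<close>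

lemma summable_on_banach_Cauchy:
  fixes f :: "'a \<Rightarrow> 'b::banach"
  assumes "\<And>e. e > 0 \<Longrightarrow> \<exists>F. finite F \<and> F \<subseteq> A \<and> (\<forall>G. finite G \<longrightarrow> G \<subseteq> A - F \<longrightarrow> norm (sum f G) < e)"
  shows "f summable_on A"
proof -
  have "\<exists>P. eventually P (finite_subsets_at_top A) \<and>
          (\<forall>F F'. P F \<and> P F' \<longrightarrow> dist (sum f F) (sum f F') < e)" if "e > 0" for e :: real
  proof -
    have "e/2 > 0" using that by simp
    from assms[OF this] obtain F0 where F0: "finite F0" "F0 \<subseteq> A"
      and G: "\<And>G. finite G \<Longrightarrow> G \<subseteq> A - F0 \<Longrightarrow> norm (sum f G) < e/2"
      by blast
    have *: "dist (sum f F) (sum f F0) < e/2" if "finite F" "F0 \<subseteq> F" "F \<subseteq> A" for F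
    proof -
      have "dist (sum f F) (sum f F0) = norm (sum f (F - F0))"
        unfolding dist_norm using that by (subst sum_diff) auto
      then show ?thesis using G[of "F - F0"] that by auto
    qed
    show ?thesis
    proof (intro exI[of _ "\<lambda>F. finite F \<and> F0 \<subseteq> F \<and> F \<subseteq> A"] conjI allI impI)
      show "\<forall>\<^sub>F F in finite_subsets_at_top A. finite F \<and> F0 \<subseteq> F \<and> F \<subseteq> A"
        unfolding eventually_finite_subsets_at_top using F0 by blast
      fix F F' assume FF: "(finite F \<and> F0 \<subseteq> F \<and> F \<subseteq> A) \<and> finite F' \<and> F0 \<subseteq> F' \<and> F' \<subseteq> A"
      have "dist (sum f F) (sum f F') \<le> dist (sum f F) (sum f F0) + dist (sum f F') (sum f F0)"
        by (rule dist_triangle2)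
      then show "dist (sum f F) (sum f F') < e"
        using *[of F] *[of F'] FF by auto
    qed
  qed
  then have "cauchy_filter (filtermap (sum f) (finite_subsets_at_top A))"
    by (simp add: cauchy_filter_metric_filtermap)
  moreover have "complete (UNIV::'b set)"
    by (rule complete_UNIV)
  ultimately obtain L' where "(sum f \<longlongrightarrow> L') (finite_subsets_at_top A)"
    using complete_uniform[where S=UNIV] by (force simp add: filterlim_def)
  then show ?thesis
    using summable_on_def has_sum_def by blast
qed

text \<open>The closing step of the duality arguments below: testing a functional on its own
  truncated coefficients bounds a sum of squares by a constant times its own root.\<close>

lemma le_mult_sqrt_imp_le_square:
  assumes "s \<le> c * sqrt s" "s \<ge> 0" "c \<ge> 0"
  shows "s \<le> c\<^sup>2"
proof -
  have "sqrt s \<le> c"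
  proof (cases "s = 0")
    case False
    then have "sqrt s > 0" using assms(2) by simp
    moreover have "sqrt s * sqrt s \<le> c * sqrt s" using assms(1,2) by simp
    ultimately show ?thesis by (rule mult_right_le_imp_le[rotated])
  qed (use assms(3) in simp)
  then show ?thesis using assms(2) by (metis real_sqrt_ge_zero real_sqrt_pow2 power_mono)
qed

lemma cinner_add_right:
  fixes u v w :: "'h::complex_hilbert_space"
  shows "cinner u (v + w) = cinner u v + cinner u w"
  by (metis cinner_add_left cinner_commute complex_cnj_add)

lemma cinner_scaleC_right:
  fixes u v :: "'h::complex_hilbert_space"
  shows "cinner u (c *\<^sub>C v) = cnj c * cinner u v"
  by (metis cinner_scaleC_left cinner_commute complex_cnj_mult)

lemma cinner_scaleR_left:
  fixes u v :: "'h::complex_hilbert_space"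
  shows "cinner (r *\<^sub>R u) v = r *\<^sub>R cinner u v"
  by (simp add: scaleR_scaleC cinner_scaleC_left scaleR_conv_of_real)

lemma cinner_scaleR_right:
  fixes u v :: "'h::complex_hilbert_space"
  shows "cinner u (r *\<^sub>R v) = r *\<^sub>R cinner u v"
  by (simp add: scaleR_scaleC cinner_scaleC_right scaleR_conv_of_real)

lemma cinner_self:
  fixes u :: "'h::complex_hilbert_space"
  shows "cinner u u = complex_of_real ((norm u)\<^sup>2)"
proof (rule complex_eqI)
  show "Re (cinner u u) = Re (complex_of_real ((norm u)\<^sup>2))"
    by (simp add: inner_eq_Re_cinner[symmetric] power2_norm_eq_inner)
  have "Im (cinner u u) = - Im (cinner u u)"
    using cinner_commute[of u u] by (metis cnj.simps(2))
  then show "Im (cinner u u) = Im (complex_of_real ((norm u)\<^sup>2))"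
    by simp
qed

lemma scaleC_one [simp]: "1 *\<^sub>C (v::'h::complex_hilbert_space) = v"
  by (metis of_real_1 scaleR_scaleC scaleR_one)

lemma scaleC_zero_left [simp]: "0 *\<^sub>C (v::'h::complex_hilbert_space) = 0"
  by (metis of_real_0 scaleR_scaleC scaleR_zero_left)

lemma scaleC_zero_right [simp]: "c *\<^sub>C (0::'h::complex_hilbert_space) = 0"
  by (metis add_cancel_right_right scaleC_add_right)

lemma scaleC_minus_one: "(-1) *\<^sub>C (v::'h::complex_hilbert_space) = - v"
  by (metis of_real_1 of_real_minus scaleR_scaleC scaleR_one scaleR_minus_left)

lemma norm_scaleC: "norm (c *\<^sub>C (v::'h::complex_hilbert_space)) = cmod c * norm v"
proof -
  have "complex_of_real ((norm (c *\<^sub>C v))\<^sup>2) = complex_of_real ((cmod c * norm v)\<^sup>2)"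
    unfolding cinner_self[symmetric] cinner_scaleC_left cinner_scaleC_right
    unfolding cinner_self
    by (simp add: power_mult_distrib complex_norm_square flip: of_real_power)
  then have "(norm (c *\<^sub>C v))\<^sup>2 = (cmod c * norm v)\<^sup>2"
    using of_real_eq_iff by blast
  then show ?thesis
    by (simp add: power2_eq_iff_nonneg)
qed

text \<open>The real Cauchy-Schwarz inequality controls only the real part; rotating
  \<open>u\<close> by the unimodular \<open>c\<close> makes the inner product real and
  nonnegative.\<close>

lemma norm_cinner_le:
  fixes u v :: "'h::complex_hilbert_space"
  shows "cmod (cinner u v) \<le> norm u * norm v"
proof (cases "cinner u v = 0")
  case False
  define c where "c = cnj (cinner u v) / cmod (cinner u v)"
  have c: "cmod c = 1" using False by (simp add: c_def norm_divide)
  have "cinner (c *\<^sub>C u) v = complex_of_real (cmod (cinner u v))"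
    using False
    by (simp add: c_def cinner_scaleC_left field_simps complex_norm_square[symmetric] power2_eq_square)
  then have "cmod (cinner u v) = inner (c *\<^sub>C u) v"
    by (simp add: inner_eq_Re_cinner)
  also have "\<dots> \<le> norm (c *\<^sub>C u) * norm v"
    by (rule norm_cauchy_schwarz)
  finally show ?thesis by (simp add: norm_scaleC c)
qed auto

lemma bounded_bilinear_cinner: "bounded_bilinear (cinner :: 'h::complex_hilbert_space \<Rightarrow> 'h \<Rightarrow> complex)"
  by (rule bounded_bilinear.intro)
    (auto simp: cinner_add_left cinner_add_right cinner_scaleR_left cinner_scaleR_right
      intro!: exI[of _ 1] norm_cinner_le)

lemma bounded_bilinear_scaleC: "bounded_bilinear (scaleC :: complex \<Rightarrow> 'h \<Rightarrow> 'h::complex_hilbert_space)"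
  by (rule bounded_bilinear.intro)
    (auto simp: scaleC_add_left scaleC_add_right scaleR_scaleC scaleC_scaleC norm_scaleC scaleR_conv_of_real mult.commute
      intro!: exI[of _ 1])

lemmas tendsto_cinner [tendsto_intros] = bounded_bilinear.tendsto[OF bounded_bilinear_cinner]
lemmas continuous_on_cinner [continuous_intros] = bounded_bilinear.continuous_on[OF bounded_bilinear_cinner]
lemmas cinner_simps [simp] =
  bounded_bilinear.zero_left[OF bounded_bilinear_cinner]
  bounded_bilinear.zero_right[OF bounded_bilinear_cinner]
  bounded_bilinear.minus_left[OF bounded_bilinear_cinner]
  bounded_bilinear.minus_right[OF bounded_bilinear_cinner]
lemmas cinner_diff_left = bounded_bilinear.diff_left[OF bounded_bilinear_cinner]
lemmas cinner_diff_right = bounded_bilinear.diff_right[OF bounded_bilinear_cinner]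
lemmas cinner_sum_left = bounded_bilinear.sum_left[OF bounded_bilinear_cinner]
lemmas cinner_sum_right = bounded_bilinear.sum_right[OF bounded_bilinear_cinner]
lemmas scaleC_diff_right = bounded_bilinear.diff_right[OF bounded_bilinear_scaleC]
lemmas bounded_linear_cinner_left = bounded_bilinear.bounded_linear_left[OF bounded_bilinear_cinner]

lemma cinner_left_eqI:
  fixes u v :: "'h::complex_hilbert_space"
  assumes "\<And>w. cinner u w = cinner v w"
  shows "u = v"
proof -
  have "cinner (u - v) (u - v) = 0" using assms by (simp add: cinner_diff_left)
  then show ?thesis by (simp add: cinner_self)
qed

lemma cinner_right_eqI:
  fixes u v :: "'h::complex_hilbert_space"
  assumes "\<And>w. cinner w u = cinner w v"
  shows "u = v"
  using assms by (intro cinner_left_eqI) (metis cinner_commute)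

lemma norm_diff_sq:
  fixes u v :: "'h::complex_hilbert_space"
  shows "(norm (u - v))\<^sup>2 = (norm u)\<^sup>2 - 2 * Re (cinner u v) + (norm v)\<^sup>2"
  by (simp add: power2_norm_eq_inner inner_diff_left inner_diff_right inner_commute
      flip: inner_eq_Re_cinner)

section \<open>Orthonormal systems: Bessel, Riesz-Fischer and Parseval over an arbitrary index
  set\<close>

definition orthonormal :: "'h::complex_hilbert_space set \<Rightarrow> bool" where
  "orthonormal E \<longleftrightarrow> (\<forall>e\<in>E. \<forall>f\<in>E. cinner e f = (if e = f then 1 else 0))"

lemma orthonormal_norm: "orthonormal E \<Longrightarrow> e \<in> E \<Longrightarrow> norm e = 1"
  unfolding orthonormal_def using cinner_self[of e]
  by (metis norm_ge_zero of_real_eq_1_iff power2_eq_iff_nonneg one_power2 zero_le_one)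

lemma cinner_orthonormal_sum:
  assumes "orthonormal E" "finite J" "J \<subseteq> E" "f \<in> E"
  shows "cinner (\<Sum>e\<in>J. c e *\<^sub>C e) f = (if f \<in> J then c f else 0)"
proof -
  have "cinner (\<Sum>e\<in>J. c e *\<^sub>C e) f = (\<Sum>e\<in>J. if e = f then c e else 0)"
    unfolding cinner_sum_left cinner_scaleC_left
    using assms by (intro sum.cong) (auto simp: orthonormal_def)
  then show ?thesis using assms by simp
qed

lemma norm_orthonormal_sum:
  assumes "orthonormal E" "finite J" "J \<subseteq> E"
  shows "(norm (\<Sum>e\<in>J. c e *\<^sub>C e))\<^sup>2 = (\<Sum>e\<in>J. (cmod (c e))\<^sup>2)"
proof -
  have "cinner (\<Sum>e\<in>J. c e *\<^sub>C e) (\<Sum>f\<in>J. c f *\<^sub>C f) = (\<Sum>f\<in>J. cnj (c f) * c f)"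
    unfolding cinner_sum_right cinner_scaleC_right
    using cinner_orthonormal_sum[OF assms] assms(3) by (intro sum.cong) auto
  then have "complex_of_real ((norm (\<Sum>e\<in>J. c e *\<^sub>C e))\<^sup>2) = complex_of_real (\<Sum>e\<in>J. (cmod (c e))\<^sup>2)"
    unfolding cinner_self by (simp add: complex_norm_square mult.commute flip: of_real_power)
  then show ?thesis using of_real_eq_iff by blast
qed

lemma bessel_finite:
  assumes "orthonormal E" "finite J" "J \<subseteq> E"
  shows "(\<Sum>e\<in>J. (cmod (cinner v e))\<^sup>2) \<le> (norm v)\<^sup>2"
proof -
  let ?w = "\<Sum>e\<in>J. cinner v e *\<^sub>C e"
  have "cinner v ?w = (\<Sum>e\<in>J. cnj (cinner v e) * cinner v e)"
    by (simp add: cinner_sum_right cinner_scaleC_right)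
  also have "\<dots> = complex_of_real (\<Sum>e\<in>J. (cmod (cinner v e))\<^sup>2)"
    by (simp add: complex_norm_square mult.commute flip: of_real_power)
  finally have "(norm (v - ?w))\<^sup>2 = (norm v)\<^sup>2 - (\<Sum>e\<in>J. (cmod (cinner v e))\<^sup>2)"
    by (simp add: norm_diff_sq norm_orthonormal_sum[OF assms])
  then show ?thesis by (metis diff_ge_0_iff_ge zero_le_power2)
qed

lemma nonneg_summable_onI:
  fixes f :: "'a \<Rightarrow> real"
  assumes "\<And>x. x \<in> A \<Longrightarrow> f x \<ge> 0" "\<And>F. finite F \<Longrightarrow> F \<subseteq> A \<Longrightarrow> sum f F \<le> B"
  shows "f summable_on A" "infsum f A \<le> B"
proof -
  show "f summable_on A"
    using assms by (intro nonneg_bdd_above_summable_on) (auto simp: bdd_above_def)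
  then show "infsum f A \<le> B"
    using assms by (intro infsum_le_finite_sums) auto
qed

lemma summable_on_tail:
  fixes f :: "'a \<Rightarrow> real"
  assumes "f summable_on A" "\<And>x. x \<in> A \<Longrightarrow> f x \<ge> 0" "e > 0"
  obtains F where "finite F" "F \<subseteq> A" "\<And>G. finite G \<Longrightarrow> G \<subseteq> A - F \<Longrightarrow> sum f G < e"
proof -
  have "(f has_sum infsum f A) A" using assms(1) by simp
  from has_sum_finite_approximation[OF this, of "e/2"] assms(3)
  obtain F where F: "finite F" "F \<subseteq> A" "dist (sum f F) (infsum f A) \<le> e/2" by auto
  have "sum f G < e" if "finite G" "G \<subseteq> A - F" for G
  proof -
    have "sum f (F \<union> G) \<le> infsum f A"
      using assms that F by (intro finite_sum_le_infsum) auto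
    moreover have "sum f (F \<union> G) = sum f F + sum f G"
      using that F by (intro sum.union_disjoint) auto
    moreover have "infsum f A - sum f F \<le> e/2" using F(3) abs_ge_self[of "infsum f A - sum f F"]
      by (simp add: dist_real_def abs_minus_commute)
    ultimately show ?thesis using assms(3) by linarith
  qed
  then show ?thesis using that F by blast
qed

text \<open>By Pythagoras, the tails of the vector series are the square roots of the tails of the
  coefficient series.\<close>

lemma orthonormal_series_summable:
  assumes "orthonormal E" "(\<lambda>e. (cmod (c e))\<^sup>2) summable_on E"
  shows "(\<lambda>e. c e *\<^sub>C e) summable_on E"
proof (rule summable_on_banach_Cauchy)
  fix \<epsilon> :: real assume e: "\<epsilon> > 0"
  obtain F where F: "finite F" "F \<subseteq> E"
    "\<And>G. finite G \<Longrightarrow> G \<subseteq> E - F \<Longrightarrow> (\<Sum>e\<in>G. (cmod (c e))\<^sup>2) < \<epsilon>\<^sup>2"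
    by (rule summable_on_tail[OF assms(2), of "\<epsilon>\<^sup>2"]) (use e in auto)
  have "norm (\<Sum>e\<in>G. c e *\<^sub>C e) < \<epsilon>" if "finite G" "G \<subseteq> E - F" for G
  proof -
    have "(norm (\<Sum>e\<in>G. c e *\<^sub>C e))\<^sup>2 < \<epsilon>\<^sup>2"
      using F(3)[OF that] that by (subst norm_orthonormal_sum[OF assms(1)]) auto
    then show ?thesis using e by (simp add: power_less_imp_less_base)
  qed
  then show "\<exists>F. finite F \<and> F \<subseteq> E \<and> (\<forall>G. finite G \<longrightarrow> G \<subseteq> E - F \<longrightarrow> norm (\<Sum>e\<in>G. c e *\<^sub>C e) < \<epsilon>)"
    using F by blast
qed

lemma is_onb_orthonormal: "is_onb E \<Longrightarrow> orthonormal E"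
  by (simp add: is_onb_def orthonormal_def)

text \<open>Zorn's lemma: a nonzero vector orthogonal to a maximal orthonormal set could be
  normalized and added to it.\<close>

lemma onb_exists: "\<exists>E :: 'h::complex_hilbert_space set. is_onb E"
proof -
  have "\<Union>C \<in> Collect (orthonormal :: 'h set \<Rightarrow> bool)" if "subset.chain (Collect orthonormal) C" for C :: "'h set set"
  proof -
    have "cinner e f = (if e = f then 1 else 0)" if "e \<in> \<Union>C" "f \<in> \<Union>C" for e f
    proof -
      from that obtain X Y where "X \<in> C" "Y \<in> C" "e \<in> X" "f \<in> Y" by auto
      moreover have "X \<subseteq> Y \<or> Y \<subseteq> X"
        using \<open>subset.chain _ C\<close> \<open>X \<in> C\<close> \<open>Y \<in> C\<close> by (auto simp: subset_chain_def)
      moreover have "orthonormal X" "orthonormal Y"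
        using \<open>subset.chain _ C\<close> \<open>X \<in> C\<close> \<open>Y \<in> C\<close> by (auto simp: subset_chain_def)
      ultimately show ?thesis unfolding orthonormal_def by blast
    qed
    then show ?thesis by (auto simp: orthonormal_def)
  qed
  from subset_Zorn'[OF this] obtain M :: "'h set" where M: "orthonormal M"
    and max: "\<And>X. orthonormal X \<Longrightarrow> M \<subseteq> X \<Longrightarrow> X = M" by auto
  have "v = 0" if v: "\<forall>e\<in>M. cinner v e = 0" for v
  proof (rule ccontr)
    assume "v \<noteq> 0"
    define u where "u = complex_of_real (1 / norm v) *\<^sub>C v"
    have "cinner u u = 1" using \<open>v \<noteq> 0\<close> by (simp add: u_def cinner_self norm_scaleC norm_divide)
    moreover have 1: "cinner u e = 0" if "e \<in> M" for e using v that by (simp add: u_def cinner_scaleC_left)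
    moreover have 2: "cinner e u = 0" if "e \<in> M" for e using 1[OF that] cinner_commute[of e u] by simp
    ultimately have "orthonormal (insert u M)"
      using M by (auto simp: orthonormal_def)
    from max[OF this] have "u \<in> M" by auto
    then show False using 1[of u] \<open>cinner u u = 1\<close> by simp
  qed
  then have "is_onb M" using M by (auto simp: is_onb_def orthonormal_def)
  then show ?thesis by blast
qed

lemma is_onb_some_onb: "is_onb (some_onb :: 'h::complex_hilbert_space set)"
  unfolding some_onb_def using onb_exists by (rule someI_ex)

lemmas orthonormal_some_onb = is_onb_orthonormal[OF is_onb_some_onb]

lemma norm_some_onb: "e \<in> some_onb \<Longrightarrow> norm e = 1"
  by (rule orthonormal_norm[OF orthonormal_some_onb])

text \<open>Bessel makes the series converge to some \<open>w\<close>; then \<open>w - v\<close> is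
  orthogonal to the basis, and the second clause of \<open>is_onb\<close> makes it zero.\<close>

lemma onb_expansion:
  fixes v :: "'h::complex_hilbert_space"
  shows "((\<lambda>e. cinner v e *\<^sub>C e) has_sum v) some_onb"
proof -
  let ?E = "some_onb :: 'h set"
  note E = orthonormal_some_onb
  have "(\<lambda>e. (cmod (cinner v e))\<^sup>2) summable_on ?E"
    by (rule nonneg_summable_onI) (use bessel_finite[OF E] in auto)
  from orthonormal_series_summable[OF E this]
  obtain w where w: "((\<lambda>e. cinner v e *\<^sub>C e) has_sum w) ?E" by (auto simp: summable_on_def)
  have "cinner w f = cinner v f" if f: "f \<in> ?E" for f
  proof -
    have "((\<lambda>e. cinner (cinner v e *\<^sub>C e) f) has_sum cinner w f) ?E"
      by (rule has_sum_bounded_linear[OF bounded_linear_cinner_left w])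
    moreover have "((\<lambda>e. cinner (cinner v e *\<^sub>C e) f) has_sum cinner v f) ?E"
      by (rule has_sum_finite_neutralI[of "{f}"])
         (use E f in \<open>auto simp: cinner_scaleC_left orthonormal_def\<close>)
    ultimately show ?thesis by (rule has_sum_unique)
  qed
  then have "\<forall>f\<in>?E. cinner (w - v) f = 0" by (simp add: cinner_diff_left)
  then have "w - v = 0" using is_onb_some_onb unfolding is_onb_def by blast
  then show ?thesis using w by simp
qed

lemma parseval_cinner:
  fixes u v :: "'h::complex_hilbert_space"
  shows "((\<lambda>e. cinner u e * cinner e v) has_sum cinner u v) some_onb"
  using has_sum_bounded_linear[OF bounded_linear_cinner_left[of v] onb_expansion[of u]]
  by (simp add: cinner_scaleC_left)

lemma parseval_norm:
  fixes u :: "'h::complex_hilbert_space"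
  shows "((\<lambda>e. (cmod (cinner u e))\<^sup>2) has_sum (norm u)\<^sup>2) some_onb"
proof -
  have "(\<lambda>e. cinner u e * cinner e u) = (\<lambda>e. complex_of_real ((cmod (cinner u e))\<^sup>2))"
    by (metis cinner_commute complex_norm_square)
  then show ?thesis using parseval_cinner[of u u]
    by (simp only: cinner_self has_sum_of_real_iff)
qed

section \<open>Bounded operators and adjoints\<close>

lemma bounded_clinearI:
  fixes A :: "'h::complex_hilbert_space \<Rightarrow> 'h"
  assumes "\<And>u v. A (u + v) = A u + A v" "\<And>c v. A (c *\<^sub>C v) = c *\<^sub>C A v"
    "\<And>v. norm (A v) \<le> K * norm v"
  shows "bounded_clinear A"
  unfolding bounded_clinear_def
proof (intro conjI allI)
  show "bounded_linear A"
    by (rule bounded_linear_intro[of _ K]) (use assms in \<open>auto simp: scaleR_scaleC mult.commute\<close>)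
qed (use assms in auto)

lemma bounded_clinear_bounded_linear: "bounded_clinear A \<Longrightarrow> bounded_linear A"
  by (simp add: bounded_clinear_def)

lemma bounded_clinear_simps:
  assumes "bounded_clinear A"
  shows "A (u + v) = A u + A v" "A (u - v) = A u - A v" "A (- v) = - A v" "A 0 = 0"
    "A (c *\<^sub>C v) = c *\<^sub>C A v" "A (\<Sum>i\<in>I. f i) = (\<Sum>i\<in>I. A (f i))"
proof -
  interpret bounded_linear A using assms by (rule bounded_clinear_bounded_linear)
  show "A (u + v) = A u + A v" "A (u - v) = A u - A v" "A (- v) = - A v" "A 0 = 0"
    "A (\<Sum>i\<in>I. f i) = (\<Sum>i\<in>I. A (f i))"
    by (simp_all add: add diff neg zero sum)
  show "A (c *\<^sub>C v) = c *\<^sub>C A v" using assms by (simp add: bounded_clinear_def)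
qed

lemma bounded_clinear_bound:
  assumes "bounded_clinear A"
  obtains K where "K \<ge> 0" "\<And>v. norm (A v) \<le> K * norm v"
  using bounded_linear.nonneg_bounded[OF bounded_clinear_bounded_linear[OF assms]]
  by (metis mult.commute)

lemma bounded_clinear_comp:
  assumes "bounded_clinear A" "bounded_clinear B"
  shows "bounded_clinear (\<lambda>v. A (B v))"
  using assms unfolding bounded_clinear_def by (auto intro: bounded_linear_compose)

lemma bounded_clinear_add:
  assumes "bounded_clinear A" "bounded_clinear B"
  shows "bounded_clinear (\<lambda>v. A v + B v)"
  using assms unfolding bounded_clinear_def by (auto intro: bounded_linear_add simp: scaleC_add_right)

lemma bounded_clinear_diff:
  assumes "bounded_clinear A" "bounded_clinear B"
  shows "bounded_clinear (\<lambda>v. A v - B v)"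
  using assms unfolding bounded_clinear_def by (auto intro: bounded_linear_sub simp: scaleC_diff_right)

lemma bounded_linear_scaleC: "bounded_linear (\<lambda>v::'h::complex_hilbert_space. c *\<^sub>C v)"
  by (rule bounded_bilinear.bounded_linear_right[OF bounded_bilinear_scaleC])

lemma bounded_clinear_scaleC:
  assumes "bounded_clinear A"
  shows "bounded_clinear (\<lambda>v. c *\<^sub>C A v)"
  using assms unfolding bounded_clinear_def
  by (auto intro: bounded_linear_compose[OF bounded_linear_scaleC] simp: scaleC_scaleC mult.commute)

lemma bounded_clinear_id: "bounded_clinear (\<lambda>v. v)"
  unfolding bounded_clinear_def by (auto intro: bounded_linear_ident)

lemma bounded_clinear_zero: "bounded_clinear (\<lambda>v. 0)"
  unfolding bounded_clinear_def by auto

lemma bounded_clinear_rank_one: "bounded_clinear (\<lambda>v. cinner v e *\<^sub>C u)"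
proof (rule bounded_clinearI)
  show "norm (cinner v e *\<^sub>C u) \<le> (norm e * norm u) * norm v" for v
    using mult_right_mono[OF norm_cinner_le[of v e] norm_ge_zero[of u]]
    by (simp add: norm_scaleC mult_ac)
qed (auto simp: cinner_add_left scaleC_add_left cinner_scaleC_left scaleC_scaleC)

lemma bounded_clinear_sum:
  assumes "\<And>i. i \<in> I \<Longrightarrow> bounded_clinear (f i)"
  shows "bounded_clinear (\<lambda>v. \<Sum>i\<in>I. f i v)"
  using assms by (induction I rule: infinite_finite_induct)
    (auto intro: bounded_clinear_zero bounded_clinear_add)

text \<open>Riesz representation for each \<open>u\<close>, with the representing vector written as
  the series with coefficients \<open>\<psi> u e\<close>. Testing \<open>\<psi> u\<close> on a
  finite part of this series gives their square-summability. Used for adjoints, and later for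
  operators defined by weak integrals.\<close>

lemma operator_of_form:
  fixes \<psi> :: "'h::complex_hilbert_space \<Rightarrow> 'h \<Rightarrow> complex"
  assumes addl: "\<And>u u' w. \<psi> (u + u') w = \<psi> u w + \<psi> u' w"
    and scl: "\<And>c u w. \<psi> (c *\<^sub>C u) w = c * \<psi> u w"
    and addr: "\<And>u w w'. \<psi> u (w + w') = \<psi> u w + \<psi> u w'"
    and scr: "\<And>c u w. \<psi> u (c *\<^sub>C w) = cnj c * \<psi> u w"
    and bd: "\<And>u w. cmod (\<psi> u w) \<le> C * norm u * norm w"
    and C: "C \<ge> 0"
  shows "\<exists>B. bounded_clinear B \<and> (\<forall>u w. cinner (B u) w = \<psi> u w) \<and> (\<forall>u. norm (B u) \<le> C * norm u)"
proof -
  let ?E = "some_onb :: 'h set"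
  have E: "orthonormal ?E" by (rule orthonormal_some_onb)
  have bl: "bounded_linear (\<psi> u)" for u
  proof (rule bounded_linear_intro[of _ "C * norm u"])
    show "cmod (\<psi> u x) \<le> norm x * (C * norm u)" for x using bd[of u x] by (simp add: mult_ac)
  qed (use addr scr in \<open>auto simp: scaleR_scaleC scaleR_conv_of_real\<close>)
  have "\<exists>z. \<forall>w. cinner z w = \<psi> u w" for u
  proof -
    have fin: "(\<Sum>e\<in>J. (cmod (\<psi> u e))\<^sup>2) \<le> (C * norm u)\<^sup>2" if J: "finite J" "J \<subseteq> ?E" for J
    proof -
      define S where "S = (\<Sum>e\<in>J. (cmod (\<psi> u e))\<^sup>2)"
      let ?w = "\<Sum>e\<in>J. \<psi> u e *\<^sub>C e"
      have S0: "S \<ge> 0" by (simp add: S_def sum_nonneg)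
      have "\<psi> u ?w = (\<Sum>e\<in>J. cnj (\<psi> u e) * \<psi> u e)"
        using bounded_linear.linear[OF bl[of u]] by (simp add: linear_sum scr)
      also have "\<dots> = complex_of_real S"
        by (simp add: S_def complex_norm_square mult.commute flip: of_real_power)
      finally have "S = cmod (\<psi> u ?w)" using S0 by simp
      also have "\<dots> \<le> C * norm u * norm ?w" by (rule bd)
      also have "norm ?w = sqrt S"
        using norm_orthonormal_sum[OF E J, of "\<psi> u"] by (metis S_def norm_ge_zero real_sqrt_unique)
      finally have "S \<le> (C * norm u) * sqrt S" .
      then show ?thesis
        unfolding S_def[symmetric] by (rule le_mult_sqrt_imp_le_square) (use S0 C in auto)
    qed
    have "(\<lambda>e. (cmod (\<psi> u e))\<^sup>2) summable_on ?E"
      by (rule nonneg_summable_onI) (use fin in auto)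
    from orthonormal_series_summable[OF E this]
    obtain z where z: "((\<lambda>e. \<psi> u e *\<^sub>C e) has_sum z) ?E" by (auto simp: summable_on_def)
    have "cinner z w = \<psi> u w" for w
    proof -
      have "((\<lambda>e. \<psi> u e * cinner e w) has_sum cinner z w) ?E"
        using has_sum_bounded_linear[OF bounded_linear_cinner_left[of w] z] by (simp add: cinner_scaleC_left)
      moreover have "((\<lambda>e. \<psi> u (cinner w e *\<^sub>C e)) has_sum \<psi> u w) ?E"
        by (rule has_sum_bounded_linear[OF bl onb_expansion])
      moreover have "\<psi> u (cinner w e *\<^sub>C e) = \<psi> u e * cinner e w" for e
        by (metis cinner_commute mult.commute scr)
      ultimately show ?thesis using has_sum_unique by simp
    qed
    then show ?thesis by blast
  qed
  then obtain B where B: "\<And>u w. cinner (B u) w = \<psi> u w" by metis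
  have nB: "norm (B u) \<le> C * norm u" for u
  proof -
    have "(norm (B u))\<^sup>2 = cmod (\<psi> u (B u))"
      unfolding B[symmetric] by (simp add: cinner_self norm_power)
    also have "\<dots> \<le> C * norm u * norm (B u)" by (rule bd)
    finally show ?thesis
      using C by (cases "B u = 0") (auto simp: power2_eq_square)
  qed
  have "bounded_clinear B"
    by (rule bounded_clinearI[OF _ _ nB]; rule cinner_left_eqI)
      (simp_all add: cinner_add_left cinner_scaleC_left B addl scl)
  then show ?thesis using B nB by blast
qed

lemma adjoint_exists:
  assumes A: "bounded_clinear A" and K: "K \<ge> 0" "\<And>v. norm (A v) \<le> K * norm v"
  shows "\<exists>B. bounded_clinear B \<and> (\<forall>u v. cinner (A u) v = cinner u (B v)) \<and> (\<forall>u. norm (B u) \<le> K * norm u)"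
proof -
  have "\<exists>B. bounded_clinear B \<and> (\<forall>u w. cinner (B u) w = cinner u (A w)) \<and> (\<forall>u. norm (B u) \<le> K * norm u)"
  proof (rule operator_of_form)
    show "cmod (cinner u (A w)) \<le> K * norm u * norm w" for u w
    proof -
      have "cmod (cinner u (A w)) \<le> norm u * norm (A w)" by (rule norm_cinner_le)
      also have "\<dots> \<le> norm u * (K * norm w)" by (intro mult_left_mono K) auto
      finally show ?thesis by (simp add: mult_ac)
    qed
  qed (use K in \<open>auto simp: cinner_add_left cinner_scaleC_left cinner_add_right cinner_scaleC_right bounded_clinear_simps[OF A]\<close>)
  then obtain B where B: "bounded_clinear B" "\<forall>u. norm (B u) \<le> K * norm u"
    "\<And>u w. cinner (B u) w = cinner u (A w)" by blast
  have "cinner (A u) v = cinner u (B v)" for u v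
    by (metis B(3) cinner_commute)
  then show ?thesis using B by blast
qed

lemma cadjoint_eqI:
  assumes "\<And>u v. cinner (A u) v = cinner u (B v)"
  shows "cadjoint A = B"
  unfolding cadjoint_def
proof (rule the_equality)
  fix C assume "\<forall>u v. cinner (A u) v = cinner u (C v)"
  then show "C = B" by (intro ext cinner_right_eqI) (metis assms)
qed (use assms in blast)

lemma cinner_cadjoint:
  assumes "bounded_clinear A"
  shows "cinner (A u) v = cinner u (cadjoint A v)"
proof -
  obtain K where K: "K \<ge> 0" "\<And>v. norm (A v) \<le> K * norm v" using bounded_clinear_bound[OF assms] by blast
  from adjoint_exists[OF assms K] obtain B where B: "\<And>u v. cinner (A u) v = cinner u (B v)" by blast
  then show ?thesis using cadjoint_eqI[of A B] by simp
qed

lemma cinner_cadjoint_left: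
  assumes "bounded_clinear A"
  shows "cinner (cadjoint A u) v = cinner u (A v)"
  by (metis assms cinner_cadjoint cinner_commute)

lemma norm_cadjoint_le:
  assumes "bounded_clinear A" "K \<ge> 0" "\<And>v. norm (A v) \<le> K * norm v"
  shows "norm (cadjoint A u) \<le> K * norm u"
  using adjoint_exists[OF assms] cadjoint_eqI[of A] by metis

lemma bounded_clinear_cadjoint:
  assumes "bounded_clinear A"
  shows "bounded_clinear (cadjoint A)"
proof -
  obtain K where K: "K \<ge> 0" "\<And>v. norm (A v) \<le> K * norm v" using bounded_clinear_bound[OF assms] by blast
  from adjoint_exists[OF assms K] show ?thesis using cadjoint_eqI[of A] by metis
qed

lemma cadjoint_cadjoint: "bounded_clinear A \<Longrightarrow> cadjoint (cadjoint A) = A"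
  by (rule cadjoint_eqI) (rule cinner_cadjoint_left)

lemma cadjoint_comp:
  assumes "bounded_clinear A" "bounded_clinear B"
  shows "cadjoint (\<lambda>v. A (B v)) = (\<lambda>v. cadjoint B (cadjoint A v))"
  by (rule cadjoint_eqI) (simp add: cinner_cadjoint[OF assms(1)] cinner_cadjoint[OF assms(2)])

lemma cadjoint_diff:
  assumes "bounded_clinear A" "bounded_clinear B"
  shows "cadjoint (\<lambda>v. A v - B v) = (\<lambda>v. cadjoint A v - cadjoint B v)"
  by (rule cadjoint_eqI)
    (simp add: cinner_cadjoint[OF assms(1)] cinner_cadjoint[OF assms(2)] cinner_diff_left cinner_diff_right)

section \<open>Unitary operators and their inverses\<close>

lemma unitary_op_bounded_clinear: "unitary_op V \<Longrightarrow> bounded_clinear V"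
  by (simp add: unitary_op_def)

lemma unitary_op_norm: "unitary_op V \<Longrightarrow> norm (V v) = norm v"
  unfolding unitary_op_def using cinner_self[of "V v"] cinner_self[of v]
  by (metis norm_ge_zero of_real_eq_iff power2_eq_iff_nonneg)

lemma unitary_op_adj_left: "unitary_op V \<Longrightarrow> cadjoint V (V v) = v"
  by (rule cinner_right_eqI) (metis cinner_cadjoint unitary_op_def)

lemma unitary_op_adj_right: "unitary_op V \<Longrightarrow> V (cadjoint V v) = v"
  by (metis surjD unitary_op_adj_left unitary_op_def)

lemma unitary_op_cadjoint: "unitary_op V \<Longrightarrow> unitary_op (cadjoint V)"
  unfolding unitary_op_def[of "cadjoint V"]
proof (intro conjI allI)
  assume V: "unitary_op V"
  note b = unitary_op_bounded_clinear[OF V]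
  show "bounded_clinear (cadjoint V)" by (rule bounded_clinear_cadjoint[OF b])
  show "surj (cadjoint V)" by (metis V surjI unitary_op_adj_left)
  show "cinner (cadjoint V u) (cadjoint V v) = cinner u v" for u v
    using cinner_cadjoint_left[OF b, of u "cadjoint V v"] unitary_op_adj_right[OF V] by simp
qed

section \<open>Hilbert-Schmidt operators\<close>

lemma hs_bounded_clinear: "A \<in> hilbert_schmidt \<Longrightarrow> bounded_clinear A"
  by (simp add: hilbert_schmidt_def)

lemma hs_norm_nonneg [simp]: "0 \<le> hs_norm A"
  by (simp add: hs_norm_def infsum_nonneg)

lemma hs_has_sum: "A \<in> hilbert_schmidt \<Longrightarrow> ((\<lambda>e. (norm (A e))\<^sup>2) has_sum (hs_norm A)\<^sup>2) some_onb"
  by (simp add: hilbert_schmidt_def hs_norm_def infsum_nonneg)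

lemma hs_sum_le:
  assumes "A \<in> hilbert_schmidt" "finite J" "J \<subseteq> some_onb"
  shows "(\<Sum>e\<in>J. (norm (A e))\<^sup>2) \<le> (hs_norm A)\<^sup>2"
  using finite_sum_le_has_sum[OF hs_has_sum[OF assms(1)] assms(2,3)] by simp

lemma hsI:
  assumes "bounded_clinear A" "c \<ge> 0"
    "\<And>J. finite J \<Longrightarrow> J \<subseteq> some_onb \<Longrightarrow> (\<Sum>e\<in>J. (norm (A e))\<^sup>2) \<le> c\<^sup>2"
  shows "A \<in> hilbert_schmidt" "hs_norm A \<le> c"
proof -
  have *: "(\<lambda>e. (norm (A e))\<^sup>2) summable_on some_onb" "(\<Sum>\<^sub>\<infinity>e\<in>some_onb. (norm (A e))\<^sup>2) \<le> c\<^sup>2"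
    using nonneg_summable_onI[of some_onb "\<lambda>e. (norm (A e))\<^sup>2" "c\<^sup>2"] assms(3) by auto
  then show "A \<in> hilbert_schmidt" using assms(1) by (simp add: hilbert_schmidt_def)
  show "hs_norm A \<le> c"
    unfolding hs_norm_def using * assms(2) by (simp add: real_le_lsqrt)
qed

text \<open>Finite matrix blocks suffice: letting \<open>K\<close> grow recovers
  \<open>norm (A e)\<close> by Parseval. The criterion treats rows and columns alike and presupposes
  no summability.\<close>

lemma hs_entryI:
  assumes "bounded_clinear A" "c \<ge> 0"
    "\<And>J K. finite J \<Longrightarrow> J \<subseteq> some_onb \<Longrightarrow> finite K \<Longrightarrow> K \<subseteq> some_onb \<Longrightarrow>
        (\<Sum>e\<in>J. \<Sum>f\<in>K. (cmod (cinner (A e) f))\<^sup>2) \<le> c\<^sup>2"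
  shows "A \<in> hilbert_schmidt" "hs_norm A \<le> c"
proof -
  have "(\<Sum>e\<in>J. (norm (A e))\<^sup>2) \<le> c\<^sup>2" if J: "finite J" "J \<subseteq> some_onb" for J
  proof -
    have "((\<lambda>K. \<Sum>e\<in>J. \<Sum>f\<in>K. (cmod (cinner (A e) f))\<^sup>2) \<longlongrightarrow> (\<Sum>e\<in>J. (norm (A e))\<^sup>2))
       (finite_subsets_at_top some_onb)"
      by (intro tendsto_sum) (use parseval_norm in \<open>simp add: has_sum_def\<close>)
    then show ?thesis
      by (rule tendsto_upperbound) (use assms(3) J in \<open>auto intro: eventually_finite_subsets_at_top_weakI\<close>)
  qed
  then show "A \<in> hilbert_schmidt" "hs_norm A \<le> c" using hsI[OF assms(1,2)] by auto
qed

text \<open>The entries of the adjoint are the conjugated transposed ones, so a finite block is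
  summed in the other order. Equality of norms follows by applying the inequality twice.\<close>

lemma hs_cadjoint:
  assumes "A \<in> hilbert_schmidt"
  shows "cadjoint A \<in> hilbert_schmidt" "hs_norm (cadjoint A) = hs_norm A"
proof -
  have *: "cadjoint A \<in> hilbert_schmidt \<and> hs_norm (cadjoint A) \<le> hs_norm A" if "A \<in> hilbert_schmidt" for A :: "'a \<Rightarrow> 'a"
  proof -
    note b = hs_bounded_clinear[OF that]
    have "(\<Sum>e\<in>J. \<Sum>f\<in>K. (cmod (cinner (cadjoint A e) f))\<^sup>2) \<le> (hs_norm A)\<^sup>2"
      if JK: "finite J" "J \<subseteq> some_onb" "finite K" "K \<subseteq> some_onb" for J K
    proof -
      have "cmod (cinner (cadjoint A e) f) = cmod (cinner (A f) e)" for e f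
        unfolding cinner_cadjoint_left[OF b] by (metis cinner_commute complex_mod_cnj)
      then have "(\<Sum>e\<in>J. \<Sum>f\<in>K. (cmod (cinner (cadjoint A e) f))\<^sup>2) = (\<Sum>f\<in>K. \<Sum>e\<in>J. (cmod (cinner (A f) e))\<^sup>2)"
        by (simp add: sum.swap[of _ K J])
      also have "\<dots> \<le> (\<Sum>f\<in>K. (norm (A f))\<^sup>2)"
        by (intro sum_mono bessel_finite[OF orthonormal_some_onb]) (use JK in auto)
      also have "\<dots> \<le> (hs_norm A)\<^sup>2" by (rule hs_sum_le) (use JK \<open>A \<in> hilbert_schmidt\<close> in auto)
      finally show ?thesis .
    qed
    then show ?thesis using hs_entryI[OF bounded_clinear_cadjoint[OF b]] hs_norm_nonneg by blast
  qed
  show "cadjoint A \<in> hilbert_schmidt" using *[OF assms] by blast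
  have "hs_norm A \<le> hs_norm (cadjoint A)"
    using *[of "cadjoint A"] *[OF assms] by (simp add: cadjoint_cadjoint[OF hs_bounded_clinear[OF assms]])
  then show "hs_norm (cadjoint A) = hs_norm A" using *[OF assms] by simp
qed

lemma hs_add:
  assumes "A \<in> hilbert_schmidt" "B \<in> hilbert_schmidt"
  shows "(\<lambda>v. A v + B v) \<in> hilbert_schmidt" "hs_norm (\<lambda>v. A v + B v) \<le> hs_norm A + hs_norm B"
proof -
  have "(\<Sum>e\<in>J. (norm (A e + B e))\<^sup>2) \<le> (hs_norm A + hs_norm B)\<^sup>2" if J: "finite J" "J \<subseteq> some_onb" for J
  proof -
    have "L2_set (\<lambda>e. norm (A e + B e)) J \<le> L2_set (\<lambda>e. norm (A e) + norm (B e)) J"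
      by (rule L2_set_mono) (auto intro: norm_triangle_ineq)
    also have "\<dots> \<le> L2_set (\<lambda>e. norm (A e)) J + L2_set (\<lambda>e. norm (B e)) J"
      by (rule L2_set_triangle_ineq)
    also have "\<dots> \<le> hs_norm A + hs_norm B"
      using hs_sum_le[OF assms(1) J] hs_sum_le[OF assms(2) J]
      by (intro add_mono) (auto simp: L2_set_def real_le_lsqrt)
    finally have "(L2_set (\<lambda>e. norm (A e + B e)) J)\<^sup>2 \<le> (hs_norm A + hs_norm B)\<^sup>2"
      by (intro power_mono) auto
    then show ?thesis by (simp add: L2_set_def sum_nonneg)
  qed
  then show "(\<lambda>v. A v + B v) \<in> hilbert_schmidt" "hs_norm (\<lambda>v. A v + B v) \<le> hs_norm A + hs_norm B"
    using hsI[of "\<lambda>v. A v + B v" "hs_norm A + hs_norm B"] bounded_clinear_add[OF assms[THEN hs_bounded_clinear]]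
    by (auto simp: add_nonneg_nonneg)
qed

lemma hs_comp_left:
  assumes "A \<in> hilbert_schmidt" "bounded_clinear X" "c \<ge> 0" "\<And>v. norm (X v) \<le> c * norm v"
  shows "(\<lambda>v. X (A v)) \<in> hilbert_schmidt" "hs_norm (\<lambda>v. X (A v)) \<le> c * hs_norm A"
proof -
  have "(\<Sum>e\<in>J. (norm (X (A e)))\<^sup>2) \<le> (c * hs_norm A)\<^sup>2" if J: "finite J" "J \<subseteq> some_onb" for J
  proof -
    have "(\<Sum>e\<in>J. (norm (X (A e)))\<^sup>2) \<le> (\<Sum>e\<in>J. c\<^sup>2 * (norm (A e))\<^sup>2)"
      by (intro sum_mono) (metis assms(4) norm_ge_zero power_mono power_mult_distrib)
    also have "\<dots> \<le> c\<^sup>2 * (hs_norm A)\<^sup>2"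
      unfolding sum_distrib_left[symmetric] by (intro mult_left_mono hs_sum_le[OF assms(1) J]) auto
    finally show ?thesis by (simp add: power_mult_distrib)
  qed
  then show "(\<lambda>v. X (A v)) \<in> hilbert_schmidt" "hs_norm (\<lambda>v. X (A v)) \<le> c * hs_norm A"
    using hsI[OF bounded_clinear_comp[OF assms(2) hs_bounded_clinear[OF assms(1)]], of "c * hs_norm A"] assms(3)
    by auto
qed

text \<open>A factor on the right changes the vectors on which \<open>A\<close> is evaluated, so a
  termwise estimate over the basis fails; taking adjoints moves the factor to the left.\<close>

lemma hs_comp_right:
  assumes "A \<in> hilbert_schmidt" "bounded_clinear X" "c \<ge> 0" "\<And>v. norm (X v) \<le> c * norm v"
  shows "(\<lambda>v. A (X v)) \<in> hilbert_schmidt" "hs_norm (\<lambda>v. A (X v)) \<le> c * hs_norm A"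
proof -
  note A = hs_bounded_clinear[OF assms(1)]
  have eq: "(\<lambda>v. A (X v)) = cadjoint (\<lambda>v. cadjoint X (cadjoint A v))"
    by (subst cadjoint_comp)
       (use A assms in \<open>auto simp: bounded_clinear_cadjoint cadjoint_cadjoint\<close>)
  note H = hs_comp_left[OF hs_cadjoint(1)[OF assms(1)] bounded_clinear_cadjoint[OF assms(2)] assms(3)
     norm_cadjoint_le[OF assms(2-4)]]
  show "(\<lambda>v. A (X v)) \<in> hilbert_schmidt" unfolding eq by (rule hs_cadjoint(1)[OF H(1)])
  show "hs_norm (\<lambda>v. A (X v)) \<le> c * hs_norm A"
    unfolding eq hs_cadjoint(2)[OF H(1)] using H(2) by (simp add: hs_cadjoint(2)[OF assms(1)])
qed

lemma hs_scaleC: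
  assumes "A \<in> hilbert_schmidt"
  shows "(\<lambda>v. c *\<^sub>C A v) \<in> hilbert_schmidt" "hs_norm (\<lambda>v. c *\<^sub>C A v) \<le> cmod c * hs_norm A"
  using hs_comp_left[OF assms bounded_clinear_scaleC[OF bounded_clinear_id], of "cmod c" c]
  by (auto simp: norm_scaleC)

lemma hs_norm_uminus: "hs_norm (\<lambda>v. - A v) = hs_norm A"
  by (simp add: hs_norm_def)

lemma hs_diff:
  assumes "A \<in> hilbert_schmidt" "B \<in> hilbert_schmidt"
  shows "(\<lambda>v. A v - B v) \<in> hilbert_schmidt" "hs_norm (\<lambda>v. A v - B v) \<le> hs_norm A + hs_norm B"
proof -
  have *: "(\<lambda>v. - B v) \<in> hilbert_schmidt"
    using hs_scaleC(1)[OF assms(2), of "-1"] by (simp add: scaleC_minus_one)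
  show "(\<lambda>v. A v - B v) \<in> hilbert_schmidt" "hs_norm (\<lambda>v. A v - B v) \<le> hs_norm A + hs_norm B"
    using hs_add[OF assms(1) *] by (auto simp: hs_norm_uminus)
qed

lemma norm_le_hs_norm:
  assumes "A \<in> hilbert_schmidt"
  shows "norm (A v) \<le> hs_norm A * norm v"
proof -
  note b = hs_bounded_clinear[OF assms]
  note adj = hs_cadjoint[OF assms]
  have "(norm (A v))\<^sup>2 \<le> (hs_norm A * norm v)\<^sup>2"
  proof (rule has_sum_le_finite_sums[OF parseval_norm])
    fix J assume J: "finite J" "J \<subseteq> (some_onb :: 'a set)"
    have "(\<Sum>e\<in>J. (cmod (cinner (A v) e))\<^sup>2) \<le> (\<Sum>e\<in>J. (norm v)\<^sup>2 * (norm (cadjoint A e))\<^sup>2)"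
    proof (rule sum_mono)
      show "(cmod (cinner (A v) e))\<^sup>2 \<le> (norm v)\<^sup>2 * (norm (cadjoint A e))\<^sup>2" for e
        unfolding cinner_cadjoint[OF b] power_mult_distrib[symmetric]
        by (rule power_mono[OF norm_cinner_le]) auto
    qed
    also have "\<dots> \<le> (norm v)\<^sup>2 * (hs_norm A)\<^sup>2"
      unfolding sum_distrib_left[symmetric]
      using hs_sum_le[OF adj(1) J] adj(2) by (intro mult_left_mono) auto
    finally show "(\<Sum>e\<in>J. (cmod (cinner (A v) e))\<^sup>2) \<le> (hs_norm A * norm v)\<^sup>2"
      by (simp add: power_mult_distrib mult.commute)
  qed
  then show ?thesis by (rule power2_le_imp_le) auto
qed

lemma hs_unitary_left:
  assumes "A \<in> hilbert_schmidt" "unitary_op V"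
  shows "(\<lambda>v. V (A v)) \<in> hilbert_schmidt" "hs_norm (\<lambda>v. V (A v)) = hs_norm A"
  using hs_comp_left(1)[OF assms(1) unitary_op_bounded_clinear[OF assms(2)], of 1] assms(2)
  by (auto simp: hs_norm_def unitary_op_norm)

lemma hs_unitary_right:
  assumes "A \<in> hilbert_schmidt" "unitary_op V"
  shows "(\<lambda>v. A (V v)) \<in> hilbert_schmidt" "hs_norm (\<lambda>v. A (V v)) = hs_norm A"
proof -
  have *: "(\<lambda>v. A (V v)) \<in> hilbert_schmidt \<and> hs_norm (\<lambda>v. A (V v)) \<le> hs_norm A"
    if "A \<in> hilbert_schmidt" "unitary_op V" for A V :: "'a \<Rightarrow> 'a"
    using hs_comp_right[OF that(1) unitary_op_bounded_clinear[OF that(2)], of 1] that(2)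
    by (auto simp: unitary_op_norm)
  show 1: "(\<lambda>v. A (V v)) \<in> hilbert_schmidt" using *[OF assms] by blast
  \<comment> \<open>Composing with the inverse unitary gives \<open>A\<close> back, which is the
    reverse inequality.\<close>
  from *[OF 1 unitary_op_cadjoint[OF assms(2)]] *[OF assms]
  show "hs_norm (\<lambda>v. A (V v)) = hs_norm A" by (simp add: unitary_op_adj_right[OF assms(2)])
qed

text \<open>Separation and the triangle inequality are claimed on the carrier only: elsewhere the
  sum in \<open>hs_norm\<close> may diverge, and then \<open>infsum\<close> has the default value
  0.\<close>

interpretation hs: Metric_space "hilbert_schmidt :: ('h::complex_hilbert_space \<Rightarrow> 'h) set" hs_dist
proof
  fix A B C :: "'h \<Rightarrow> 'h"
  show "0 \<le> hs_dist A B" by (simp add: hs_dist_def)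
  show "hs_dist A B = hs_dist B A" by (simp add: hs_dist_def hs_norm_def norm_minus_commute)
  assume A: "A \<in> hilbert_schmidt" and B: "B \<in> hilbert_schmidt"
  show "hs_dist A B = 0 \<longleftrightarrow> A = B"
  proof
    assume "hs_dist A B = 0"
    then have "norm (A v - B v) \<le> 0" for v
      using norm_le_hs_norm[OF hs_diff(1)[OF A B], of v] by (simp add: hs_dist_def)
    then show "A = B" by auto
  qed (simp add: hs_dist_def hs_norm_def)
  assume C: "C \<in> hilbert_schmidt"
  show "hs_dist A C \<le> hs_dist A B + hs_dist B C"
    unfolding hs_dist_def using hs_add(2)[OF hs_diff(1)[OF A B] hs_diff(1)[OF B C]] by simp
qed

lemma hs_limitin:
  "limitin hs_topology \<sigma> (A :: 'h::complex_hilbert_space \<Rightarrow> 'h) sequentially \<longleftrightarrow>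
     A \<in> hilbert_schmidt \<and> (\<forall>\<^sub>F n in sequentially. \<sigma> n \<in> hilbert_schmidt) \<and> (\<lambda>n. hs_dist (\<sigma> n) A) \<longlonglongrightarrow> 0"
proof -
  have "(\<lambda>n. hs_dist (\<sigma> n) A) \<longlonglongrightarrow> 0 \<longleftrightarrow> (\<forall>e>0. \<forall>\<^sub>F n in sequentially. hs_dist (\<sigma> n) A < e)"
    by (simp add: tendsto_iff hs_dist_def)
  then show ?thesis
    unfolding hs.limitin_metric eventually_conj_iff by (metis gt_ex)
qed

text \<open>Since \<open>hs_norm\<close> dominates the operator norm, a pointwise limit
  \<open>A\<close> exists. The Cauchy estimate passes to the limit on each finite part of the basis,
  and \<open>hsI\<close> turns this into membership and distance at once.\<close>

lemma hs_mcomplete: "Metric_space.mcomplete (hilbert_schmidt :: ('h::complex_hilbert_space \<Rightarrow> 'h) set) hs_dist"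
  unfolding hs.mcomplete_def
proof (intro allI impI)
  fix \<sigma> :: "nat \<Rightarrow> 'h \<Rightarrow> 'h"
  assume "hs.MCauchy \<sigma>"
  then have hs: "\<And>n. \<sigma> n \<in> hilbert_schmidt"
    and cau: "\<And>e. e > 0 \<Longrightarrow> \<exists>N. \<forall>n n'. N \<le> n \<longrightarrow> N \<le> n' \<longrightarrow> hs_dist (\<sigma> n) (\<sigma> n') < e"
    unfolding hs.MCauchy_def by auto
  note bc = hs_bounded_clinear[OF hs]
  have dn: "norm (\<sigma> n v - \<sigma> k v) \<le> hs_dist (\<sigma> n) (\<sigma> k) * norm v" for n k v
    unfolding hs_dist_def using norm_le_hs_norm[OF hs_diff(1)[OF hs hs]] .
  have "Cauchy (\<lambda>n. \<sigma> n v)" for v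
  proof (rule metric_CauchyI)
    fix e :: real assume e: "e > 0"
    then have "e / (norm v + 1) > 0" by (simp add: add_nonneg_pos)
    from cau[OF this] obtain N where N: "\<And>n n'. N \<le> n \<Longrightarrow> N \<le> n' \<Longrightarrow> hs_dist (\<sigma> n) (\<sigma> n') < e / (norm v + 1)"
      by blast
    have "dist (\<sigma> n v) (\<sigma> k v) < e" if "n \<ge> N" "k \<ge> N" for n k
    proof -
      have "dist (\<sigma> n v) (\<sigma> k v) \<le> hs_dist (\<sigma> n) (\<sigma> k) * norm v" using dn by (simp add: dist_norm)
      also have "\<dots> \<le> e / (norm v + 1) * norm v" using N[OF that] by (intro mult_right_mono) auto
      also have "\<dots> < e" using e by (simp add: field_simps add_pos_nonneg)
      finally show ?thesis .
    qed
    then show "\<exists>M. \<forall>m\<ge>M. \<forall>n\<ge>M. dist (\<sigma> m v) (\<sigma> n v) < e" by blast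
  qed
  then obtain A where A: "\<And>v. (\<lambda>n. \<sigma> n v) \<longlonglongrightarrow> A v"
    unfolding Cauchy_convergent_iff convergent_def by metis
  have close: "(\<lambda>v. \<sigma> n v - A v) \<in> hilbert_schmidt \<and> hs_norm (\<lambda>v. \<sigma> n v - A v) \<le> e"
    if e: "e > 0" and N: "\<And>n n'. N \<le> n \<Longrightarrow> N \<le> n' \<Longrightarrow> hs_dist (\<sigma> n) (\<sigma> n') < e" "n \<ge> N" for e N n
  proof -
    have nb: "norm (\<sigma> n v - A v) \<le> e * norm v" for v
    proof (rule tendsto_upperbound)
      show "(\<lambda>k. norm (\<sigma> n v - \<sigma> k v)) \<longlonglongrightarrow> norm (\<sigma> n v - A v)" by (intro tendsto_intros A)
      have "norm (\<sigma> n v - \<sigma> k v) \<le> e * norm v" if "k \<ge> N" for k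
        by (rule order.trans[OF dn]) (use N(1)[OF \<open>n \<ge> N\<close> that] in \<open>intro mult_right_mono, auto\<close>)
      then show "\<forall>\<^sub>F k in sequentially. norm (\<sigma> n v - \<sigma> k v) \<le> e * norm v"
        unfolding eventually_sequentially by blast
    qed auto
    have bcd: "bounded_clinear (\<lambda>v. \<sigma> n v - A v)"
    proof (rule bounded_clinearI[OF _ _ nb])
      fix u v :: 'h and c
      have "(\<lambda>k. \<sigma> k u + \<sigma> k v) \<longlonglongrightarrow> A (u + v)"
        using A[of "u + v"] by (simp add: bounded_clinear_simps(1)[OF bc])
      from LIMSEQ_unique[OF this tendsto_add[OF A A]] have "A (u + v) = A u + A v" .
      then show "\<sigma> n (u + v) - A (u + v) = \<sigma> n u - A u + (\<sigma> n v - A v)"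
        by (simp add: bounded_clinear_simps(1)[OF bc])
      have "(\<lambda>k. c *\<^sub>C \<sigma> k v) \<longlonglongrightarrow> A (c *\<^sub>C v)"
        using A[of "c *\<^sub>C v"] by (simp add: bounded_clinear_simps(5)[OF bc])
      from LIMSEQ_unique[OF this bounded_linear.tendsto[OF bounded_linear_scaleC A]]
      have "A (c *\<^sub>C v) = c *\<^sub>C A v" .
      then show "\<sigma> n (c *\<^sub>C v) - A (c *\<^sub>C v) = c *\<^sub>C (\<sigma> n v - A v)"
        by (simp add: bounded_clinear_simps(5)[OF bc] scaleC_diff_right)
    qed
    have "(\<Sum>i\<in>J. (norm (\<sigma> n i - A i))\<^sup>2) \<le> e\<^sup>2" if J: "finite J" "J \<subseteq> some_onb" for J
    proof (rule tendsto_upperbound)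
      show "(\<lambda>k. \<Sum>i\<in>J. (norm (\<sigma> n i - \<sigma> k i))\<^sup>2) \<longlonglongrightarrow> (\<Sum>i\<in>J. (norm (\<sigma> n i - A i))\<^sup>2)"
        by (intro tendsto_intros A)
      have "(\<Sum>i\<in>J. (norm (\<sigma> n i - \<sigma> k i))\<^sup>2) \<le> e\<^sup>2" if "k \<ge> N" for k
      proof -
        have "(\<Sum>i\<in>J. (norm (\<sigma> n i - \<sigma> k i))\<^sup>2) \<le> (hs_dist (\<sigma> n) (\<sigma> k))\<^sup>2"
          unfolding hs_dist_def by (rule hs_sum_le[OF hs_diff(1)[OF hs hs] J])
        also have "\<dots> \<le> e\<^sup>2"
          using N(1)[OF \<open>n \<ge> N\<close> that] by (intro power_mono) (auto simp: hs_dist_def)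
        finally show ?thesis .
      qed
      then show "\<forall>\<^sub>F k in sequentially. (\<Sum>i\<in>J. (norm (\<sigma> n i - \<sigma> k i))\<^sup>2) \<le> e\<^sup>2"
        unfolding eventually_sequentially by blast
    qed auto
    then show ?thesis using hsI[OF bcd, of e] e by auto
  qed
  obtain N1 where N1: "\<And>n n'. N1 \<le> n \<Longrightarrow> N1 \<le> n' \<Longrightarrow> hs_dist (\<sigma> n) (\<sigma> n') < 1" using cau[of 1] by auto
  \<comment> \<open>The limit is written as a difference of two operators already known to be
    Hilbert-Schmidt.\<close>
  have "(\<lambda>v. \<sigma> N1 v - (\<sigma> N1 v - A v)) \<in> hilbert_schmidt"
    by (rule hs_diff(1)[OF hs]) (use close[OF _ N1, of N1] in simp)
  then have "A \<in> hilbert_schmidt" by simp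
  moreover have "\<exists>N. \<forall>n\<ge>N. \<sigma> n \<in> hilbert_schmidt \<and> hs_dist (\<sigma> n) A < e" if "e > 0" for e
  proof -
    from cau[of "e/2"] that obtain N where N: "\<And>n n'. N \<le> n \<Longrightarrow> N \<le> n' \<Longrightarrow> hs_dist (\<sigma> n) (\<sigma> n') < e/2" by auto
    have "hs_dist (\<sigma> n) A < e" if "n \<ge> N" for n
      using close[OF _ N that] \<open>e > 0\<close> by (auto simp: hs_dist_def)
    then show ?thesis using hs by blast
  qed
  ultimately show "\<exists>x. limitin hs_topology \<sigma> x sequentially"
    unfolding hs.limit_metric_sequentially by blast
qed

section \<open>Positive square roots\<close>

text \<open>Polarization: the defect \<open>D\<close> is a sesquilinear form that vanishes on the
  diagonal, because the quadratic form of \<open>A\<close> is real. Expanding at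
  \<open>u + v\<close> and at \<open>u\<close> plus \<i> times \<open>v\<close> makes it vanish
  everywhere.\<close>

lemma positive_op_selfadjoint:
  assumes "positive_op A"
  shows "cinner (A u) v = cinner u (A v)"
proof -
  have b: "bounded_clinear A" and im: "\<And>v. Im (cinner (A v) v) = 0"
    using assms by (auto simp: positive_op_def)
  define D where "D u v = cinner (A u) v - cinner u (A v)" for u v
  have D0: "D v v = 0" for v
    unfolding D_def using im[of v] by (metis cinner_commute cnj.simps complex_eqI diff_self minus_zero)
  have "D (u + v) (u + v) = D u u + D u v + D v u + D v v"
    by (simp add: D_def bounded_clinear_simps[OF b] cinner_add_left cinner_add_right)
  then have 1: "D u v + D v u = 0" by (simp add: D0)
  have "D (u + \<i> *\<^sub>C v) (u + \<i> *\<^sub>C v) = D u u - \<i> * D u v + \<i> * D v u + D v v"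
    by (simp add: D_def bounded_clinear_simps[OF b] cinner_add_left cinner_add_right
        cinner_scaleC_left cinner_scaleC_right algebra_simps)
  then have "\<i> * (D v u - D u v) = 0" by (simp add: D0 algebra_simps)
  with 1 have "D u v = 0" by auto
  then show ?thesis by (simp add: D_def)
qed

lemma positive_op_Re: "positive_op A \<Longrightarrow> 0 \<le> Re (cinner (A v) v)"
  by (simp add: positive_op_def)

lemma positive_op_bounded_clinear: "positive_op A \<Longrightarrow> bounded_clinear A"
  by (simp add: positive_op_def)

text \<open>The operator inequality that the square of \<open>A\<close> is at most \<open>K\<close>
  times \<open>A\<close>, obtained from positivity of the quadratic form at \<open>v\<close> minus
  \<open>A v / K\<close>.\<close>

lemma positive_op_norm_sq_le:
  assumes "positive_op A" "K > 0" "\<And>v. norm (A v) \<le> K * norm v"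
  shows "(norm (A v))\<^sup>2 \<le> K * Re (cinner (A v) v)"
proof -
  note b = positive_op_bounded_clinear[OF assms(1)]
  define s where "s = 1 / K"
  define w where "w = complex_of_real s *\<^sub>C A v"
  have "0 \<le> Re (cinner (A (v - w)) (v - w))" by (rule positive_op_Re[OF assms(1)])
  also have "\<dots> = Re (cinner (A v) v) - 2 * s * (norm (A v))\<^sup>2 + s\<^sup>2 * Re (cinner (A (A v)) (A v))"
    by (simp add: w_def bounded_clinear_simps[OF b] cinner_diff_left cinner_diff_right
        cinner_scaleC_left cinner_scaleC_right positive_op_selfadjoint[OF assms(1)] cinner_self power2_eq_square algebra_simps)
  also have "Re (cinner (A (A v)) (A v)) \<le> K * (norm (A v))\<^sup>2"
  proof -
    have "Re (cinner (A (A v)) (A v)) \<le> norm (A (A v)) * norm (A v)"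
      by (metis inner_eq_Re_cinner norm_cauchy_schwarz)
    also have "\<dots> \<le> (K * norm (A v)) * norm (A v)" by (intro mult_right_mono assms) auto
    finally show ?thesis by (simp add: power2_eq_square)
  qed
  finally have "0 \<le> Re (cinner (A v) v) - 2 * s * (norm (A v))\<^sup>2 + s\<^sup>2 * (K * (norm (A v))\<^sup>2)"
    by (simp add: mult_left_mono)
  also have "\<dots> = Re (cinner (A v) v) - (norm (A v))\<^sup>2 / K"
    using assms(2) by (simp add: s_def field_simps power2_eq_square)
  finally show ?thesis using assms(2) by (simp add: field_simps)
qed

text \<open>The iteration \<open>Y \<mapsto> (X + Y\<^sup>2) / 2\<close> is dominated by its scalar version, which increases to \<open>1\<close>;
  its limit \<open>Y\<close> satisfies \<open>(1 - Y)\<^sup>2 = 1 - X\<close>.\<close>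

fun sqrt_iter :: "('h::complex_hilbert_space \<Rightarrow> 'h) \<Rightarrow> nat \<Rightarrow> 'h \<Rightarrow> 'h" where
  "sqrt_iter X 0 v = 0"
| "sqrt_iter X (Suc n) v = (1/2) *\<^sub>C (X v + sqrt_iter X n (sqrt_iter X n v))"

fun sqrt_bound :: "nat \<Rightarrow> real" where
  "sqrt_bound 0 = 0"
| "sqrt_bound (Suc n) = (1 + (sqrt_bound n)\<^sup>2) / 2"

lemma sqrt_bound_range: "0 \<le> sqrt_bound n \<and> sqrt_bound n \<le> 1"
proof (induction n)
  case (Suc n)
  then have "(sqrt_bound n)\<^sup>2 \<le> 1" by (simp add: power_le_one)
  then show ?case by simp
qed simp

lemma sqrt_bound_mono: "sqrt_bound n \<le> sqrt_bound (Suc n)"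
proof -
  have "0 \<le> (1 - sqrt_bound n)\<^sup>2" by simp
  then show ?thesis by (simp add: power2_eq_square algebra_simps)
qed

lemma sqrt_bound_convergent: "convergent sqrt_bound"
proof (rule Bseq_mono_convergent)
  show "Bseq sqrt_bound" by (rule BseqI'[of _ 1]) (use sqrt_bound_range in auto)
  show "\<forall>m. \<forall>n\<ge>m. sqrt_bound m \<le> sqrt_bound n"
    using sqrt_bound_mono by (metis lift_Suc_mono_le)
qed

context
  fixes X :: "'h::complex_hilbert_space \<Rightarrow> 'h"
  assumes X: "bounded_clinear X" "\<And>v. norm (X v) \<le> norm v"
begin

lemma sqrt_iter_bounded_clinear: "bounded_clinear (sqrt_iter X n)"
proof (induction n)
  case (Suc n)
  from bounded_clinear_scaleC[OF bounded_clinear_add[OF X(1) bounded_clinear_comp[OF this this]]]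
  have "bounded_clinear (\<lambda>v. (1/2) *\<^sub>C (X v + sqrt_iter X n (sqrt_iter X n v)))" .
  moreover have "sqrt_iter X (Suc n) = (\<lambda>v. (1/2) *\<^sub>C (X v + sqrt_iter X n (sqrt_iter X n v)))"
    by (rule ext) simp
  ultimately show ?case by simp
next
  case 0
  have "sqrt_iter X 0 = (\<lambda>v. 0)" by (rule ext) simp
  then show ?case by (simp add: bounded_clinear_zero)
qed

lemma norm_sqrt_iter: "norm (sqrt_iter X n v) \<le> sqrt_bound n * norm v"
proof (induction n arbitrary: v)
  case (Suc n)
  have "norm (sqrt_iter X n (sqrt_iter X n v)) \<le> sqrt_bound n * norm (sqrt_iter X n v)" by (rule Suc)
  also have "\<dots> \<le> sqrt_bound n * (sqrt_bound n * norm v)"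
    using sqrt_bound_range by (intro mult_left_mono Suc) auto
  finally have "norm (X v + sqrt_iter X n (sqrt_iter X n v)) \<le> norm v + sqrt_bound n * (sqrt_bound n * norm v)"
    using X(2)[of v] norm_triangle_ineq[of "X v" "sqrt_iter X n (sqrt_iter X n v)"] by linarith
  then show ?case by (simp add: norm_scaleC power2_eq_square algebra_simps)
qed simp

text \<open>Splitting \<open>Y Y - Z Z\<close> as \<open>Y (Y - Z) + (Y - Z) Z\<close> is valid
  without commutativity and reproduces the scalar bound \<open>y\<^sup>2 - z\<^sup>2\<close>
  exactly.\<close>

lemma sqrt_iter_step:
  "norm (sqrt_iter X (Suc n) v - sqrt_iter X n v) \<le> (sqrt_bound (Suc n) - sqrt_bound n) * norm v"
proof (induction n arbitrary: v)
  case 0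
  then show ?case using X(2)[of v] by (simp add: norm_scaleC)
next
  case (Suc n)
  let ?Y = "sqrt_iter X (Suc n)" and ?Z = "sqrt_iter X n"
  let ?y = "sqrt_bound (Suc n)" and ?z = "sqrt_bound n"
  have d: "0 \<le> ?y - ?z" using sqrt_bound_mono[of n] by simp
  have "sqrt_iter X (Suc (Suc n)) v - ?Y v = (1/2) *\<^sub>C (?Y (?Y v) - ?Z (?Z v))"
    unfolding sqrt_iter.simps(2)[of X "Suc n" v] sqrt_iter.simps(2)[of X n v]
    by (simp add: scaleC_diff_right[symmetric] del: sqrt_iter.simps)
  also have "?Y (?Y v) - ?Z (?Z v) = ?Y (?Y v - ?Z v) + (?Y (?Z v) - ?Z (?Z v))"
    by (simp add: bounded_clinear_simps[OF sqrt_iter_bounded_clinear] del: sqrt_iter.simps)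
  finally have eq: "sqrt_iter X (Suc (Suc n)) v - ?Y v = (1/2) *\<^sub>C (?Y (?Y v - ?Z v) + (?Y (?Z v) - ?Z (?Z v)))" .
  have "norm (?Y (?Y v - ?Z v)) \<le> ?y * norm (?Y v - ?Z v)" by (rule norm_sqrt_iter)
  also have "\<dots> \<le> ?y * ((?y - ?z) * norm v)"
    using sqrt_bound_range[of "Suc n"] by (intro mult_left_mono Suc) auto
  finally have 1: "norm (?Y (?Y v - ?Z v)) \<le> ?y * ((?y - ?z) * norm v)" .
  have "norm (?Y (?Z v) - ?Z (?Z v)) \<le> (?y - ?z) * norm (?Z v)" by (rule Suc)
  also have "\<dots> \<le> (?y - ?z) * (?z * norm v)" by (intro mult_left_mono norm_sqrt_iter d)
  finally have 2: "norm (?Y (?Z v) - ?Z (?Z v)) \<le> (?y - ?z) * (?z * norm v)" .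
  have "norm (sqrt_iter X (Suc (Suc n)) v - ?Y v) \<le> (?y * ((?y - ?z) * norm v) + (?y - ?z) * (?z * norm v)) / 2"
    unfolding eq norm_scaleC
    using 1 2 norm_triangle_ineq[of "?Y (?Y v - ?Z v)" "?Y (?Z v) - ?Z (?Z v)"]
    by (simp del: sqrt_iter.simps sqrt_bound.simps)
  also have "\<dots> = (?y\<^sup>2 - ?z\<^sup>2) / 2 * norm v"
    by (simp add: power2_eq_square field_simps del: sqrt_bound.simps)
  also have "(?y\<^sup>2 - ?z\<^sup>2) / 2 = sqrt_bound (Suc (Suc n)) - ?y"
    by (simp add: field_simps)
  finally show ?case .
qed

text \<open>Each property holds for all iterates and survives strong limits. The clause about
  operators \<open>C\<close> commuting with \<open>X\<close> is recorded for the uniqueness of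
  positive square roots, the one on symmetry for positivity.\<close>

lemma sqrt_iter_limit:
  "\<exists>Y. bounded_clinear Y \<and> (\<forall>v. norm (Y v) \<le> norm v) \<and> (\<forall>v. 2 *\<^sub>C Y v = X v + Y (Y v)) \<and>
       ((\<forall>u v. cinner (X u) v = cinner u (X v)) \<longrightarrow> (\<forall>u v. cinner (Y u) v = cinner u (Y v))) \<and>
       (\<forall>C. bounded_clinear C \<longrightarrow> (\<forall>v. C (X v) = X (C v)) \<longrightarrow> (\<forall>v. C (Y v) = Y (C v)))"
proof -
  have dist: "norm (sqrt_iter X m v - sqrt_iter X n v) \<le> (sqrt_bound m - sqrt_bound n) * norm v" if "n \<le> m" for m n v
    using that
  proof (induction m rule: dec_induct)
    case (step m)
    have "sqrt_iter X (Suc m) v - sqrt_iter X n v =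
       (sqrt_iter X (Suc m) v - sqrt_iter X m v) + (sqrt_iter X m v - sqrt_iter X n v)" by simp
    also have "norm \<dots> \<le> norm (sqrt_iter X (Suc m) v - sqrt_iter X m v) + norm (sqrt_iter X m v - sqrt_iter X n v)"
      by (rule norm_triangle_ineq)
    finally show ?case using step(3) sqrt_iter_step[of m v] by (simp add: algebra_simps del: sqrt_iter.simps sqrt_bound.simps)
  qed simp
  have "Cauchy (\<lambda>n. sqrt_iter X n v)" for v
  proof (rule metric_CauchyI)
    fix e :: real assume e: "e > 0"
    have "Cauchy sqrt_bound" using sqrt_bound_convergent by (simp add: Cauchy_convergent_iff)
    from metric_CauchyD[OF this, of "e / (norm v + 1)"] e
    obtain N where N: "\<And>m n. m \<ge> N \<Longrightarrow> n \<ge> N \<Longrightarrow> dist (sqrt_bound m) (sqrt_bound n) < e / (norm v + 1)"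
      by (auto simp: add_nonneg_pos)
    have "dist (sqrt_iter X m v) (sqrt_iter X n v) < e" if "m \<ge> N" "n \<ge> N" for m n
    proof -
      have "dist (sqrt_iter X m v) (sqrt_iter X n v) \<le> \<bar>sqrt_bound n - sqrt_bound m\<bar> * norm v"
        using dist[of m n v] dist[of n m v] mult_right_mono[OF abs_ge_self[of "sqrt_bound n - sqrt_bound m"], of "norm v"]
          mult_right_mono[OF abs_ge_minus_self[of "sqrt_bound n - sqrt_bound m"], of "norm v"]
        by (cases "m \<le> n") (auto simp: dist_norm norm_minus_commute)
      also have "\<dots> \<le> e / (norm v + 1) * norm v"
        using N[of n m] that by (intro mult_right_mono) (auto simp: dist_real_def)
      also have "\<dots> < e" using e by (simp add: field_simps add_pos_nonneg)
      finally show ?thesis .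
    qed
    then show "\<exists>M. \<forall>m\<ge>M. \<forall>n\<ge>M. dist (sqrt_iter X m v) (sqrt_iter X n v) < e" by blast
  qed
  then obtain Y where Y: "\<And>v. (\<lambda>n. sqrt_iter X n v) \<longlonglongrightarrow> Y v"
    unfolding Cauchy_convergent_iff convergent_def by metis
  have n1: "norm (sqrt_iter X n v) \<le> norm v" for n v
    using norm_sqrt_iter[of n v] mult_right_mono[of "sqrt_bound n" 1 "norm v"] sqrt_bound_range[of n] by simp
  have nY: "norm (Y v) \<le> 1 * norm v" for v
    using tendsto_upperbound[OF tendsto_norm[OF Y]] n1 by (simp add: eventually_sequentially)
  have bY: "bounded_clinear Y"
  proof (rule bounded_clinearI[OF _ _ nY])
    fix u v :: 'h and c
    have "(\<lambda>n. sqrt_iter X n u + sqrt_iter X n v) \<longlonglongrightarrow> Y (u + v)"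
      using Y[of "u + v"] by (simp add: bounded_clinear_simps(1)[OF sqrt_iter_bounded_clinear])
    from LIMSEQ_unique[OF this tendsto_add[OF Y Y]] show "Y (u + v) = Y u + Y v" .
    have "(\<lambda>k. c *\<^sub>C sqrt_iter X k v) \<longlonglongrightarrow> Y (c *\<^sub>C v)"
      using Y[of "c *\<^sub>C v"] by (simp add: bounded_clinear_simps(5)[OF sqrt_iter_bounded_clinear])
    from LIMSEQ_unique[OF this bounded_linear.tendsto[OF bounded_linear_scaleC Y]]
    show "Y (c *\<^sub>C v) = c *\<^sub>C Y v" .
  qed
  have YY: "(\<lambda>n. sqrt_iter X n (sqrt_iter X n v)) \<longlonglongrightarrow> Y (Y v)" for v
  proof -
    \<comment> \<open>Strong limits of products need uniform boundedness: the iterates are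
      contractions, so the moving outer factor does no harm.\<close>
    have "(\<lambda>n. sqrt_iter X n (sqrt_iter X n v - Y v)) \<longlonglongrightarrow> 0"
    proof (rule Lim_null_comparison)
      show "\<forall>\<^sub>F n in sequentially. norm (sqrt_iter X n (sqrt_iter X n v - Y v)) \<le> norm (sqrt_iter X n v - Y v)"
        by (simp add: n1)
      show "(\<lambda>n. norm (sqrt_iter X n v - Y v)) \<longlonglongrightarrow> 0"
        using Y[of v] LIM_zero tendsto_norm_zero by blast
    qed
    from tendsto_add[OF this Y[of "Y v"]] show ?thesis
      by (simp add: bounded_clinear_simps(2)[OF sqrt_iter_bounded_clinear])
  qed
  have fix_eq: "2 *\<^sub>C Y v = X v + Y (Y v)" for v
  proof -
    have "(\<lambda>n. 2 *\<^sub>C sqrt_iter X (Suc n) v) \<longlonglongrightarrow> 2 *\<^sub>C Y v"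
      by (intro bounded_linear.tendsto[OF bounded_linear_scaleC] LIMSEQ_Suc Y)
    moreover have "(\<lambda>n. 2 *\<^sub>C sqrt_iter X (Suc n) v) = (\<lambda>n. X v + sqrt_iter X n (sqrt_iter X n v))"
      by (simp add: scaleC_scaleC)
    ultimately show ?thesis using LIMSEQ_unique tendsto_add[OF tendsto_const YY[of v]] by metis
  qed
  have comm: "C (Y v) = Y (C v)" if C: "bounded_clinear C" "\<And>v. C (X v) = X (C v)" for C v
  proof -
    have "C (sqrt_iter X n v) = sqrt_iter X n (C v)" for n v
      by (induction n arbitrary: v) (simp_all add: bounded_clinear_simps[OF C(1)] C(2))
    then have "(\<lambda>n. sqrt_iter X n (C v)) \<longlonglongrightarrow> C (Y v)"
      using bounded_linear.tendsto[OF bounded_clinear_bounded_linear[OF C(1)] Y[of v]] by simp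
    then show ?thesis using LIMSEQ_unique Y by blast
  qed
  have self: "cinner (Y u) v = cinner u (Y v)" if X: "\<forall>u v. cinner (X u) v = cinner u (X v)" for u v
  proof -
    have "cinner (sqrt_iter X n u) v = cinner u (sqrt_iter X n v)" for n u v
      by (induction n arbitrary: u v)
        (simp_all add: X cinner_scaleC_left cinner_scaleC_right cinner_add_left cinner_add_right)
    then have "(\<lambda>n. cinner u (sqrt_iter X n v)) \<longlonglongrightarrow> cinner (Y u) v"
      using tendsto_cinner[OF Y[of u] tendsto_const[of v]] by simp
    then show ?thesis using LIMSEQ_unique tendsto_cinner[OF tendsto_const Y] by blast
  qed
  show ?thesis using bY nY fix_eq comm self by auto
qed

end

text \<open>For \<open>K\<close> large, \<open>X = 1 - A / K\<close> is a contraction. The fixed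
  point equation for \<open>Y\<close> says that \<open>1 - Y\<close> squares to
  \<open>1 - X = A / K\<close>, and \<open>1 - Y\<close> is positive because \<open>Y\<close> is a
  symmetric contraction.\<close>

lemma positive_sqrt_exists:
  fixes A :: "'h::complex_hilbert_space \<Rightarrow> 'h"
  assumes A: "positive_op A"
  shows "\<exists>B. positive_op B \<and> (\<forall>v. B (B v) = A v) \<and>
     (\<forall>C. bounded_clinear C \<longrightarrow> (\<forall>v. C (A v) = A (C v)) \<longrightarrow> (\<forall>v. C (B v) = B (C v)))"
proof -
  note b = positive_op_bounded_clinear[OF A]
  obtain K0 where K0: "K0 \<ge> 0" "\<And>v. norm (A v) \<le> K0 * norm v" using bounded_clinear_bound[OF b] by blast
  \<comment> \<open>The added 1 keeps \<open>K\<close> positive even for the zero operator.\<close>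
  define K where "K = K0 + 1"
  have K: "K > 0" "\<And>v. norm (A v) \<le> K * norm v"
    using K0 by (auto simp: K_def algebra_simps intro: add_increasing)
  define c where "c = complex_of_real (1 / K)"
  define X where "X v = v - c *\<^sub>C A v" for v
  have bX: "bounded_clinear X" unfolding X_def
    by (intro bounded_clinear_diff bounded_clinear_id bounded_clinear_scaleC b)
  have nX: "norm (X v) \<le> norm v" for v
  proof -
    have "(norm (X v))\<^sup>2 = (norm v)\<^sup>2 - 2 / K * Re (cinner (A v) v) + (1/K)\<^sup>2 * (norm (A v))\<^sup>2"
      unfolding X_def norm_diff_sq
      by (simp add: cinner_scaleC_right c_def norm_scaleC power_mult_distrib norm_divide
        positive_op_selfadjoint[OF A, symmetric] power_divide K(1))
    also have "\<dots> \<le> (norm v)\<^sup>2 - 2 / K * Re (cinner (A v) v) + (1/K)\<^sup>2 * (K * Re (cinner (A v) v))"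
      by (intro add_left_mono mult_left_mono positive_op_norm_sq_le A K) auto
    also have "\<dots> = (norm v)\<^sup>2 - Re (cinner (A v) v) / K"
      using K(1) by (simp add: power2_eq_square field_simps)
    also have "\<dots> \<le> (norm v)\<^sup>2" using positive_op_Re[OF A, of v] K(1) by simp
    finally show ?thesis by (rule power2_le_imp_le) simp
  qed
  obtain Y where Y: "bounded_clinear Y" "\<And>v. norm (Y v) \<le> norm v" "\<And>v. 2 *\<^sub>C Y v = X v + Y (Y v)"
    "\<And>C v. bounded_clinear C \<Longrightarrow> (\<forall>v. C (X v) = X (C v)) \<Longrightarrow> C (Y v) = Y (C v)"
    "(\<forall>u v. cinner (X u) v = cinner u (X v)) \<Longrightarrow> \<forall>u v. cinner (Y u) v = cinner u (Y v)"
    using sqrt_iter_limit[OF bX nX] by blast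
  define s where "s = complex_of_real (sqrt K)"
  have s2: "s * s = complex_of_real K" using K(1) by (simp add: s_def flip: of_real_mult)
  define B where "B v = s *\<^sub>C (v - Y v)" for v
  have bB: "bounded_clinear B" unfolding B_def
    by (intro bounded_clinear_diff bounded_clinear_id bounded_clinear_scaleC Y)
  have BB: "B (B v) = A v" for v
  proof -
    have two: "2 *\<^sub>C Y v = Y v + Y v"
      by (metis one_add_one scaleC_add_left scaleC_one)
    have "B (B v) = (s * s) *\<^sub>C (v - (Y v + Y v) + Y (Y v))"
      by (simp add: B_def bounded_clinear_simps[OF Y(1)] scaleC_diff_right[symmetric] scaleC_scaleC)
        (simp add: algebra_simps)
    also have "\<dots> = (s * s) *\<^sub>C (v - X v)" using Y(3)[of v] unfolding two by simp
    also have "\<dots> = A v" using K(1) by (simp add: X_def scaleC_scaleC s2 c_def)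
    finally show ?thesis .
  qed
  have selfX: "\<forall>u v. cinner (X u) v = cinner u (X v)"
    by (simp add: X_def cinner_diff_left cinner_diff_right cinner_scaleC_left cinner_scaleC_right c_def
       positive_op_selfadjoint[OF A])
  have "positive_op B"
    unfolding positive_op_def
  proof (intro conjI allI bB)
    fix v
    have ImY: "Im (cinner (Y v) v) = 0"
      using Y(5)[OF selfX] by (metis Reals_cnj_iff cinner_commute complex_is_Real_iff)
    have "Re (cinner (Y v) v) \<le> norm (Y v) * norm v"
      by (metis inner_eq_Re_cinner norm_cauchy_schwarz)
    also have "\<dots> \<le> (norm v)\<^sup>2" unfolding power2_eq_square by (intro mult_right_mono Y(2)) auto
    finally have ReY: "Re (cinner (Y v) v) \<le> (norm v)\<^sup>2" .
    have pos: "cinner (B v) v = s * (complex_of_real ((norm v)\<^sup>2) - cinner (Y v) v)"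
      by (simp add: B_def cinner_scaleC_left cinner_diff_left cinner_self)
    show "Im (cinner (B v) v) = 0" using ImY by (simp add: pos s_def)
    show "0 \<le> Re (cinner (B v) v)" using ReY K(1) by (simp add: pos s_def)
  qed
  moreover have "C (B v) = B (C v)" if C: "bounded_clinear C" "\<forall>v. C (A v) = A (C v)" for C v
  proof -
    have "\<forall>v. C (X v) = X (C v)" by (simp add: X_def bounded_clinear_simps[OF C(1)] C(2))
    from Y(4)[OF C(1) this] show ?thesis by (simp add: B_def bounded_clinear_simps[OF C(1)])
  qed
  ultimately show ?thesis using BB by blast
qed

text \<open>Both roots are compared with the constructed root \<open>D\<close>, which commutes with
  everything that commutes with the square. For \<open>y = C x - D x\<close> one gets
  \<open>C y + D y = 0\<close>, so both quadratic forms vanish at \<open>y\<close>, hence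
  \<open>C y = D y = 0\<close>, and \<open>cinner y y = cinner x (C y - D y) = 0\<close>.\<close>

lemma positive_sqrt_unique:
  assumes B: "positive_op B" and C: "positive_op C" and eq: "\<And>v. B (B v) = C (C v)"
  shows "B = C"
proof -
  obtain D where D: "positive_op D" "\<And>v. D (D v) = B (B v)"
    and comm: "\<And>C v. bounded_clinear C \<Longrightarrow> \<forall>v. C (B (B v)) = B (B (C v)) \<Longrightarrow> C (D v) = D (C v)"
  proof -
    have "positive_op (\<lambda>v. B (B v))"
      unfolding positive_op_def
      using bounded_clinear_comp[OF positive_op_bounded_clinear[OF B] positive_op_bounded_clinear[OF B]]
      by (simp add: positive_op_selfadjoint[OF B] cinner_self)
    from positive_sqrt_exists[OF this] show ?thesis using that by blast
  qed
  have *: "C = D" if C: "positive_op C" "\<And>v. C (C v) = B (B v)" for C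
  proof
    fix x
    note bC = positive_op_bounded_clinear[OF C(1)] and bD = positive_op_bounded_clinear[OF D(1)]
    have CD: "C (D v) = D (C v)" for v
      by (rule comm[OF bC]) (metis C(2))
    define y where "y = C x - D x"
    have "cinner (C y) y + cinner (D y) y = 0"
    proof -
      have "C y + D y = 0"
        unfolding y_def by (simp add: bounded_clinear_simps[OF bC] bounded_clinear_simps[OF bD] CD C(2) D(2))
      then show ?thesis by (metis cinner_add_left cinner_simps(1))
    qed
    then have "Re (cinner (C y) y) + Re (cinner (D y) y) = 0" by (metis plus_complex.simps(1) zero_complex.simps(1))
    then have z: "Re (cinner (C y) y) = 0" "Re (cinner (D y) y) = 0"
      using positive_op_Re[OF C(1), of y] positive_op_Re[OF D(1), of y] by linarith+
    have ker: "P y = 0" if P: "positive_op P" "Re (cinner (P y) y) = 0" for P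
    proof -
      obtain K where K: "K \<ge> 0" "\<And>v. norm (P v) \<le> K * norm v"
        using bounded_clinear_bound[OF positive_op_bounded_clinear[OF P(1)]] by blast
      have "(norm (P y))\<^sup>2 \<le> (K + 1) * Re (cinner (P y) y)"
        by (rule positive_op_norm_sq_le[OF P(1)])
           (use K in \<open>auto simp: algebra_simps intro: add_increasing\<close>)
      then show ?thesis using P(2) by simp
    qed
    have "cinner y y = cinner x (C y) - cinner x (D y)"
      by (metis C(1) D(1) cinner_diff_left positive_op_selfadjoint y_def)
    also have "\<dots> = 0" using ker[OF C(1) z(1)] ker[OF D(1) z(2)] by simp
    finally show "C x = D x" by (simp add: cinner_self y_def)
  qed
  have "B = D" by (rule *[OF B]) simp
  moreover have "C = D" by (rule *[OF C]) (simp add: eq)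
  ultimately show ?thesis by simp
qed

lemma abs_op:
  assumes A: "bounded_clinear A"
  shows "positive_op (abs_op A)" "abs_op A (abs_op A v) = cadjoint A (A v)" "norm (abs_op A v) = norm (A v)"
proof -
  have "positive_op (\<lambda>v. cadjoint A (A v))"
    unfolding positive_op_def
    using bounded_clinear_comp[OF bounded_clinear_cadjoint[OF A] A]
    by (simp add: cinner_cadjoint_left[OF A] cinner_self)
  from positive_sqrt_exists[OF this] obtain B where B: "positive_op B" "\<And>v. B (B v) = cadjoint A (A v)"
    by blast
  have "abs_op A = B"
    unfolding abs_op_def
  proof (rule the_equality)
    show "positive_op B \<and> B \<circ> B = cadjoint A \<circ> A" using B by auto
    fix C assume "positive_op C \<and> C \<circ> C = cadjoint A \<circ> A"
    then show "C = B" using B by (intro positive_sqrt_unique) (auto simp: fun_eq_iff)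
  qed
  then show 1: "positive_op (abs_op A)" and 2: "abs_op A (abs_op A v) = cadjoint A (A v)" using B by auto
  have "cinner (abs_op A v) (abs_op A v) = cinner (A v) (A v)"
    by (metis 1 2 A cinner_cadjoint positive_op_selfadjoint)
  then have "(norm (abs_op A v))\<^sup>2 = (norm (A v))\<^sup>2" unfolding cinner_self using of_real_eq_iff by blast
  then show "norm (abs_op A v) = norm (A v)" by simp
qed

section \<open>Coordinate projections and trace class operators\<close>

lemma has_sum_diff:
  fixes f g :: "'a \<Rightarrow> 'b::topological_ab_group_add"
  assumes "(f has_sum a) A" "(g has_sum b) A"
  shows "((\<lambda>x. f x - g x) has_sum (a - b)) A"
proof -
  have "sum (\<lambda>x. f x - g x) = (\<lambda>F. sum f F - sum g F)" by (rule ext) (rule sum_subtractf)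
  then show ?thesis using assms unfolding has_sum_def by (simp add: tendsto_diff)
qed

text \<open>For finite \<open>J\<close> inside the fixed basis this is the orthogonal projection
  onto the span. Composing an operator with it on the right keeps the columns in
  \<open>J\<close>.\<close>

definition coord_proj :: "'h::complex_hilbert_space set \<Rightarrow> 'h \<Rightarrow> 'h" where
  "coord_proj J v = (\<Sum>f\<in>J. cinner v f *\<^sub>C f)"

lemma bounded_clinear_coord_proj: "bounded_clinear (coord_proj J)"
  unfolding coord_proj_def[abs_def] by (intro bounded_clinear_sum bounded_clinear_rank_one)

lemma coord_proj_onb:
  assumes "finite J" "J \<subseteq> some_onb" "e \<in> some_onb"
  shows "coord_proj J e = (if e \<in> J then e else 0)"
proof -
  have "coord_proj J e = (\<Sum>f\<in>J. if f = e then e else 0)"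
    unfolding coord_proj_def
    using assms orthonormal_some_onb unfolding orthonormal_def by (intro sum.cong) auto
  then show ?thesis using assms(1) by simp
qed

lemma cinner_coord_proj_left: "cinner (coord_proj J u) v = (\<Sum>f\<in>J. cinner u f * cinner f v)"
  by (simp add: coord_proj_def cinner_sum_left cinner_scaleC_left)

lemma cadjoint_coord_proj: "cadjoint (coord_proj J) = coord_proj J"
proof (rule cadjoint_eqI)
  fix u v
  have "cinner u (coord_proj J v) = (\<Sum>f\<in>J. cnj (cinner v f) * cinner u f)"
    by (simp add: coord_proj_def cinner_sum_right cinner_scaleC_right)
  also have "\<dots> = (\<Sum>f\<in>J. cinner u f * cinner f v)"
    by (intro sum.cong refl) (metis cinner_commute mult.commute)
  finally show "cinner (coord_proj J u) v = cinner u (coord_proj J v)"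
    by (simp add: cinner_coord_proj_left)
qed

lemma norm_coord_proj_le:
  assumes "finite J" "J \<subseteq> some_onb"
  shows "norm (coord_proj J v) \<le> norm v"
proof -
  have "(norm (coord_proj J v))\<^sup>2 \<le> (norm v)\<^sup>2"
    unfolding coord_proj_def norm_orthonormal_sum[OF orthonormal_some_onb assms]
    by (rule bessel_finite[OF orthonormal_some_onb assms])
  then show ?thesis by (rule power2_le_imp_le) simp
qed

lemma hs_comp_coord_proj:
  assumes "A \<in> hilbert_schmidt" "finite J" "J \<subseteq> some_onb"
  shows "(\<lambda>v. A (coord_proj J v)) \<in> hilbert_schmidt"
  using hs_comp_right(1)[OF assms(1) bounded_clinear_coord_proj, of 1] norm_coord_proj_le[OF assms(2,3)]
  by simp

lemma hs_norm_comp_coord_proj: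
  assumes "bounded_clinear A" "finite J" "J \<subseteq> some_onb"
  shows "(hs_norm (\<lambda>v. A (coord_proj J v)))\<^sup>2 = (\<Sum>e\<in>J. (norm (A e))\<^sup>2)"
proof -
  have "((\<lambda>e. (norm (A (coord_proj J e)))\<^sup>2) has_sum (\<Sum>e\<in>J. (norm (A e))\<^sup>2)) some_onb"
    by (rule has_sum_finite_neutralI[of J])
       (use assms in \<open>auto simp: coord_proj_onb subsetD bounded_clinear_simps[OF assms(1)] intro!: sum.cong\<close>)
  from infsumI[OF this] show ?thesis by (simp add: hs_norm_def infsum_nonneg sum_nonneg)
qed

text \<open>Kept as an equality because the same tail reappears as the \<open>L2\<close> distance
  between a transform and its finite partial sums.\<close>

lemma hs_coord_proj_tail:
  assumes "A \<in> hilbert_schmidt" "finite J" "J \<subseteq> some_onb"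
  shows "(\<lambda>v. A v - A (coord_proj J v)) \<in> hilbert_schmidt"
    "(hs_norm (\<lambda>v. A v - A (coord_proj J v)))\<^sup>2 = (hs_norm A)\<^sup>2 - (\<Sum>e\<in>J. (norm (A e))\<^sup>2)"
proof -
  show 1: "(\<lambda>v. A v - A (coord_proj J v)) \<in> hilbert_schmidt"
    by (intro hs_diff(1) assms(1) hs_comp_coord_proj assms)
  note b = hs_bounded_clinear[OF assms(1)]
  have "((\<lambda>e. (norm (A e))\<^sup>2 - (if e \<in> J then (norm (A e))\<^sup>2 else 0)) has_sum
         ((hs_norm A)\<^sup>2 - (\<Sum>e\<in>J. (norm (A e))\<^sup>2))) some_onb"
  proof (rule has_sum_diff[OF hs_has_sum[OF assms(1)]])
    show "((\<lambda>e. if e \<in> J then (norm (A e))\<^sup>2 else 0) has_sum (\<Sum>e\<in>J. (norm (A e))\<^sup>2)) some_onb"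
      by (rule has_sum_finite_neutralI[of J]) (use assms in auto)
  qed
  moreover have "((\<lambda>e. (norm (A e))\<^sup>2 - (if e \<in> J then (norm (A e))\<^sup>2 else 0)) has_sum
      (hs_norm (\<lambda>v. A v - A (coord_proj J v)))\<^sup>2) some_onb
    \<longleftrightarrow> ((\<lambda>e. (norm (A e - A (coord_proj J e)))\<^sup>2) has_sum
      (hs_norm (\<lambda>v. A v - A (coord_proj J v)))\<^sup>2) some_onb"
    by (rule has_sum_cong) (simp add: coord_proj_onb[OF assms(2,3)] bounded_clinear_simps[OF b])
  ultimately show "(hs_norm (\<lambda>v. A v - A (coord_proj J v)))\<^sup>2 = (hs_norm A)\<^sup>2 - (\<Sum>e\<in>J. (norm (A e))\<^sup>2)"
    using hs_has_sum[OF 1] has_sum_unique by blast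
qed

text \<open>\<open>abs_op\<close> has the same norm on each vector as the operator itself, so it
  kills the basis vectors outside \<open>J\<close> and the trace has finitely many nonzero
  terms.\<close>

lemma coord_proj_trace_class:
  assumes A: "bounded_clinear A" and J: "finite J" "J \<subseteq> some_onb"
  shows "(\<lambda>v. A (coord_proj J v)) \<in> trace_class"
proof -
  have b: "bounded_clinear (\<lambda>v. A (coord_proj J v))"
    by (rule bounded_clinear_comp[OF A bounded_clinear_coord_proj])
  have "(\<lambda>e. Re (cinner (abs_op (\<lambda>v. A (coord_proj J v)) e) e)) summable_on some_onb"
  proof (rule finite_nonzero_values_imp_summable_on, rule finite_subset[OF _ J(1)], rule subsetI)
    fix e assume e: "e \<in> {x \<in> some_onb. Re (cinner (abs_op (\<lambda>v. A (coord_proj J v)) x) x) \<noteq> 0}"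
    show "e \<in> J"
    proof (rule ccontr)
      assume "e \<notin> J"
      then have "norm (abs_op (\<lambda>v. A (coord_proj J v)) e) = 0"
        unfolding abs_op(3)[OF b] using e by (simp add: coord_proj_onb[OF J] bounded_clinear_simps[OF A])
      then show False using e by simp
    qed
  qed
  then show ?thesis using b by (simp add: trace_class_def)
qed

text \<open>\<open>S\<close> is the inverse of \<open>R + \<delta>\<close>, found by Banach's fixed
  point theorem. Uniqueness of the fixed point yields linearity of \<open>S\<close> and its
  commutation with \<open>R\<close>.\<close>

lemma resolvent_exists:
  fixes R :: "'h::complex_hilbert_space \<Rightarrow> 'h"
  assumes R: "positive_op R" and \<delta>: "\<delta> > 0"
  shows "\<exists>S. bounded_clinear S \<and> (\<forall>v. R (S v) + \<delta> *\<^sub>R S v = v) \<and> (\<forall>v. S (R v) = R (S v)) \<and> (\<forall>v. norm (R (S v)) \<le> norm v)"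
proof -
  note b = positive_op_bounded_clinear[OF R]
  interpret R: bounded_linear R by (rule bounded_clinear_bounded_linear[OF b])
  obtain K0 where K0: "K0 \<ge> 0" "\<And>v. norm (R v) \<le> K0 * norm v" using bounded_clinear_bound[OF b] by blast
  define K where "K = K0 + 1"
  have K: "K > 0" "\<And>v. norm (R v) \<le> K * norm v"
    using K0 by (auto simp: K_def algebra_simps intro: add_increasing)
  \<comment> \<open>This step size turns \<open>1 - t * \<delta>\<close> into \<open>t * K\<close>,
    and the contraction factor \<open>t * K\<close> is then below 1.\<close>
  define t where "t = 1 / (K + \<delta>)"
  have t: "t > 0" "1 - t * \<delta> = t * K" using K \<delta> by (auto simp: t_def field_simps)
  have contr: "norm (x - t *\<^sub>R (R x + \<delta> *\<^sub>R x)) \<le> (t * K) * norm x" for x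
  proof -
    have "x - t *\<^sub>R (R x + \<delta> *\<^sub>R x) = (1 - t * \<delta>) *\<^sub>R x - t *\<^sub>R R x"
      by (simp add: algebra_simps)
    then have eq: "x - t *\<^sub>R (R x + \<delta> *\<^sub>R x) = (t * K) *\<^sub>R x - t *\<^sub>R R x" by (simp only: t)
    have "(norm ((t * K) *\<^sub>R x - t *\<^sub>R R x))\<^sup>2
       = (t * K)\<^sup>2 * (norm x)\<^sup>2 - 2 * (t * K) * t * Re (cinner (R x) x) + t\<^sup>2 * (norm (R x))\<^sup>2"
      unfolding norm_diff_sq
      by (simp add: cinner_scaleR_left cinner_scaleR_right positive_op_selfadjoint[OF R] power_mult_distrib)
    also have "\<dots> \<le> (t * K)\<^sup>2 * (norm x)\<^sup>2 - 2 * (t * K) * t * Re (cinner (R x) x) + t\<^sup>2 * (K * Re (cinner (R x) x))"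
      by (intro add_left_mono mult_left_mono positive_op_norm_sq_le R K) auto
    also have "\<dots> = (t * K)\<^sup>2 * (norm x)\<^sup>2 - t\<^sup>2 * K * Re (cinner (R x) x)"
      by (simp add: power2_eq_square algebra_simps)
    also have "\<dots> \<le> (t * K)\<^sup>2 * (norm x)\<^sup>2"
      using positive_op_Re[OF R, of x] K(1) by simp
    also have "\<dots> = (t * K * norm x)\<^sup>2" by (simp add: power_mult_distrib)
    finally show ?thesis unfolding eq
      by (rule power2_le_imp_le) (use t K in simp)
  qed
  have "\<exists>x. R x + \<delta> *\<^sub>R x = y \<and> (\<forall>z. R z + \<delta> *\<^sub>R z = y \<longrightarrow> z = x)" for y
  proof -
    have "\<exists>!x. x - t *\<^sub>R (R x + \<delta> *\<^sub>R x - y) = x"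
    proof (rule banach_fix_type)
      show "0 \<le> t * K" "t * K < 1" using t K \<delta> by (auto simp: t_def field_simps)
      have "dist (x - t *\<^sub>R (R x + \<delta> *\<^sub>R x - y)) (z - t *\<^sub>R (R z + \<delta> *\<^sub>R z - y)) \<le> t * K * dist x z" for x z
      proof -
        have "x - t *\<^sub>R (R x + \<delta> *\<^sub>R x - y) - (z - t *\<^sub>R (R z + \<delta> *\<^sub>R z - y))
           = (x - z) - t *\<^sub>R (R (x - z) + \<delta> *\<^sub>R (x - z))"
          by (simp add: R.diff algebra_simps)
        then show ?thesis using contr[of "x - z"] by (simp only: dist_norm)
      qed
      then show "\<forall>x z. dist (x - t *\<^sub>R (R x + \<delta> *\<^sub>R x - y)) (z - t *\<^sub>R (R z + \<delta> *\<^sub>R z - y)) \<le> t * K * dist x z" by blast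
    qed
    moreover have "x - t *\<^sub>R (R x + \<delta> *\<^sub>R x - y) = x \<longleftrightarrow> R x + \<delta> *\<^sub>R x = y" for x
      using t(1) by simp
    ultimately show ?thesis by (simp only: Ex1_def)
  qed
  then have "\<exists>S. \<forall>y. R (S y) + \<delta> *\<^sub>R S y = y \<and> (\<forall>z. R z + \<delta> *\<^sub>R z = y \<longrightarrow> z = S y)"
    by (intro choice) blast
  then obtain S where S: "\<And>y. R (S y) + \<delta> *\<^sub>R S y = y" and uniq: "\<And>x y. R x + \<delta> *\<^sub>R x = y \<Longrightarrow> x = S y"
    by blast
  \<comment> \<open>Expanding the norm of \<open>y = R (S y) + \<delta> S y\<close> gives three
    nonnegative terms; dropping all but one of them bounds \<open>S\<close> and \<open>R S\<close>
    respectively.\<close>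
  have nsq: "(norm y)\<^sup>2 = (norm (R (S y)))\<^sup>2 + 2 * \<delta> * Re (cinner (R (S y)) (S y)) + \<delta>\<^sup>2 * (norm (S y))\<^sup>2" for y
  proof -
    have "(norm (R (S y) - (- \<delta>) *\<^sub>R S y))\<^sup>2 = (norm (R (S y)))\<^sup>2 + 2 * \<delta> * Re (cinner (R (S y)) (S y)) + \<delta>\<^sup>2 * (norm (S y))\<^sup>2"
      unfolding norm_diff_sq by (simp add: cinner_scaleR_right power_mult_distrib)
    then show ?thesis by (simp add: S)
  qed
  have pos: "0 \<le> 2 * \<delta> * Re (cinner (R (S y)) (S y))" for y
    using \<delta> positive_op_Re[OF R] by simp
  have nS: "norm (S y) \<le> (1 / \<delta>) * norm y" for y
  proof -
    have "(\<delta> * norm (S y))\<^sup>2 \<le> (norm y)\<^sup>2" using nsq[of y] pos[of y] by (simp add: power_mult_distrib)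
    then have "\<delta> * norm (S y) \<le> norm y" by (rule power2_le_imp_le) simp
    then show ?thesis using \<delta> by (simp add: field_simps)
  qed
  have nRS: "norm (R (S y)) \<le> norm y" for y
  proof -
    have "(norm (R (S y)))\<^sup>2 \<le> (norm y)\<^sup>2" using nsq[of y] pos[of y] by simp
    then show ?thesis by (rule power2_le_imp_le) simp
  qed
  have bS: "bounded_clinear S"
  proof (rule bounded_clinearI[OF _ _ nS])
    show "S (u + v) = S u + S v" for u v
    proof (rule uniq[symmetric])
      have "R (S u + S v) + \<delta> *\<^sub>R (S u + S v) = (R (S u) + \<delta> *\<^sub>R S u) + (R (S v) + \<delta> *\<^sub>R S v)"
        by (simp add: R.add scaleR_add_right)
      then show "R (S u + S v) + \<delta> *\<^sub>R (S u + S v) = u + v" by (simp only: S)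
    qed
    show "S (c *\<^sub>C v) = c *\<^sub>C S v" for c v
    proof (rule uniq[symmetric])
      have "R (c *\<^sub>C S v) + \<delta> *\<^sub>R c *\<^sub>C S v = c *\<^sub>C (R (S v) + \<delta> *\<^sub>R S v)"
        by (simp add: bounded_clinear_simps[OF b] scaleC_add_right scaleR_scaleC scaleC_scaleC mult.commute)
      then show "R (c *\<^sub>C S v) + \<delta> *\<^sub>R c *\<^sub>C S v = c *\<^sub>C v" by (simp add: S)
    qed
  qed
  have "S (R v) = R (S v)" for v
  proof (rule uniq[symmetric])
    have "R (R (S v)) + \<delta> *\<^sub>R R (S v) = R (R (S v) + \<delta> *\<^sub>R S v)"
      by (simp add: R.add R.scaleR)
    then show "R (R (S v)) + \<delta> *\<^sub>R R (S v) = R v" by (simp only: S)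
  qed
  then show ?thesis using bS S nRS by blast
qed

section \<open>Traces of trace class operators through a square root of the modulus\<close>

lemma sum_cinner_le_hs:
  assumes A: "A \<in> hilbert_schmidt" and B: "B \<in> hilbert_schmidt" and K: "finite K" "K \<subseteq> some_onb"
  shows "(\<Sum>e\<in>K. cmod (cinner (A e) (B e))) \<le> hs_norm A * hs_norm B"
proof -
  have "(\<Sum>e\<in>K. cmod (cinner (A e) (B e))) \<le> (\<Sum>e\<in>K. \<bar>norm (A e)\<bar> * \<bar>norm (B e)\<bar>)"
    by (intro sum_mono) (simp add: norm_cinner_le)
  also have "\<dots> \<le> L2_set (\<lambda>e. norm (A e)) K * L2_set (\<lambda>e. norm (B e)) K"
    by (rule L2_set_mult_ineq)
  also have "\<dots> \<le> hs_norm A * hs_norm B"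
    using hs_sum_le[OF A K] hs_sum_le[OF B K]
    by (intro mult_mono) (auto simp: L2_set_def real_le_lsqrt sum_nonneg)
  finally show ?thesis .
qed

text \<open>Morally \<open>T = B R\<close> with a Hilbert-Schmidt operator \<open>B\<close> of the same norm as \<open>R\<close>, by polar
  decomposition; regularizing by the resolvent of \<open>R\<close> avoids the partial isometry.\<close>

lemma trace_bound:
  fixes T :: "'h::complex_hilbert_space \<Rightarrow> 'h"
  assumes T: "bounded_clinear T" and R: "positive_op R" "R \<in> hilbert_schmidt"
    and eq: "\<And>v. norm (T v) = norm (R (R v))"
    and X: "bounded_clinear X" and K: "finite K" "K \<subseteq> some_onb"
  shows "(\<Sum>e\<in>K. cmod (cinner (T (X e)) e)) \<le> hs_norm R * hs_norm (\<lambda>v. R (X v))"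
proof -
  obtain c where c: "c \<ge> 0" "\<And>v. norm (X v) \<le> c * norm v" using bounded_clinear_bound[OF X] by blast
  have RX: "(\<lambda>v. R (X v)) \<in> hilbert_schmidt" by (rule hs_comp_right(1)[OF R(2) X c])
  define M where "M = hs_norm R * hs_norm (\<lambda>v. R (X v))"
  \<comment> \<open>The error constant grows with \<open>K\<close>, which is harmless since
    \<open>\<delta>\<close> tends to 0 while \<open>K\<close> stays fixed.\<close>
  define C where "C = real (card K) * (hs_norm R * c)"
  have "(\<Sum>e\<in>K. cmod (cinner (T (X e)) e)) \<le> M + \<delta> * C" if \<delta>: "\<delta> > 0" for \<delta>
  proof -
    obtain S where S: "bounded_clinear S" "\<And>v. R (S v) + \<delta> *\<^sub>R S v = v" "\<And>v. S (R v) = R (S v)"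
       "\<And>v. norm (R (S v)) \<le> norm v"
      using resolvent_exists[OF R(1) \<delta>] by blast
    \<comment> \<open>\<open>P\<close> stands in for \<open>B\<close>: it is dominated by
      \<open>R\<close> at every vector, and \<open>T = P R + \<delta> P\<close>.\<close>
    define P where "P v = T (S v)" for v
    have bP: "bounded_clinear P" unfolding P_def by (rule bounded_clinear_comp[OF T S(1)])
    have nP: "norm (P v) \<le> norm (R v)" for v
      unfolding P_def eq S(3)[symmetric] using S(4)[of "R v"] by (simp add: S(3))
    have P: "P \<in> hilbert_schmidt" "hs_norm P \<le> hs_norm R"
    proof -
      have "(\<Sum>e\<in>J. (norm (P e))\<^sup>2) \<le> (hs_norm R)\<^sup>2" if J: "finite J" "J \<subseteq> some_onb" for J
        by (rule order.trans[OF sum_mono hs_sum_le[OF R(2) J]]) (simp add: nP power_mono)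
      from hsI[OF bP hs_norm_nonneg this] show "P \<in> hilbert_schmidt" "hs_norm P \<le> hs_norm R" by auto
    qed
    have dec: "T w = P (R w) + complex_of_real \<delta> *\<^sub>C P w" for w
    proof -
      have "w = S (R w) + complex_of_real \<delta> *\<^sub>C S w" using S(2)[of w] by (simp add: S(3) scaleR_scaleC)
      then have "T w = T (S (R w) + complex_of_real \<delta> *\<^sub>C S w)" by simp
      then show ?thesis by (simp add: P_def bounded_clinear_simps[OF T])
    qed
    have "cmod (cinner (T (X e)) e) \<le> cmod (cinner (R (X e)) (cadjoint P e)) + \<delta> * (hs_norm R * c)" if "e \<in> K" for e
    proof -
      have "norm e = 1" using that K norm_some_onb by auto
      have "cmod (cinner (P (X e)) e) \<le> norm (P (X e)) * norm e" by (rule norm_cinner_le)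
      also have "\<dots> = norm (P (X e))" using \<open>norm e = 1\<close> by simp
      also have "\<dots> \<le> norm (R (X e))" by (rule nP)
      also have "\<dots> \<le> hs_norm R * norm (X e)" by (rule norm_le_hs_norm[OF R(2)])
      also have "\<dots> \<le> hs_norm R * (c * norm e)" by (intro mult_left_mono c) auto
      finally have *: "cmod (cinner (P (X e)) e) \<le> hs_norm R * c" using \<open>norm e = 1\<close> by simp
      have "cinner (T (X e)) e = cinner (R (X e)) (cadjoint P e) + complex_of_real \<delta> * cinner (P (X e)) e"
        unfolding dec by (simp add: cinner_add_left cinner_scaleC_left cinner_cadjoint[OF bP])
      also have "cmod \<dots> \<le> cmod (cinner (R (X e)) (cadjoint P e)) + cmod (complex_of_real \<delta> * cinner (P (X e)) e)"
        by (rule norm_triangle_ineq)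
      also have "cmod (complex_of_real \<delta> * cinner (P (X e)) e) \<le> \<delta> * (hs_norm R * c)"
        using mult_left_mono[OF *, of \<delta>] \<delta> by (simp add: norm_mult)
      finally show ?thesis by simp
    qed
    then have "(\<Sum>e\<in>K. cmod (cinner (T (X e)) e)) \<le> (\<Sum>e\<in>K. cmod (cinner (R (X e)) (cadjoint P e)) + \<delta> * (hs_norm R * c))"
      by (rule sum_mono)
    also have "\<dots> = (\<Sum>e\<in>K. cmod (cinner (R (X e)) (cadjoint P e))) + \<delta> * C"
      by (simp add: sum.distrib C_def)
    also have "(\<Sum>e\<in>K. cmod (cinner (R (X e)) (cadjoint P e))) \<le> hs_norm (\<lambda>v. R (X v)) * hs_norm (cadjoint P)"
      by (rule sum_cinner_le_hs[OF RX hs_cadjoint(1)[OF P(1)] K])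
    also have "\<dots> \<le> hs_norm (\<lambda>v. R (X v)) * hs_norm R"
      unfolding hs_cadjoint(2)[OF P(1)] by (intro mult_left_mono P) auto
    finally show ?thesis by (simp add: M_def mult.commute)
  qed
  then have "\<forall>\<^sub>F \<delta> in at_right 0. (\<Sum>e\<in>K. cmod (cinner (T (X e)) e)) \<le> M + \<delta> * C"
    by (auto simp: eventually_at_right_less eventually_at intro!: exI[of _ 1])
  moreover have "((\<lambda>\<delta>. M + \<delta> * C) \<longlongrightarrow> M + 0 * C) (at_right 0)" by (intro tendsto_intros)
  ultimately have "(\<Sum>e\<in>K. cmod (cinner (T (X e)) e)) \<le> M + 0 * C"
    by (intro tendsto_lowerbound) auto
  then show ?thesis by (simp add: M_def)
qed

text \<open>Cyclicity of the trace in the form in which each summand becomes a matrix coefficient.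
  With \<open>T\<close> cut to a finite \<open>J\<close>, one of the two sums is finite and the
  other is Parseval; the remainder is controlled by \<open>trace_bound\<close>, uniformly in the
  summation set.\<close>

lemma op_trace_comp_adjoint:
  fixes T V :: "'h::complex_hilbert_space \<Rightarrow> 'h"
  assumes T: "T \<in> trace_class" and V: "unitary_op V"
  shows "((\<lambda>f. cinner (T f) (V f)) has_sum op_trace (T \<circ> cadjoint V)) some_onb"
proof -
  let ?E = "some_onb :: 'h set"
  have bT: "bounded_clinear T" and tr: "(\<lambda>e. Re (cinner (abs_op T e) e)) summable_on ?E"
    using T by (auto simp: trace_class_def)
  obtain R where R: "positive_op R" "\<And>v. R (R v) = abs_op T v"
    using positive_sqrt_exists[OF abs_op(1)[OF bT]] by blast
  have eq: "norm (T v) = norm (R (R v))" for v by (simp add: R abs_op(3)[OF bT])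
  \<comment> \<open>Summability of the diagonal of the modulus says exactly that its square root
    \<open>R\<close> is Hilbert-Schmidt.\<close>
  have "Re (cinner (abs_op T e) e) = (norm (R e))\<^sup>2" for e
    unfolding R(2)[symmetric] positive_op_selfadjoint[OF R(1), of "R e" e] by (simp add: cinner_self)
  then have Rhs: "R \<in> hilbert_schmidt"
    using tr positive_op_bounded_clinear[OF R(1)] by (simp add: hilbert_schmidt_def)
  have bV: "bounded_clinear (cadjoint V)"
    by (rule bounded_clinear_cadjoint[OF unitary_op_bounded_clinear[OF V]])
  have "(\<lambda>e. cmod (cinner (T (cadjoint V e)) e)) summable_on ?E"
    by (rule nonneg_summable_onI) (use trace_bound[OF bT R(1) Rhs eq bV] in auto)
  then have sum1: "((\<lambda>e. cinner (T (cadjoint V e)) e) has_sum op_trace (T \<circ> cadjoint V)) ?E"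
    by (simp add: op_trace_def abs_summable_summable)
  have fin: "((\<lambda>e. cinner (T (coord_proj J (cadjoint V e))) e) has_sum (\<Sum>f\<in>J. cinner (T f) (V f))) ?E" for J
  proof -
    have "cinner (T (coord_proj J (cadjoint V e))) e = (\<Sum>f\<in>J. cinner (T f) e * cinner e (V f))" for e
      by (simp add: coord_proj_def bounded_clinear_simps[OF bT] cinner_sum_left cinner_scaleC_left
          cinner_cadjoint_left[OF unitary_op_bounded_clinear[OF V]] mult.commute)
    moreover have "((\<lambda>e. \<Sum>f\<in>J. cinner (T f) e * cinner e (V f)) has_sum (\<Sum>f\<in>J. cinner (T f) (V f))) ?E"
    proof (induction J rule: infinite_finite_induct)
      case (insert f J)
      then show ?case using has_sum_add[OF parseval_cinner[of "T f" "V f"] insert(3)] by simp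
    qed auto
    ultimately show ?thesis by simp
  qed
  have diff: "cmod (op_trace (T \<circ> cadjoint V) - (\<Sum>f\<in>J. cinner (T f) (V f)))
      \<le> hs_norm R * sqrt ((hs_norm R)\<^sup>2 - (\<Sum>e\<in>J. (norm (R e))\<^sup>2))" if J: "finite J" "J \<subseteq> ?E" for J
  proof -
    define X where "X v = cadjoint V v - coord_proj J (cadjoint V v)" for v
    have bX: "bounded_clinear X" unfolding X_def
      by (intro bounded_clinear_diff bV bounded_clinear_comp[OF bounded_clinear_coord_proj bV])
    have s: "((\<lambda>e. cinner (T (X e)) e) has_sum (op_trace (T \<circ> cadjoint V) - (\<Sum>f\<in>J. cinner (T f) (V f)))) ?E"
      using has_sum_diff[OF sum1 fin[of J]] by (simp add: X_def bounded_clinear_simps[OF bT] cinner_diff_left)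
    have "cmod (op_trace (T \<circ> cadjoint V) - (\<Sum>f\<in>J. cinner (T f) (V f))) \<le> hs_norm R * hs_norm (\<lambda>v. R (X v))"
    proof (rule tendsto_upperbound)
      show "((\<lambda>K. cmod (\<Sum>e\<in>K. cinner (T (X e)) e)) \<longlongrightarrow> cmod (op_trace (T \<circ> cadjoint V) - (\<Sum>f\<in>J. cinner (T f) (V f)))) (finite_subsets_at_top ?E)"
        using s unfolding has_sum_def by (rule tendsto_norm)
      show "\<forall>\<^sub>F K in finite_subsets_at_top ?E. cmod (\<Sum>e\<in>K. cinner (T (X e)) e) \<le> hs_norm R * hs_norm (\<lambda>v. R (X v))"
        by (rule eventually_finite_subsets_at_top_weakI)
          (rule order.trans[OF norm_sum trace_bound[OF bT R(1) Rhs eq bX]])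
    qed auto
    \<comment> \<open>\<open>R X\<close> is the tail of \<open>R\<close> followed on the right by a
      unitary, so its norm does not involve \<open>V\<close>.\<close>
    also have "(\<lambda>v. R (X v)) = (\<lambda>v. (\<lambda>w. R w - R (coord_proj J w)) (cadjoint V v))"
      by (simp add: X_def bounded_clinear_simps[OF positive_op_bounded_clinear[OF R(1)]])
    also have "hs_norm \<dots> = hs_norm (\<lambda>w. R w - R (coord_proj J w))"
      by (rule hs_unitary_right(2)[OF hs_coord_proj_tail(1)[OF Rhs J] unitary_op_cadjoint[OF V]])
    also have "\<dots> = sqrt ((hs_norm R)\<^sup>2 - (\<Sum>e\<in>J. (norm (R e))\<^sup>2))"
      by (simp add: hs_coord_proj_tail(2)[OF Rhs J, symmetric])
    finally show ?thesis .
  qed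
  have lim0: "((\<lambda>J. hs_norm R * sqrt ((hs_norm R)\<^sup>2 - (\<Sum>e\<in>J. (norm (R e))\<^sup>2))) \<longlongrightarrow>
      hs_norm R * sqrt ((hs_norm R)\<^sup>2 - (hs_norm R)\<^sup>2)) (finite_subsets_at_top ?E)"
    by (intro tendsto_intros) (use hs_has_sum[OF Rhs] in \<open>simp add: has_sum_def\<close>)
  have "((\<lambda>J. op_trace (T \<circ> cadjoint V) - (\<Sum>f\<in>J. cinner (T f) (V f))) \<longlongrightarrow> 0) (finite_subsets_at_top ?E)"
    by (rule Lim_null_comparison[where g = "\<lambda>J. hs_norm R * sqrt ((hs_norm R)\<^sup>2 - (\<Sum>e\<in>J. (norm (R e))\<^sup>2))"])
       (use diff lim0 in \<open>auto intro: eventually_finite_subsets_at_top_weakI\<close>)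
  from tendsto_diff[OF tendsto_const[of "op_trace (T \<circ> cadjoint V)"] this]
  show ?thesis by (simp add: has_sum_def)
qed

section \<open>Square-integrable functions\<close>

lemma L2_functionsD:
  assumes "f \<in> L2_functions \<mu>"
  shows "f \<in> borel_measurable \<mu>" "integrable \<mu> (\<lambda>x. (cmod (f x))\<^sup>2)"
  using assms by (auto simp: L2_functions_def)

lemma L2_functions_bound:
  assumes "g \<in> L2_functions \<mu>" "f \<in> borel_measurable \<mu>" "c \<ge> 0" "\<And>x. cmod (f x) \<le> c * cmod (g x)"
  shows "f \<in> L2_functions \<mu>"
proof -
  have "integrable \<mu> (\<lambda>x. (cmod (f x))\<^sup>2)"
  proof (rule Bochner_Integration.integrable_bound)
    show "integrable \<mu> (\<lambda>x. c\<^sup>2 * (cmod (g x))\<^sup>2)" using L2_functionsD(2)[OF assms(1)] by simp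
    show "(\<lambda>x. (cmod (f x))\<^sup>2) \<in> borel_measurable \<mu>" using assms(2) by measurable
    have "(cmod (f x))\<^sup>2 \<le> c\<^sup>2 * (cmod (g x))\<^sup>2" for x
      using power_mono[OF assms(4)[of x], of 2] by (simp add: power_mult_distrib)
    then show "AE x in \<mu>. norm ((cmod (f x))\<^sup>2) \<le> norm (c\<^sup>2 * (cmod (g x))\<^sup>2)" by simp
  qed
  then show ?thesis using assms(2) by (simp add: L2_functions_def)
qed

lemma L2_functions_zero [simp]: "(\<lambda>x. 0) \<in> L2_functions \<mu>"
  by (simp add: L2_functions_def)

lemma L2_functions_add:
  assumes "f \<in> L2_functions \<mu>" "g \<in> L2_functions \<mu>"
  shows "(\<lambda>x. f x + g x) \<in> L2_functions \<mu>"
proof -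
  note m [measurable] = L2_functionsD(1)[OF assms(1)] L2_functionsD(1)[OF assms(2)]
  have "integrable \<mu> (\<lambda>x. (cmod (f x + g x))\<^sup>2)"
  proof (rule Bochner_Integration.integrable_bound)
    show "integrable \<mu> (\<lambda>x. 2 * (cmod (f x))\<^sup>2 + 2 * (cmod (g x))\<^sup>2)"
      using L2_functionsD(2)[OF assms(1)] L2_functionsD(2)[OF assms(2)] by simp
    show "(\<lambda>x. (cmod (f x + g x))\<^sup>2) \<in> borel_measurable \<mu>" by measurable
    have "(cmod (f x + g x))\<^sup>2 \<le> 2 * (cmod (f x))\<^sup>2 + 2 * (cmod (g x))\<^sup>2" for x
    proof -
      have "(cmod (f x + g x))\<^sup>2 \<le> (cmod (f x) + cmod (g x))\<^sup>2"
        by (intro power_mono norm_triangle_ineq) simp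
      also have "\<dots> \<le> 2 * (cmod (f x))\<^sup>2 + 2 * (cmod (g x))\<^sup>2"
        using zero_le_power2[of "cmod (f x) - cmod (g x)"] by (simp add: power2_eq_square algebra_simps)
      finally show ?thesis .
    qed
    then show "AE x in \<mu>. norm ((cmod (f x + g x))\<^sup>2) \<le> norm (2 * (cmod (f x))\<^sup>2 + 2 * (cmod (g x))\<^sup>2)" by simp
  qed
  then show ?thesis by (simp add: L2_functions_def)
qed

lemma L2_functions_mult:
  assumes "f \<in> L2_functions \<mu>" "h \<in> borel_measurable \<mu>" "c \<ge> 0" "\<And>x. cmod (h x) \<le> c"
  shows "(\<lambda>x. h x * f x) \<in> L2_functions \<mu>"
  using assms(2) L2_functionsD(1)[OF assms(1)] assms(4)
  by (intro L2_functions_bound[OF assms(1) _ assms(3)]) (auto simp: norm_mult intro!: mult_right_mono)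

lemma L2_functions_uminus:
  assumes "f \<in> L2_functions \<mu>"
  shows "(\<lambda>x. - f x) \<in> L2_functions \<mu>"
  using assms by (auto simp: L2_functions_def)

lemma L2_functions_diff:
  assumes "f \<in> L2_functions \<mu>" "g \<in> L2_functions \<mu>"
  shows "(\<lambda>x. f x - g x) \<in> L2_functions \<mu>"
  using L2_functions_add[OF assms(1) L2_functions_uminus[OF assms(2)]] by simp

lemma L2_functions_sum:
  assumes "\<And>i. i \<in> I \<Longrightarrow> f i \<in> L2_functions \<mu>"
  shows "(\<lambda>x. \<Sum>i\<in>I. f i x) \<in> L2_functions \<mu>"
  using assms by (induction I rule: infinite_finite_induct) (auto intro: L2_functions_add)

lemma L2_norm_nonneg [simp]: "L2_norm \<mu> f \<ge> 0"
  by (simp add: L2_norm_def)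

lemma L2_norm_sq: "(L2_norm \<mu> f)\<^sup>2 = (LINT x|\<mu>. (cmod (f x))\<^sup>2)"
  by (simp add: L2_norm_def)

lemma L2_norm_cong: "(\<And>x. cmod (f x) = cmod (g x)) \<Longrightarrow> L2_norm \<mu> f = L2_norm \<mu> g"
  by (simp add: L2_norm_def)

lemma L2_norm_mono:
  assumes "f \<in> L2_functions \<mu>" "g \<in> L2_functions \<mu>" "\<And>x. cmod (f x) \<le> cmod (g x)"
  shows "L2_norm \<mu> f \<le> L2_norm \<mu> g"
  unfolding L2_norm_def using L2_functionsD(2)[OF assms(1)] L2_functionsD(2)[OF assms(2)] assms(3)
  by (intro real_sqrt_le_mono integral_mono) (auto intro: power_mono)

lemma L2_norm_scale: "c \<ge> 0 \<Longrightarrow> L2_norm \<mu> (\<lambda>x. complex_of_real c * f x) = c * L2_norm \<mu> f"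
  by (simp add: L2_norm_def norm_mult power_mult_distrib real_sqrt_mult)

lemma L2_mult_integrable:
  assumes "f \<in> L2_functions \<mu>" "g \<in> L2_functions \<mu>"
  shows "integrable \<mu> (\<lambda>x. cmod (f x) * cmod (g x))" "integrable \<mu> (\<lambda>x. f x * g x)"
    "integrable \<mu> (\<lambda>x. f x * cnj (g x))"
proof -
  note m [measurable] = L2_functionsD(1)[OF assms(1)] L2_functionsD(1)[OF assms(2)]
  show 1: "integrable \<mu> (\<lambda>x. cmod (f x) * cmod (g x))"
  proof (rule Bochner_Integration.integrable_bound)
    show "integrable \<mu> (\<lambda>x. (cmod (f x))\<^sup>2 + (cmod (g x))\<^sup>2)"
      using L2_functionsD(2)[OF assms(1)] L2_functionsD(2)[OF assms(2)] by simp
    have "cmod (f x) * cmod (g x) \<le> (cmod (f x))\<^sup>2 + (cmod (g x))\<^sup>2" for x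
    proof -
      have "2 * (cmod (f x) * cmod (g x)) \<le> (cmod (f x))\<^sup>2 + (cmod (g x))\<^sup>2"
        using sum_squares_bound[of "cmod (f x)" "cmod (g x)"] by simp
      moreover have "0 \<le> cmod (f x) * cmod (g x)" by simp
      ultimately show ?thesis by linarith
    qed
    then show "AE x in \<mu>. norm (cmod (f x) * cmod (g x)) \<le> norm ((cmod (f x))\<^sup>2 + (cmod (g x))\<^sup>2)" by simp
  qed measurable
  have [measurable]: "(\<lambda>x. cnj (g x)) \<in> borel_measurable \<mu>"
    by (rule measurable_compose[OF m(2)]) (intro borel_measurable_continuous_onI continuous_intros)
  show "integrable \<mu> (\<lambda>x. f x * g x)" "integrable \<mu> (\<lambda>x. f x * cnj (g x))"
    by (rule Bochner_Integration.integrable_bound[OF 1]; simp add: norm_mult)+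
qed

text \<open>Weighted arithmetic-geometric mean, the weight \<open>t\<close> being the ratio of the
  norms. Adding \<open>e\<close> to both norms keeps \<open>t\<close> positive and finite when one
  of them is 0.\<close>

lemma L2_Cauchy_Schwarz:
  assumes "f \<in> L2_functions \<mu>" "g \<in> L2_functions \<mu>"
  shows "(LINT x|\<mu>. cmod (f x) * cmod (g x)) \<le> L2_norm \<mu> f * L2_norm \<mu> g"
proof -
  let ?a = "L2_norm \<mu> f" and ?b = "L2_norm \<mu> g"
  have "(LINT x|\<mu>. cmod (f x) * cmod (g x)) \<le> (?a + e) * (?b + e)" if e: "e > 0" for e
  proof -
    define t where "t = (?b + e) / (?a + e)"
    have p: "?a + e > 0" "?b + e > 0" using e by (auto intro: add_nonneg_pos)
    then have t: "t > 0" by (simp add: t_def)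
    have "2 * (cmod (f x) * cmod (g x)) \<le> t * (cmod (f x))\<^sup>2 + (1 / t) * (cmod (g x))\<^sup>2" for x
    proof -
      have "0 \<le> (sqrt t * cmod (f x) - cmod (g x) / sqrt t)\<^sup>2" by simp
      also have "\<dots> = t * (cmod (f x))\<^sup>2 - 2 * (cmod (f x) * cmod (g x)) + (1 / t) * (cmod (g x))\<^sup>2"
        using t by (simp add: power2_diff power_mult_distrib power_divide)
      finally show ?thesis by simp
    qed
    then have "(LINT x|\<mu>. 2 * (cmod (f x) * cmod (g x))) \<le> (LINT x|\<mu>. t * (cmod (f x))\<^sup>2 + (1 / t) * (cmod (g x))\<^sup>2)"
      using L2_mult_integrable(1)[OF assms] L2_functionsD(2)[OF assms(1)] L2_functionsD(2)[OF assms(2)]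
      by (intro integral_mono) auto
    also have "\<dots> = t * ?a\<^sup>2 + (1 / t) * ?b\<^sup>2"
      using L2_functionsD(2)[OF assms(1)] L2_functionsD(2)[OF assms(2)] by (simp add: L2_norm_sq)
    also have "\<dots> \<le> t * (?a + e)\<^sup>2 + (1 / t) * (?b + e)\<^sup>2"
      using t e by (intro add_mono mult_left_mono power_mono) auto
    also have "\<dots> = 2 * ((?a + e) * (?b + e))"
      using p by (simp add: t_def power2_eq_square)
    finally show ?thesis by simp
  qed
  then have "\<forall>\<^sub>F e in at_right 0. (LINT x|\<mu>. cmod (f x) * cmod (g x)) \<le> (?a + e) * (?b + e)"
    by (auto simp: eventually_at_right_less eventually_at intro!: exI[of _ 1])
  moreover have "((\<lambda>e. (?a + e) * (?b + e)) \<longlongrightarrow> (?a + 0) * (?b + 0)) (at_right 0)" by (intro tendsto_intros)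
  ultimately have "(LINT x|\<mu>. cmod (f x) * cmod (g x)) \<le> (?a + 0) * (?b + 0)"
    by (intro tendsto_lowerbound) auto
  then show ?thesis by simp
qed

lemma L2_cinner_le:
  assumes "f \<in> L2_functions \<mu>" "g \<in> L2_functions \<mu>"
  shows "cmod (LINT x|\<mu>. f x * g x) \<le> L2_norm \<mu> f * L2_norm \<mu> g"
    "cmod (LINT x|\<mu>. f x * cnj (g x)) \<le> L2_norm \<mu> f * L2_norm \<mu> g"
  using integral_norm_bound[of \<mu> "\<lambda>x. f x * g x"] integral_norm_bound[of \<mu> "\<lambda>x. f x * cnj (g x)"]
    L2_Cauchy_Schwarz[OF assms] by (auto simp: norm_mult)

lemma L2_norm_diff_sq:
  assumes "f \<in> L2_functions \<mu>" "g \<in> L2_functions \<mu>"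
  shows "(L2_norm \<mu> (\<lambda>x. f x - g x))\<^sup>2 =
    (L2_norm \<mu> f)\<^sup>2 - 2 * Re (LINT x|\<mu>. f x * cnj (g x)) + (L2_norm \<mu> g)\<^sup>2"
proof -
  note I = L2_mult_integrable(3)[OF assms]
  have *: "(cmod (f x - g x))\<^sup>2 = (cmod (f x))\<^sup>2 - 2 * Re (f x * cnj (g x)) + (cmod (g x))\<^sup>2" for x
    unfolding cmod_power2 by (simp add: power2_eq_square) (simp add: algebra_simps)
  have Re_eq: "Re (LINT x|\<mu>. f x * cnj (g x)) = (LINT x|\<mu>. Re (f x * cnj (g x)))"
    using I by (rule integral_Re[symmetric])
  define r where "r x = Re (f x * cnj (g x))" for x
  have r: "integrable \<mu> r" unfolding r_def using I by (rule integrable_Re)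
  show ?thesis
    unfolding L2_norm_sq * Re_eq r_def[symmetric]
    using L2_functionsD(2)[OF assms(1)] L2_functionsD(2)[OF assms(2)] r
    by simp
qed

lemma L2_norm_uminus: "L2_norm \<mu> (\<lambda>x. - f x) = L2_norm \<mu> f"
  by (simp add: L2_norm_def)

lemma L2_norm_triangle:
  assumes "f \<in> L2_functions \<mu>" "g \<in> L2_functions \<mu>"
  shows "L2_norm \<mu> (\<lambda>x. f x + g x) \<le> L2_norm \<mu> f + L2_norm \<mu> g"
proof (rule power2_le_imp_le)
  have "- Re (LINT x|\<mu>. f x * cnj (- g x)) \<le> cmod (LINT x|\<mu>. f x * cnj (- g x))"
    using abs_Re_le_cmod[of "LINT x|\<mu>. f x * cnj (- g x)"] by linarith
  also have "\<dots> \<le> L2_norm \<mu> f * L2_norm \<mu> g"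
    using L2_cinner_le(2)[OF assms(1) L2_functions_uminus[OF assms(2)]] by (simp add: L2_norm_uminus)
  finally show "(L2_norm \<mu> (\<lambda>x. f x + g x))\<^sup>2 \<le> (L2_norm \<mu> f + L2_norm \<mu> g)\<^sup>2"
    using L2_norm_diff_sq[OF assms(1) L2_functions_uminus[OF assms(2)]]
    by (simp add: L2_norm_uminus power2_sum)
qed simp

lemma L2_norm_triangle_diff:
  assumes "f \<in> L2_functions \<mu>" "g \<in> L2_functions \<mu>"
  shows "L2_norm \<mu> f \<le> L2_norm \<mu> (\<lambda>x. f x - g x) + L2_norm \<mu> g"
  using L2_norm_triangle[OF L2_functions_diff[OF assms] assms(2)] by simp

lemma L2_norm_commute: "L2_norm \<mu> (\<lambda>x. f x - g x) = L2_norm \<mu> (\<lambda>x. g x - f x)"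
  by (rule L2_norm_cong) (rule norm_minus_commute)

section \<open>Completeness of the space of square-integrable functions\<close>

lemma L2_nn_integral:
  assumes "f \<in> L2_functions \<mu>"
  shows "(\<integral>\<^sup>+x. ennreal ((cmod (f x))\<^sup>2) \<partial>\<mu>) = ennreal ((L2_norm \<mu> f)\<^sup>2)"
  unfolding L2_norm_sq by (rule nn_integral_eq_integral[OF L2_functionsD(2)[OF assms]]) simp

lemma L2_functionsI_nn_integral:
  assumes "f \<in> borel_measurable \<mu>" "(\<integral>\<^sup>+x. ennreal ((cmod (f x))\<^sup>2) \<partial>\<mu>) \<le> ennreal (c\<^sup>2)" "c \<ge> 0"
  shows "f \<in> L2_functions \<mu>" "L2_norm \<mu> f \<le> c"
proof -
  note [measurable] = assms(1)
  have "(\<integral>\<^sup>+x. ennreal (norm ((cmod (f x))\<^sup>2)) \<partial>\<mu>) < \<infinity>"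
    using assms(2) by (simp add: le_less_trans[OF _ ennreal_less_top])
  then have "integrable \<mu> (\<lambda>x. (cmod (f x))\<^sup>2)"
    by (intro integrableI_bounded) auto
  then show f: "f \<in> L2_functions \<mu>" using assms(1) by (simp add: L2_functions_def)
  from L2_nn_integral[OF this] assms(2) have "(L2_norm \<mu> f)\<^sup>2 \<le> c\<^sup>2" by simp
  then show "L2_norm \<mu> f \<le> c" using assms(3) by (rule power2_le_imp_le)
qed

text \<open>With \<open>F\<close> a term of a Cauchy sequence, this is the half of Riesz-Fischer
  that upgrades convergence almost everywhere to convergence in norm, square-integrability of the
  limit included.\<close>

lemma L2_Fatou:
  assumes H: "\<And>n. H n \<in> L2_functions \<mu>" and G: "G \<in> borel_measurable \<mu>"
    and lim: "AE x in \<mu>. (\<lambda>n. H n x) \<longlonglongrightarrow> G x"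
    and c: "c \<ge> 0" "\<And>m. m \<ge> N \<Longrightarrow> L2_norm \<mu> (\<lambda>x. H m x - F x) \<le> c" and F: "F \<in> L2_functions \<mu>"
  shows "(\<lambda>x. G x - F x) \<in> L2_functions \<mu>" "L2_norm \<mu> (\<lambda>x. G x - F x) \<le> c"
proof -
  note [measurable] = L2_functionsD(1)[OF H] G L2_functionsD(1)[OF F]
  have "(\<integral>\<^sup>+x. ennreal ((cmod (G x - F x))\<^sup>2) \<partial>\<mu>) = (\<integral>\<^sup>+x. liminf (\<lambda>m. ennreal ((cmod (H m x - F x))\<^sup>2)) \<partial>\<mu>)"
  proof (rule nn_integral_cong_AE, use lim in eventually_elim)
    fix x assume "(\<lambda>n. H n x) \<longlonglongrightarrow> G x"
    then have "(\<lambda>m. ennreal ((cmod (H m x - F x))\<^sup>2)) \<longlonglongrightarrow> ennreal ((cmod (G x - F x))\<^sup>2)"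
      by (intro tendsto_intros)
    from lim_imp_Liminf[OF trivial_limit_sequentially this]
    show "ennreal ((cmod (G x - F x))\<^sup>2) = liminf (\<lambda>m. ennreal ((cmod (H m x - F x))\<^sup>2))"
      by (rule sym)
  qed
  also have "\<dots> \<le> liminf (\<lambda>m. \<integral>\<^sup>+x. ennreal ((cmod (H m x - F x))\<^sup>2) \<partial>\<mu>)"
    by (rule nn_integral_liminf) measurable
  also have "\<dots> \<le> ennreal (c\<^sup>2)"
  proof (rule Liminf_le)
    have "(\<integral>\<^sup>+x. ennreal ((cmod (H m x - F x))\<^sup>2) \<partial>\<mu>) \<le> ennreal (c\<^sup>2)" if "m \<ge> N" for m
      unfolding L2_nn_integral[OF L2_functions_diff[OF H F]]
      using c(2)[OF that] by (intro ennreal_leI power_mono) auto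
    then show "\<forall>\<^sub>F m in sequentially. (\<integral>\<^sup>+x. ennreal ((cmod (H m x - F x))\<^sup>2) \<partial>\<mu>) \<le> ennreal (c\<^sup>2)"
      unfolding eventually_sequentially by blast
  qed simp
  finally have "(\<integral>\<^sup>+x. ennreal ((cmod (G x - F x))\<^sup>2) \<partial>\<mu>) \<le> ennreal (c\<^sup>2)" .
  from L2_functionsI_nn_integral[OF _ this c(1)]
  show "(\<lambda>x. G x - F x) \<in> L2_functions \<mu>" "L2_norm \<mu> (\<lambda>x. G x - F x) \<le> c" by measurable
qed

text \<open>The weight \<open>4 ^ n\<close> splits the rate: the weighted squares still have
  summable integrals, and finiteness of their sum at a point forces the increments there to decay
  like \<open>(1/2) ^ n\<close>.\<close>

lemma L2_fast_Cauchy_AE_convergent: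
  assumes H: "\<And>n. H n \<in> L2_functions \<mu>" and d: "\<And>n. L2_norm \<mu> (\<lambda>x. H (Suc n) x - H n x) \<le> (1/4) ^ n"
  shows "AE x in \<mu>. convergent (\<lambda>n. H n x)"
proof -
  note [measurable] = L2_functionsD(1)[OF H]
  let ?D = "\<lambda>n x. cmod (H (Suc n) x - H n x)"
  have "(\<integral>\<^sup>+x. (\<Sum>n. ennreal (4 ^ n * (?D n x)\<^sup>2)) \<partial>\<mu>) = (\<Sum>n. \<integral>\<^sup>+x. ennreal (4 ^ n * (?D n x)\<^sup>2) \<partial>\<mu>)"
    by (rule nn_integral_suminf) measurable
  also have "\<dots> \<le> (\<Sum>n. ennreal ((1/4) ^ n))"
  proof (rule suminf_le)
    fix n
    have "(\<integral>\<^sup>+x. ennreal (4 ^ n * (?D n x)\<^sup>2) \<partial>\<mu>) = ennreal (4 ^ n) * (\<integral>\<^sup>+x. ennreal ((?D n x)\<^sup>2) \<partial>\<mu>)"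
      by (subst nn_integral_cmult[symmetric]) (auto simp: ennreal_mult)
    also have "\<dots> = ennreal (4 ^ n * (L2_norm \<mu> (\<lambda>x. H (Suc n) x - H n x))\<^sup>2)"
      unfolding L2_nn_integral[OF L2_functions_diff[OF H H]] by (simp add: ennreal_mult)
    also have "\<dots> \<le> ennreal (4 ^ n * ((1/4) ^ n)\<^sup>2)"
      using d[of n] by (intro ennreal_leI mult_left_mono power_mono) auto
    also have "4 ^ n * ((1/4) ^ n)\<^sup>2 = ((1/4) ^ n :: real)"
      by (simp add: power2_eq_square power_divide field_simps)
    finally show "(\<integral>\<^sup>+x. ennreal (4 ^ n * (?D n x)\<^sup>2) \<partial>\<mu>) \<le> ennreal ((1/4) ^ n)" .
  qed auto
  also have "\<dots> < \<infinity>"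
    by (subst suminf_ennreal2) (auto simp: summable_geometric)
  finally have "AE x in \<mu>. (\<Sum>n. ennreal (4 ^ n * (?D n x)\<^sup>2)) \<noteq> \<infinity>"
    by (intro nn_integral_PInf_AE) auto
  then show ?thesis
  proof eventually_elim
    fix x assume fin: "(\<Sum>n. ennreal (4 ^ n * (?D n x)\<^sup>2)) \<noteq> \<infinity>"
    define c where "c = enn2real (\<Sum>n. ennreal (4 ^ n * (?D n x)\<^sup>2))"
    have c: "c \<ge> 0" "(\<Sum>n. ennreal (4 ^ n * (?D n x)\<^sup>2)) = ennreal c"
      using fin by (simp_all add: c_def less_top)
    have bd: "?D n x \<le> sqrt c * (1/2) ^ n" for n
    proof -
      have "ennreal (4 ^ n * (?D n x)\<^sup>2) = (\<Sum>k\<in>{n}. ennreal (4 ^ k * (?D k x)\<^sup>2))" by simp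
      also have "\<dots> \<le> ennreal c" unfolding c(2)[symmetric] by (rule sum_le_suminf) auto
      finally have "4 ^ n * (?D n x)\<^sup>2 \<le> c" using c(1) by simp
      moreover have "(4::real) ^ n = (2 ^ n)\<^sup>2" by (simp add: power2_eq_square flip: power_mult_distrib)
      ultimately have "(2 ^ n * ?D n x)\<^sup>2 \<le> c" by (simp add: power_mult_distrib)
      then have "2 ^ n * ?D n x \<le> sqrt c" by (rule real_le_rsqrt)
      then show ?thesis by (simp add: field_simps power_divide)
    qed
    have "summable (\<lambda>n. sqrt c * (1/2) ^ n)"
      by (rule summable_mult) (rule summable_geometric, simp)
    then have "summable (\<lambda>n. H (Suc n) x - H n x)"
      by (rule summable_comparison_test'[where N = 0 and f = "\<lambda>n. H (Suc n) x - H n x"]) (rule bd)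
    then have "convergent (\<lambda>n. \<Sum>k<n. H (Suc k) x - H k x)" by (simp add: summable_iff_convergent)
    then have "convergent (\<lambda>n. H n x - H 0 x)"
      unfolding sum_lessThan_telescope[of "\<lambda>n. H n x"] .
    then show "convergent (\<lambda>n. H n x)" by (simp add: convergent_diff_const_right_iff)
  qed
qed

section \<open>Haar measure on a locally compact group\<close>

definition cut :: "'a set \<Rightarrow> ('a \<Rightarrow> complex) \<Rightarrow> 'a \<Rightarrow> complex" where
  "cut K g = (\<lambda>\<xi>. if \<xi> \<in> K then 0 else g \<xi>)"

locale lca_group =
  fixes \<mu> :: "'a::{topological_ab_group_add,t2_space} measure"
  assumes haar: "haar_measure \<mu>"
    and locally_compact: "locally_compact_space (euclidean :: 'a topology)"
begin

lemma sets_eq [measurable_cong, simp]: "sets \<mu> = sets borel"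
  using haar by (simp add: haar_measure_def)

lemma space_eq [simp]: "space \<mu> = UNIV"
  using sets_eq_imp_space_eq[OF sets_eq] by simp

lemma borel_measurable_continuous:
  fixes f :: "'a \<Rightarrow> 'b::topological_space"
  assumes "continuous_on UNIV f"
  shows "f \<in> borel_measurable \<mu>"
  using borel_measurable_continuous_onI[OF assms] by measurable

lemma compact_sets: "compact A \<Longrightarrow> A \<in> sets \<mu>"
  by (simp add: compact_imp_closed)

lemma emeasure_compact_finite: "compact K \<Longrightarrow> emeasure \<mu> K < \<infinity>"
  using haar by (simp add: haar_measure_def)

lemma emeasure_translate: "A \<in> sets borel \<Longrightarrow> emeasure \<mu> ((+) x ` A) = emeasure \<mu> A"
  using haar by (simp add: haar_measure_def)

lemma emeasure_open_inner: "open G \<Longrightarrow> emeasure \<mu> G = (SUP K\<in>{K. compact K \<and> K \<subseteq> G}. emeasure \<mu> K)"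
  using haar unfolding haar_measure_def by blast

lemma translate_measurable [measurable]: "(\<lambda>\<xi>. \<xi> - \<eta>) \<in> borel \<rightarrow>\<^sub>M (borel :: 'a measure)"
  by (intro borel_measurable_continuous_onI continuous_intros)

lemma distr_translate: "distr \<mu> \<mu> (\<lambda>\<xi>. \<xi> - \<eta>) = \<mu>"
proof (rule measure_eqI)
  fix A assume "A \<in> sets (distr \<mu> \<mu> (\<lambda>\<xi>. \<xi> - \<eta>))"
  then have A: "A \<in> sets borel" by simp
  have "(\<lambda>\<xi>. \<xi> - \<eta>) -` A = (+) \<eta> ` A"
  proof (intro set_eqI iffI)
    fix x assume "x \<in> (\<lambda>\<xi>. \<xi> - \<eta>) -` A"
    then show "x \<in> (+) \<eta> ` A" by (intro image_eqI[of _ _ "x - \<eta>"]) auto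
  qed auto
  then show "emeasure (distr \<mu> \<mu> (\<lambda>\<xi>. \<xi> - \<eta>)) A = emeasure \<mu> A"
    using emeasure_translate[OF A, of \<eta>] A by (subst emeasure_distr) auto
qed simp

lemma integral_translate:
  fixes f :: "'a \<Rightarrow> 'b::{banach,second_countable_topology}"
  assumes "f \<in> borel_measurable \<mu>"
  shows "(LINT \<xi>|\<mu>. f (\<xi> - \<eta>)) = (LINT \<xi>|\<mu>. f \<xi>)"
  using integral_distr[of "\<lambda>\<xi>. \<xi> - \<eta>" \<mu> \<mu> f] assms by (simp add: distr_translate)

lemma integrable_translate:
  fixes f :: "'a \<Rightarrow> 'b::{banach,second_countable_topology}"
  assumes "integrable \<mu> f"
  shows "integrable \<mu> (\<lambda>\<xi>. f (\<xi> - \<eta>))"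
  using integrable_distr_eq[of "\<lambda>\<xi>. \<xi> - \<eta>" \<mu> \<mu> f] assms by (simp add: distr_translate)

lemma L2_functions_translate:
  assumes "g \<in> L2_functions \<mu>"
  shows "(\<lambda>\<xi>. g (\<xi> - \<eta>)) \<in> L2_functions \<mu>"
  using L2_functionsD(1)[OF assms] integrable_translate[OF L2_functionsD(2)[OF assms], of \<eta>]
  by (simp add: L2_functions_def)

lemma L2_norm_translate:
  assumes "g \<in> L2_functions \<mu>"
  shows "L2_norm \<mu> (\<lambda>\<xi>. g (\<xi> - \<eta>)) = L2_norm \<mu> g"
proof -
  have "(\<lambda>x. (cmod (g x))\<^sup>2) \<in> borel_measurable \<mu>" using L2_functionsD(2)[OF assms] by auto
  from integral_translate[OF this] show ?thesis by (simp add: L2_norm_def)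
qed

section \<open>Compact neighbourhoods, positivity on open sets and inner regularity\<close>

lemma compact_nbhd:
  assumes "open V" "x \<in> V"
  obtains W C :: "'a set" where "open W" "compact C" "x \<in> W" "W \<subseteq> C" "C \<subseteq> V"
proof -
  have "Hausdorff_space (euclidean :: 'a topology)"
    unfolding Hausdorff_space_def by (auto simp: disjnt_def dest!: hausdorff)
  then have "neighbourhood_base_of (compactin euclidean) (euclidean :: 'a topology)"
    using locally_compact locally_compact_space_neighbourhood_base
    by blast
  then have "\<exists>U C. open U \<and> compact C \<and> x \<in> U \<and> U \<subseteq> C \<and> C \<subseteq> V"
    using assms unfolding neighbourhood_base_of by simp
  then show ?thesis using that by blast
qed

text \<open>A compact set is covered by finitely many translates of \<open>W\<close>; if
  \<open>W\<close> were null, all compact sets would be, and inner regularity would make the whole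
  space null.\<close>

lemma emeasure_open_pos:
  assumes W: "open W" "W \<noteq> {}"
  shows "emeasure \<mu> W > 0"
proof (rule ccontr)
  assume "\<not> emeasure \<mu> W > 0"
  then have W0: "emeasure \<mu> W = 0" by simp
  obtain w where w: "w \<in> W" using W by auto
  have "emeasure \<mu> K = 0" if K: "compact K" for K
  proof -
    have "open ((+) x ` W)" for x
    proof -
      have "(+) x ` W = (\<lambda>y. y - x) -` W"
      proof (intro set_eqI iffI)
        fix y assume "y \<in> (\<lambda>y. y - x) -` W"
        then show "y \<in> (+) x ` W" by (intro image_eqI[of _ _ "y - x"]) auto
      qed auto
      moreover have "open ((\<lambda>y. y - x) -` W)"
        using W(1) by (intro open_vimage continuous_intros)
      ultimately show ?thesis by simp
    qed
    then have op: "\<forall>B\<in>(\<lambda>x. (+) x ` W) ` UNIV. open B" by auto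
    have "y \<in> (+) (y - w) ` W" for y using w by (intro image_eqI[of _ _ w]) auto
    then have "K \<subseteq> \<Union>((\<lambda>x. (+) x ` W) ` UNIV)" by blast
    then obtain D where D: "D \<subseteq> (\<lambda>x. (+) x ` W) ` UNIV" "finite D" "K \<subseteq> \<Union>D"
      using compactE[OF K _ op[rule_format]] by metis
    have null: "B \<in> null_sets \<mu>" if BD: "B \<in> D" for B
    proof -
      obtain x where "B = (+) x ` W" using subsetD[OF D(1) BD] by (rule imageE)
      then show ?thesis using emeasure_translate[of W x] W W0 op by (auto simp: null_sets_def)
    qed
    have "\<Union>D \<in> null_sets \<mu>"
      using null D(2) null_sets.finite_Union[of D \<mu>] by blast
    then have "emeasure \<mu> (\<Union>D) = 0" by auto
    moreover have "emeasure \<mu> K \<le> emeasure \<mu> (\<Union>D)"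
      using D(3) \<open>\<Union>D \<in> null_sets \<mu>\<close> by (intro emeasure_mono) auto
    ultimately show ?thesis by simp
  qed
  then have "emeasure \<mu> UNIV = 0" using emeasure_open_inner[of UNIV] by (auto intro!: antisym SUP_least)
  then show False using haar by (simp add: haar_measure_def)
qed

text \<open>Inner regularity is part of the definition for open sets, so it is applied below to
  superlevel sets of continuous functions.\<close>

lemma open_inner_approx:
  fixes e :: real
  assumes G: "open G" "emeasure \<mu> G < \<infinity>" and e: "e > 0"
  obtains K where "compact K" "K \<subseteq> G" "emeasure \<mu> (G - K) < ennreal e"
proof (cases "emeasure \<mu> G = 0")
  case True
  have "emeasure \<mu> (G - {}) < ennreal e" using True e by simp
  then show ?thesis using that[of "{}"] by simp
next
  case False
  define a where "a = measure \<mu> G"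
  have a: "emeasure \<mu> G = ennreal a" using G(2) by (simp add: a_def emeasure_eq_ennreal_measure)
  have "a > 0" using False unfolding a by (simp add: a_def zero_less_measure_iff)
  then have "ennreal (max 0 (a - e)) < emeasure \<mu> G" using e unfolding a by (subst ennreal_less_iff) auto
  then obtain K where K: "compact K" "K \<subseteq> G" "ennreal (max 0 (a - e)) < emeasure \<mu> K"
    unfolding emeasure_open_inner[OF G(1)] by (auto simp: less_SUP_iff)
  have fK: "emeasure \<mu> K \<noteq> \<infinity>" using emeasure_compact_finite[OF K(1)] by auto
  then have k: "emeasure \<mu> K = ennreal (measure \<mu> K)" by (simp add: emeasure_eq_ennreal_measure)
  have "max 0 (a - e) < measure \<mu> K" using K(3) unfolding k by (subst (asm) ennreal_less_iff) auto
  moreover have "emeasure \<mu> (G - K) = ennreal (a - measure \<mu> K)"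
    using K G fK compact_sets[OF K(1)] a k by (subst emeasure_Diff) (auto simp: ennreal_minus)
  ultimately have "emeasure \<mu> (G - K) < ennreal e" using e by (simp add: ennreal_less_iff ennreal_lessI)
  then show ?thesis using that K by blast
qed

lemma emeasure_superlevel_finite:
  assumes "g \<in> L2_functions \<mu>" "d > 0"
  shows "emeasure \<mu> {\<xi>. cmod (g \<xi>) > d} < \<infinity>"
proof -
  note [measurable] = L2_functionsD(1)[OF assms(1)]
  have "emeasure \<mu> {\<xi>. cmod (g \<xi>) > d} \<le> emeasure \<mu> {\<xi>\<in>UNIV. 1 \<le> ennreal (1 / d\<^sup>2) * ennreal ((cmod (g \<xi>))\<^sup>2)}"
  proof (rule emeasure_mono)
    show "{\<xi>. cmod (g \<xi>) > d} \<subseteq> {\<xi>\<in>UNIV. 1 \<le> ennreal (1 / d\<^sup>2) * ennreal ((cmod (g \<xi>))\<^sup>2)}"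
    proof (rule subsetI)
      fix \<xi> assume "\<xi> \<in> {\<xi>. cmod (g \<xi>) > d}"
      then have "d < cmod (g \<xi>)" by simp
      then have "d\<^sup>2 \<le> (cmod (g \<xi>))\<^sup>2" using assms(2) by (intro power_mono) auto
      then have "1 \<le> (1 / d\<^sup>2) * (cmod (g \<xi>))\<^sup>2" using assms(2) by (simp add: field_simps)
      then have "1 \<le> ennreal (1 / d\<^sup>2) * ennreal ((cmod (g \<xi>))\<^sup>2)"
        by (subst ennreal_mult[symmetric]) (auto simp: ennreal_ge_1)
      then show "\<xi> \<in> {\<xi>\<in>UNIV. 1 \<le> ennreal (1 / d\<^sup>2) * ennreal ((cmod (g \<xi>))\<^sup>2)}" by simp
    qed
    have "{\<xi> \<in> space \<mu>. 1 \<le> ennreal (1 / d\<^sup>2) * ennreal ((cmod (g \<xi>))\<^sup>2)} \<in> sets \<mu>" by measurable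
    then show "{\<xi>\<in>UNIV. 1 \<le> ennreal (1 / d\<^sup>2) * ennreal ((cmod (g \<xi>))\<^sup>2)} \<in> sets \<mu>" by simp
  qed
  also have "\<dots> \<le> ennreal (1 / d\<^sup>2) * (\<integral>\<^sup>+ x. ennreal ((cmod (g x))\<^sup>2) * indicator UNIV x \<partial>\<mu>)"
    by (rule nn_integral_Markov_inequality) auto
  also have "\<dots> = ennreal (1 / d\<^sup>2) * ennreal ((L2_norm \<mu> g)\<^sup>2)"
    using L2_nn_integral[OF assms(1)] by simp
  also have "\<dots> < \<infinity>" by (simp add: ennreal_mult_less_top)
  finally show ?thesis .
qed

section \<open>Tails outside compact sets\<close>

lemma cut_L2: 
  assumes "g \<in> L2_functions \<mu>" "compact K"
  shows "cut K g \<in> L2_functions \<mu>"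
proof (rule L2_functions_bound[OF assms(1), of _ 1])
  have "K \<in> sets \<mu>" by (rule compact_sets[OF assms(2)])
  then show "cut K g \<in> borel_measurable \<mu>"
    unfolding cut_def using L2_functionsD(1)[OF assms(1)] by (intro measurable_If_set) auto
qed (auto simp: cut_def)

lemma set_integral_cut: "(LINT \<xi>:-K|\<mu>. (cmod (g \<xi>))\<^sup>2) = (L2_norm \<mu> (cut K g))\<^sup>2"
  unfolding L2_norm_sq set_lebesgue_integral_def
  by (rule Bochner_Integration.integral_cong) (auto simp: cut_def)

lemma L2_decay_iff:
  assumes S: "S \<subseteq> L2_functions \<mu>"
  shows "L2_decay \<mu> S \<longleftrightarrow> (\<forall>e>0. \<exists>K. compact K \<and> (\<forall>g\<in>S. L2_norm \<mu> (cut K g) < e))"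
proof
  assume L: "L2_decay \<mu> S"
  show "\<forall>e>0. \<exists>K. compact K \<and> (\<forall>g\<in>S. L2_norm \<mu> (cut K g) < e)"
  proof (intro allI impI)
    fix e :: real assume e: "e > 0"
    then have "e\<^sup>2 > 0" by simp
    with L obtain K where "compact K" "\<forall>g\<in>S. (L2_norm \<mu> (cut K g))\<^sup>2 < e\<^sup>2"
      unfolding L2_decay_def set_integral_cut by blast
    then show "\<exists>K. compact K \<and> (\<forall>g\<in>S. L2_norm \<mu> (cut K g) < e)"
      using e by (meson less_eq_real_def power_less_imp_less_base)
  qed
next
  assume R: "\<forall>e>0. \<exists>K. compact K \<and> (\<forall>g\<in>S. L2_norm \<mu> (cut K g) < e)"
  show "L2_decay \<mu> S"
    unfolding L2_decay_def set_integral_cut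
  proof (intro allI impI)
    fix e :: real assume e: "e > 0"
    then have "sqrt e > 0" by simp
    with R obtain K where "compact K" "\<forall>g\<in>S. L2_norm \<mu> (cut K g) < sqrt e" by blast
    then show "\<exists>K. compact K \<and> (\<forall>g\<in>S. (L2_norm \<mu> (cut K g))\<^sup>2 < e)"
      using real_less_rsqrt by (metis L2_norm_nonneg e less_eq_real_def power_strict_mono real_sqrt_pow2 zero_less_numeral)
  qed
qed

text \<open>The part where \<open>g\<close> is small is handled by dominated convergence. The rest
  lives on an open superlevel set of finite measure, which a compact set exhausts up to small
  measure, and there \<open>g\<close> is bounded by \<open>B\<close>.\<close>

lemma bounded_continuous_tail:
  assumes g: "g \<in> L2_functions \<mu>" and cont: "continuous_on UNIV g" and B: "\<And>\<xi>. cmod (g \<xi>) \<le> B"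
    and e: "e > 0"
  obtains K where "compact K" "L2_norm \<mu> (cut K g) < e"
proof -
  note gm [measurable] = L2_functionsD(1)[OF g]
  define s where "s n \<xi> = (if cmod (g \<xi>) \<le> 1 / Suc n then (cmod (g \<xi>))\<^sup>2 else 0)" for n \<xi>
  have sm [measurable]: "s n \<in> borel_measurable \<mu>" for n unfolding s_def by measurable
  have "(\<lambda>n. LINT \<xi>|\<mu>. s n \<xi>) \<longlonglongrightarrow> (LINT \<xi>|\<mu>. 0)"
  proof (rule integral_dominated_convergence[where w = "\<lambda>\<xi>. (cmod (g \<xi>))\<^sup>2"])
    show "AE \<xi> in \<mu>. (\<lambda>n. s n \<xi>) \<longlonglongrightarrow> 0"
    proof (rule AE_I2)
      fix \<xi>
      show "(\<lambda>n. s n \<xi>) \<longlonglongrightarrow> 0"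
      proof (rule Lim_null_comparison)
        show "\<forall>\<^sub>F n in sequentially. norm (s n \<xi>) \<le> (1 / real (Suc n))\<^sup>2"
          by (intro always_eventually allI) (auto simp: s_def intro!: power_mono)
        show "(\<lambda>n. (1 / real (Suc n))\<^sup>2) \<longlonglongrightarrow> 0"
          using tendsto_power[OF LIMSEQ_inverse_real_of_nat, of 2] by (simp add: inverse_eq_divide)
      qed
    qed
    show "AE \<xi> in \<mu>. norm (s n \<xi>) \<le> (cmod (g \<xi>))\<^sup>2" for n by (auto simp: s_def)
  qed (use L2_functionsD(2)[OF g] in auto)
  then have "\<forall>\<^sub>F n in sequentially. (LINT \<xi>|\<mu>. s n \<xi>) < e\<^sup>2 / 2"
    using e by (intro order_tendstoD(2)[of _ "0::real"]) auto
  then obtain n where n: "(LINT \<xi>|\<mu>. s n \<xi>) < e\<^sup>2 / 2"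
    by (meson eventually_sequentially order_refl)
  define G where "G = {\<xi>. cmod (g \<xi>) > 1 / Suc n}"
  have G: "open G" unfolding G_def by (intro open_Collect_less continuous_intros cont)
  have Gf: "emeasure \<mu> G < \<infinity>" unfolding G_def by (rule emeasure_superlevel_finite[OF g]) simp
  \<comment> \<open>Chosen so that \<open>B\<^sup>2 * d\<close> is at most half of
    \<open>e\<^sup>2\<close>; the 1 covers \<open>B = 0\<close>.\<close>
  define d where "d = e\<^sup>2 / (2 * (B\<^sup>2 + 1))"
  have d: "d > 0" using e by (simp add: d_def add_nonneg_pos)
  obtain K where K: "compact K" "K \<subseteq> G" "emeasure \<mu> (G - K) < ennreal d"
    using open_inner_approx[OF G Gf d] by blast
  have GKs: "G - K \<in> sets \<mu>" using G compact_sets[OF K(1)] by auto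
  have "integrable \<mu> (\<lambda>\<xi>. indicator (G - K) \<xi> :: real)"
    using K(3) GKs by (intro integrable_real_indicator) (auto intro: less_trans[OF _ ennreal_less_top])
  then have int2: "integrable \<mu> (\<lambda>\<xi>. B\<^sup>2 * indicator (G - K) \<xi>)" by simp
  have ints: "integrable \<mu> (s n)"
    by (rule Bochner_Integration.integrable_bound[OF L2_functionsD(2)[OF g]]) (auto simp: s_def)
  have "(L2_norm \<mu> (cut K g))\<^sup>2 \<le> (LINT \<xi>|\<mu>. s n \<xi> + B\<^sup>2 * indicator (G - K) \<xi>)"
    unfolding L2_norm_sq
  proof (rule integral_mono)
    show "integrable \<mu> (\<lambda>x. (cmod (cut K g x))\<^sup>2)" by (rule L2_functionsD(2)[OF cut_L2[OF g K(1)]])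
    show "integrable \<mu> (\<lambda>\<xi>. s n \<xi> + B\<^sup>2 * indicator (G - K) \<xi>)" using int2 ints by simp
    show "(cmod (cut K g x))\<^sup>2 \<le> s n x + B\<^sup>2 * indicator (G - K) x" for x
      using power_mono[OF B[of x], of 2] by (auto simp: cut_def s_def G_def indicator_def)
  qed
  also have "\<dots> = (LINT \<xi>|\<mu>. s n \<xi>) + B\<^sup>2 * measure \<mu> (G - K)"
    using int2 ints GKs by simp
  also have "measure \<mu> (G - K) \<le> d"
    using K(3) d unfolding measure_def by (intro enn2real_leI) auto
  also have "B\<^sup>2 * d \<le> e\<^sup>2 / 2"
  proof -
    have "0 < B\<^sup>2 + 1" by (simp add: add_nonneg_pos)
    then show ?thesis unfolding d_def by (simp add: divide_simps) (simp add: algebra_simps)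
  qed
  finally have "(L2_norm \<mu> (cut K g))\<^sup>2 < e\<^sup>2" using n by (simp add: mult_left_mono)
  then have "L2_norm \<mu> (cut K g) < e" using e by (simp add: power_less_imp_less_base)
  then show ?thesis using that K by blast
qed

end

section \<open>Matrix coefficients of a projective representation\<close>

locale weyl_rep = lca_group \<mu> for \<mu> :: "'a::{topological_ab_group_add,t2_space} measure" +
  fixes m :: "'a \<Rightarrow> 'a \<Rightarrow> complex"
    and U :: "'a \<Rightarrow> 'h::complex_hilbert_space \<Rightarrow> 'h"
  assumes mult: "multiplier m"
    and rep: "projective_rep m U"
    and sc: "strongly_continuous_rep U"
    and ortho: "orthogonality_relations \<mu> U"
    and nontrivial: "\<exists>v::'h. v \<noteq> 0"
begin

lemma unitary: "unitary_op (U x)"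
  using rep by (simp add: projective_rep_def)

lemma U_U: "U x (U y v) = m x y *\<^sub>C U (x + y) v"
  using rep by (simp add: projective_rep_def)

lemma norm_m [simp]: "cmod (m x y) = 1"
  using mult by (simp add: multiplier_def)

lemma m_zero [simp]: "m x 0 = 1" "m 0 x = 1"
  using mult by (auto simp: multiplier_def)

lemma m_cnj [simp]: "m x y * cnj (m x y) = 1" "cnj (m x y) * m x y = 1"
  using complex_norm_square[of "m x y"] by (auto simp: mult.commute)

lemmas norm_U [simp] = unitary_op_norm[OF unitary]
lemmas bclinear_U = unitary_op_bounded_clinear[OF unitary]
lemmas U_simps = bounded_clinear_simps[OF bclinear_U]
lemmas U_adj [simp] = unitary_op_adj_left[OF unitary] unitary_op_adj_right[OF unitary]

lemma cinner_U [simp]: "cinner (U x u) (U x v) = cinner u v"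
  using unitary[of x] by (simp add: unitary_op_def)

lemma U_zero [simp]: "U 0 v = v"
proof -
  obtain w where w: "v = U 0 w" using unitary[of 0] unfolding unitary_op_def by (metis surjD)
  show ?thesis using U_U[of 0 0 w] by (simp add: w)
qed

lemma continuous_U: "continuous_on UNIV (\<lambda>x. U x v)"
  using sc by (simp add: strongly_continuous_rep_def)

lemma tendsto_U: "(f \<longlongrightarrow> x) F \<Longrightarrow> ((\<lambda>t. U (f t) v) \<longlongrightarrow> U x v) F"
  using continuous_U[of v] by (rule continuous_on_tendsto_compose) auto

text \<open>A multiplier is separately continuous by definition, but uniformity on compact sets
  requires joint continuity. It comes from strong continuity of \<open>U\<close>, as
  \<open>m x y\<close> is the inner product of \<open>U x (U y v)\<close> with
  \<open>U (x + y) v\<close>, up to normalization.\<close>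

lemma continuous_m: "continuous_on UNIV (\<lambda>p. m (fst p) (snd p))"
proof -
  obtain v :: 'h where v: "v \<noteq> 0" using nontrivial by blast
  have eq: "m x y = cinner (U x (U y v)) (U (x + y) v) / complex_of_real ((norm v)\<^sup>2)" for x y
    using v by (simp add: U_U cinner_scaleC_left cinner_self)
  have "((\<lambda>p. cinner (U (fst p) (U (snd p) v)) (U (fst p + snd p) v) / complex_of_real ((norm v)\<^sup>2)) \<longlongrightarrow>
     cinner (U (fst q) (U (snd q) v)) (U (fst q + snd q) v) / complex_of_real ((norm v)\<^sup>2)) (at q)" for q :: "'a \<times> 'a"
  proof -
    have f: "(fst \<longlongrightarrow> fst q) (at q)" and s: "(snd \<longlongrightarrow> snd q) (at q)"
      using tendsto_fst[OF tendsto_ident_at] tendsto_snd[OF tendsto_ident_at] by (cases q, force)+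
    \<comment> \<open>The moving unitary is isometric, so it may be applied to a vector tending to
      0.\<close>
    have "((\<lambda>p. U (fst p) (U (snd p) v - U (snd q) v)) \<longlongrightarrow> 0) (at q)"
    proof (rule Lim_null_comparison)
      show "((\<lambda>p. norm (U (snd p) v - U (snd q) v)) \<longlongrightarrow> 0) (at q)"
        using tendsto_U[OF s, of v] by (intro tendsto_norm_zero LIM_zero)
    qed simp
    from tendsto_add[OF this tendsto_U[OF f, of "U (snd q) v"]]
    have "((\<lambda>p. U (fst p) (U (snd p) v)) \<longlongrightarrow> U (fst q) (U (snd q) v)) (at q)"
      by (simp add: U_simps)
    moreover have "((\<lambda>p. U (fst p + snd p) v) \<longlongrightarrow> U (fst q + snd q) v) (at q)"
      by (intro tendsto_U tendsto_add f s)
    ultimately show ?thesis using v by (intro tendsto_intros) auto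
  qed
  then show ?thesis unfolding eq continuous_on_def by (auto simp: continuous_within[symmetric])
qed

lemma continuous_m_compose [continuous_intros]:
  assumes "continuous_on S f" "continuous_on S g"
  shows "continuous_on S (\<lambda>x. m (f x) (g x))"
  using continuous_on_compose2[OF continuous_m continuous_on_Pair[OF assms]] by simp

text \<open>The bicharacter \<open>symplectic m\<close>, with a conjugate in place of the quotient
  because \<open>m\<close> is unimodular.\<close>

definition sig :: "'a \<Rightarrow> 'a \<Rightarrow> complex" where
  "sig x y = m x y * cnj (m y x)"

lemma norm_sig [simp]: "cmod (sig x y) = 1"
  by (simp add: sig_def norm_mult)

lemma sig_zero [simp]: "sig x 0 = 1" "sig 0 x = 1"
  by (auto simp: sig_def)

lemma U_commute: "U x (U y v) = sig x y *\<^sub>C U y (U x v)"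
  by (simp add: U_U sig_def scaleC_scaleC add.commute mult.assoc)

lemma continuous_sig [continuous_intros]:
  assumes "continuous_on S f" "continuous_on S g"
  shows "continuous_on S (\<lambda>x. sig (f x) (g x))"
  unfolding sig_def using assms by (intro continuous_intros)

section \<open>Matrix coefficients: orthogonality and vanishing at infinity\<close>

definition coef :: "'h \<Rightarrow> 'h \<Rightarrow> 'a \<Rightarrow> complex" where
  "coef u v \<xi> = cinner u (U \<xi> v)"

lemma continuous_coef: "continuous_on UNIV (coef u v)"
  unfolding coef_def by (intro continuous_intros continuous_U)

lemma norm_coef_le: "cmod (coef u v \<xi>) \<le> norm u * norm v"
  using norm_cinner_le[of u "U \<xi> v"] by (simp add: coef_def)

lemma coef_measurable [measurable]: "coef u v \<in> borel_measurable \<mu>"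
  by (rule borel_measurable_continuous[OF continuous_coef])

lemma coef_ortho: "has_bochner_integral \<mu> (\<lambda>\<xi>. coef u v \<xi> * cnj (coef u' v' \<xi>)) (cinner u u' * cinner v' v)"
proof -
  have "has_bochner_integral \<mu> (\<lambda>x. cinner (U x v') u' * cnj (cinner (U x v) u)) (cinner v' v * cnj (cinner u' u))"
    using ortho unfolding orthogonality_relations_def by blast
  moreover have "cnj (cinner u' u) = cinner u u'" "\<And>x. cinner (U x v') u' * cnj (cinner (U x v) u) = coef u v x * cnj (coef u' v' x)"
    unfolding coef_def by (metis cinner_commute, metis cinner_commute mult.commute)
  ultimately show ?thesis by (simp add: mult.commute)
qed

lemma coef_norm_integral: "has_bochner_integral \<mu> (\<lambda>\<xi>. (cmod (coef u v \<xi>))\<^sup>2) ((norm u * norm v)\<^sup>2)"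
proof -
  have "has_bochner_integral \<mu> (\<lambda>\<xi>. Re (coef u v \<xi> * cnj (coef u v \<xi>))) (Re (cinner u u * cinner v v))"
    using coef_ortho[of u v u v] by (simp only: has_bochner_integral_iff integral_Re integrable_Re)
  moreover have "Re (coef u v \<xi> * cnj (coef u v \<xi>)) = (cmod (coef u v \<xi>))\<^sup>2" for \<xi>
    unfolding complex_norm_square[symmetric] by simp
  moreover have "Re (cinner u u * cinner v v) = (norm u * norm v)\<^sup>2"
    by (simp add: cinner_self power_mult_distrib flip: of_real_mult of_real_power)
  ultimately show ?thesis by simp
qed

lemma coef_L2 [simp]: "coef u v \<in> L2_functions \<mu>"
  using coef_norm_integral[of u v] by (simp add: L2_functions_def has_bochner_integral_iff)

lemma L2_norm_coef [simp]: "L2_norm \<mu> (coef u v) = norm u * norm v"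
  using coef_norm_integral[of u v] by (simp add: L2_norm_def has_bochner_integral_iff)

lemma coef_integral: "(LINT \<xi>|\<mu>. coef u v \<xi> * cnj (coef u' v' \<xi>)) = cinner u u' * cinner v' v"
  using coef_ortho by (simp add: has_bochner_integral_iff)

text \<open>Square-integrability alone does not force smallness at infinity; uniform continuity up
  to a phase does. If the coefficient is at least \<open>e\<close> at \<xi>, it exceeds
  \<open>e / 2\<close> on the whole translate of \<open>W\<close> by \<xi>. This translate lies in
  \<open>G\<close> and has more measure than \<open>G - K\<close>, so it meets \<open>K\<close>, and
  \<xi> lies in the compact difference set \<open>L\<close> of \<open>K\<close> and
  \<open>C\<close>.\<close>

lemma coef_vanishes_at_infinity:
  assumes e: "e > 0"
  obtains K where "compact K" "\<And>\<xi>. \<xi> \<notin> K \<Longrightarrow> cmod (coef u v \<xi>) < e"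
proof -
  define G where "G = {\<xi>. cmod (coef u v \<xi>) > e / 2}"
  have G: "open G" unfolding G_def by (intro open_Collect_less continuous_intros continuous_coef)
  have Gf: "emeasure \<mu> G < \<infinity>" unfolding G_def by (rule emeasure_superlevel_finite) (use e in auto)
  define V where "V = {\<eta>. norm u * norm (U \<eta> v - v) < e / 2}"
  have "open V" unfolding V_def by (intro open_Collect_less continuous_intros continuous_U)
  moreover have "0 \<in> V" using e by (simp add: V_def)
  ultimately obtain W C where W: "open W" "compact C" "0 \<in> W" "W \<subseteq> C" "C \<subseteq> V" by (rule compact_nbhd)
  have fW: "emeasure \<mu> W < \<infinity>"
    using emeasure_mono[OF W(4) compact_sets[OF W(2)]] emeasure_compact_finite[OF W(2)] by (rule le_less_trans)
  have pW: "emeasure \<mu> W > 0" using W by (intro emeasure_open_pos) auto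
  define w where "w = measure \<mu> W"
  have w: "emeasure \<mu> W = ennreal w" using fW by (simp add: w_def emeasure_eq_ennreal_measure)
  have "w > 0" using pW w by (simp add: w_def zero_less_measure_iff)
  from open_inner_approx[OF G Gf this] obtain K where K: "compact K" "K \<subseteq> G" "emeasure \<mu> (G - K) < emeasure \<mu> W"
    unfolding w by blast
  define L where "L = (\<lambda>p. fst p - snd p) ` (K \<times> C)"
  have L: "compact L" unfolding L_def
    by (intro compact_continuous_image compact_Times K W continuous_intros)
  have "\<xi> \<in> L" if x: "cmod (coef u v \<xi>) \<ge> e" for \<xi>
  proof -
    have sub: "(+) \<xi> ` W \<subseteq> G"
    proof clarify
      fix \<eta> assume eta: "\<eta> \<in> W"
      \<comment> \<open>Up to a phase the shift by \<eta> acts on \<open>v\<close> alone, so the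
        modulus of continuity does not depend on \<xi>.\<close>
      have eq: "cmod (coef u v (\<xi> + \<eta>)) = cmod (cinner u (U \<xi> (U \<eta> v)))"
        by (simp add: coef_def U_U cinner_scaleC_right norm_mult)
      have "cmod (coef u v \<xi>) \<le> cmod (cinner u (U \<xi> (U \<eta> v))) + cmod (coef u v \<xi> - cinner u (U \<xi> (U \<eta> v)))"
        using norm_triangle_ineq[of "cinner u (U \<xi> (U \<eta> v))" "coef u v \<xi> - cinner u (U \<xi> (U \<eta> v))"] by simp
      also have "coef u v \<xi> - cinner u (U \<xi> (U \<eta> v)) = cinner u (U \<xi> (v - U \<eta> v))"
        by (simp add: coef_def U_simps cinner_diff_right)
      also have "cmod \<dots> \<le> norm u * norm (U \<eta> v - v)"
        using norm_cinner_le[of u "U \<xi> (v - U \<eta> v)"] by (simp add: norm_minus_commute)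
      also have "\<dots> < e / 2" using eta W by (auto simp: V_def)
      finally have "e / 2 < cmod (coef u v (\<xi> + \<eta>))" using x unfolding eq by simp
      then show "\<xi> + \<eta> \<in> G" by (simp add: G_def)
    qed
    have "(+) \<xi> ` W \<inter> K \<noteq> {}"
    proof
      assume "(+) \<xi> ` W \<inter> K = {}"
      then have "emeasure \<mu> ((+) \<xi> ` W) \<le> emeasure \<mu> (G - K)"
        using sub G compact_sets[OF K(1)] by (intro emeasure_mono) auto
      then show False using emeasure_translate[of W \<xi>] W(1) K(3) by simp
    qed
    then obtain \<eta> where "\<eta> \<in> W" "\<xi> + \<eta> \<in> K" by auto
    then have "(\<xi> + \<eta>, \<eta>) \<in> K \<times> C" using W by auto
    then show ?thesis unfolding L_def by (rule rev_image_eqI) simp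
  qed
  then show ?thesis using that[OF L] by (meson not_le_imp_less)
qed

end

section \<open>The Fourier-Weyl transform on Hilbert-Schmidt operators\<close>

text \<open>Fatou's lemma needs sequences, whereas the basis may be uncountable; the unordered sum
  is reached along any increasing sequence of finite sets that exhausts its support.\<close>

lemma has_sum_incseq:
  assumes "(f has_sum s) A" "incseq J" "\<And>n. finite (J n)" "\<And>n. J n \<subseteq> A"
    and "\<And>x. x \<in> A \<Longrightarrow> x \<notin> (\<Union>n. J n) \<Longrightarrow> f x = 0"
  shows "(\<lambda>n. \<Sum>x\<in>J n. f x) \<longlonglongrightarrow> s"
proof -
  let ?D = "\<Union>n. J n"
  have "(f has_sum s) ?D \<longleftrightarrow> (f has_sum s) A"
    by (rule has_sum_cong_neutral) (use assms(4,5) in auto)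
  then have "(sum f \<longlongrightarrow> s) (finite_subsets_at_top ?D)" using assms(1) by (simp add: has_sum_def)
  moreover have "filterlim J (finite_subsets_at_top ?D) sequentially"
  proof (rule filterlim_finite_subsets_at_top[THEN iffD2], intro allI impI)
    fix X assume X: "finite X \<and> X \<subseteq> ?D"
    then have "finite X" "X \<subseteq> ?D" by auto
    then have "\<exists>N. X \<subseteq> J N"
    proof (induction X rule: finite_induct)
      case (insert x X)
      then obtain N k where "X \<subseteq> J N" "x \<in> J k" by auto
      then have "insert x X \<subseteq> J (max N k)"
        using incseqD[OF assms(2), of N "max N k"] incseqD[OF assms(2), of k "max N k"] by auto
      then show ?case by blast
    qed auto
    then obtain N where "X \<subseteq> J N" by blast
    then have "X \<subseteq> J n" if "n \<ge> N" for n using incseqD[OF assms(2) that] by blast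
    then show "\<forall>\<^sub>F n in sequentially. finite (J n) \<and> X \<subseteq> J n \<and> J n \<subseteq> ?D"
      unfolding eventually_sequentially using assms(3) by blast
  qed
  ultimately show ?thesis by (rule filterlim_compose)
qed

text \<open>The rate \<open>(1/16) ^ n\<close> is for squares: its root is the
  \<open>(1/4) ^ n\<close> of \<open>L2_fast_Cauchy_AE_convergent\<close>. A basis vector that is
  never reached has its value under \<open>A\<close> inside every tail, hence zero.\<close>

lemma hs_exhaust:
  assumes A: "A \<in> hilbert_schmidt"
  obtains J :: "nat \<Rightarrow> 'h::complex_hilbert_space set" where "incseq J" "\<And>n. finite (J n)" "\<And>n. J n \<subseteq> some_onb"
    "\<And>n. (hs_norm A)\<^sup>2 - (\<Sum>e\<in>J n. (norm (A e))\<^sup>2) \<le> (1/16) ^ n"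
    "\<And>e. e \<in> some_onb \<Longrightarrow> e \<notin> (\<Union>n. J n) \<Longrightarrow> A e = 0"
proof -
  have "\<exists>F. finite F \<and> F \<subseteq> some_onb \<and> (hs_norm A)\<^sup>2 - (\<Sum>e\<in>F. (norm (A e))\<^sup>2) \<le> (1/16) ^ n" for n
  proof -
    obtain F where "finite F" "F \<subseteq> some_onb" "dist (\<Sum>e\<in>F. (norm (A e))\<^sup>2) ((hs_norm A)\<^sup>2) \<le> (1/16) ^ n"
      using has_sum_finite_approximation[OF hs_has_sum[OF A], of "(1/16) ^ n"] by auto
    then show ?thesis by (auto simp: dist_real_def abs_le_iff intro!: exI[of _ F])
  qed
  then obtain F where F: "\<And>n. finite (F n)" "\<And>n. F n \<subseteq> some_onb"
    "\<And>n. (hs_norm A)\<^sup>2 - (\<Sum>e\<in>F n. (norm (A e))\<^sup>2) \<le> (1/16) ^ n" by metis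
  define J where "J n = (\<Union>k\<le>n. F k)" for n
  have J: "incseq J" "\<And>n. finite (J n)" "\<And>n. J n \<subseteq> some_onb"
    using F(1,2) by (auto simp: J_def incseq_def intro: order.trans)
  have tail: "(hs_norm A)\<^sup>2 - (\<Sum>e\<in>J n. (norm (A e))\<^sup>2) \<le> (1/16) ^ n" for n
  proof -
    have "(\<Sum>e\<in>F n. (norm (A e))\<^sup>2) \<le> (\<Sum>e\<in>J n. (norm (A e))\<^sup>2)"
      using J(2) by (intro sum_mono2) (auto simp: J_def)
    then show ?thesis using F(3)[of n] by linarith
  qed
  have "A e = 0" if e: "e \<in> some_onb" "e \<notin> (\<Union>n. J n)" for e
  proof (rule ccontr)
    assume "A e \<noteq> 0"
    then have "(norm (A e))\<^sup>2 > 0" by simp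
    then obtain n where n: "(1/16) ^ n < (norm (A e))\<^sup>2"
      using real_arch_pow_inv[of "(norm (A e))\<^sup>2" "1/16"] by auto
    have "(\<Sum>e\<in>insert e (J n). (norm (A e))\<^sup>2) \<le> (hs_norm A)\<^sup>2"
      by (rule hs_sum_le[OF A]) (use J e in auto)
    then show False using n tail[of n] J(2) e by simp
  qed
  then show ?thesis using that J tail by blast
qed

context weyl_rep
begin

text \<open>Describes the transform up to null sets, without choosing a function. The pairings
  determine \<open>g\<close> modulo the orthogonal complement of the matrix coefficients, and the
  equality of norms excludes a component there.\<close>

definition represents :: "('h \<Rightarrow> 'h) \<Rightarrow> ('a \<Rightarrow> complex) \<Rightarrow> bool" where
  "represents A g \<longleftrightarrow> A \<in> hilbert_schmidt \<and> g \<in> L2_functions \<mu> \<and> L2_norm \<mu> g = hs_norm A \<and>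
     (\<forall>u v. (LINT \<xi>|\<mu>. g \<xi> * cnj (coef u v \<xi>)) = cinner (A v) u)"

lemma representsD:
  assumes "represents A g"
  shows "A \<in> hilbert_schmidt" "g \<in> L2_functions \<mu>" "L2_norm \<mu> g = hs_norm A"
    "(LINT \<xi>|\<mu>. g \<xi> * cnj (coef u v \<xi>)) = cinner (A v) u"
  using assms by (auto simp: represents_def)

text \<open>For finite \<open>J\<close> in the basis, the transform of the truncation
  \<open>A (coord_proj J v)\<close>: a bounded continuous function, hence accessible
  pointwise.\<close>

definition partial :: "('h \<Rightarrow> 'h) \<Rightarrow> 'h set \<Rightarrow> 'a \<Rightarrow> complex" where
  "partial A J \<xi> = (\<Sum>f\<in>J. coef (A f) f \<xi>)"

lemma partial_L2: "partial A J \<in> L2_functions \<mu>"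
  unfolding partial_def[abs_def] by (intro L2_functions_sum) simp

lemma continuous_partial: "continuous_on UNIV (partial A J)"
  unfolding partial_def[abs_def] by (intro continuous_intros continuous_coef)

lemma norm_partial_le: "cmod (partial A J \<xi>) \<le> (\<Sum>f\<in>J. norm (A f) * norm f)"
  unfolding partial_def by (intro order.trans[OF norm_sum] sum_mono norm_coef_le)

lemma integral_partial_coef:
  "(LINT \<xi>|\<mu>. partial A J \<xi> * cnj (coef u v \<xi>)) = (\<Sum>f\<in>J. cinner (A f) u * cinner v f)"
proof -
  have "(LINT \<xi>|\<mu>. partial A J \<xi> * cnj (coef u v \<xi>)) = (LINT \<xi>|\<mu>. (\<Sum>f\<in>J. coef (A f) f \<xi> * cnj (coef u v \<xi>)))"
    by (simp add: partial_def sum_distrib_right)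
  also have "\<dots> = (\<Sum>f\<in>J. LINT \<xi>|\<mu>. coef (A f) f \<xi> * cnj (coef u v \<xi>))"
    by (rule Bochner_Integration.integral_sum) (intro L2_mult_integrable(3) coef_L2)
  finally show ?thesis by (simp add: coef_integral)
qed

lemma integral_partial_right:
  assumes g: "g \<in> L2_functions \<mu>"
  shows "(LINT \<xi>|\<mu>. g \<xi> * cnj (partial B J \<xi>)) = (\<Sum>f\<in>J. LINT \<xi>|\<mu>. g \<xi> * cnj (coef (B f) f \<xi>))"
proof -
  have "(LINT \<xi>|\<mu>. g \<xi> * cnj (partial B J \<xi>)) = (LINT \<xi>|\<mu>. (\<Sum>f\<in>J. g \<xi> * cnj (coef (B f) f \<xi>)))"
    by (simp add: partial_def sum_distrib_left)
  also have "\<dots> = (\<Sum>f\<in>J. LINT \<xi>|\<mu>. g \<xi> * cnj (coef (B f) f \<xi>))"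
    by (rule Bochner_Integration.integral_sum) (intro L2_mult_integrable(3) coef_L2 g)
  finally show ?thesis .
qed

lemma L2_norm_partial:
  assumes "finite J" "J \<subseteq> some_onb"
  shows "(L2_norm \<mu> (partial A J))\<^sup>2 = (\<Sum>f\<in>J. (norm (A f))\<^sup>2)"
proof -
  have "(LINT \<xi>|\<mu>. partial A J \<xi> * cnj (partial A J \<xi>)) = (\<Sum>f\<in>J. \<Sum>g\<in>J. cinner (A g) (A f) * cinner f g)"
    unfolding integral_partial_right[OF partial_L2] integral_partial_coef ..
  also have "\<dots> = (\<Sum>f\<in>J. \<Sum>g\<in>J. if g = f then complex_of_real ((norm (A f))\<^sup>2) else 0)"
  proof (intro sum.cong refl)
    fix f g assume "f \<in> J" "g \<in> J"
    then have "cinner f g = (if f = g then 1 else 0)"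
      using assms orthonormal_some_onb unfolding orthonormal_def by blast
    then show "cinner (A g) (A f) * cinner f g = (if g = f then complex_of_real ((norm (A f))\<^sup>2) else 0)"
      by (simp add: cinner_self)
  qed
  also have "\<dots> = complex_of_real (\<Sum>f\<in>J. (norm (A f))\<^sup>2)" using assms by simp
  finally have "(LINT \<xi>|\<mu>. partial A J \<xi> * cnj (partial A J \<xi>)) = complex_of_real (\<Sum>f\<in>J. (norm (A f))\<^sup>2)" .
  moreover have "partial A J \<xi> * cnj (partial A J \<xi>) = complex_of_real ((cmod (partial A J \<xi>))\<^sup>2)" for \<xi>
    by (simp add: complex_norm_square flip: of_real_power)
  ultimately have "complex_of_real (LINT \<xi>|\<mu>. (cmod (partial A J \<xi>))\<^sup>2) = complex_of_real (\<Sum>f\<in>J. (norm (A f))\<^sup>2)"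
    by (simp only: integral_complex_of_real)
  then show ?thesis unfolding L2_norm_sq using of_real_eq_iff by blast
qed

lemma partial_Diff:
  assumes "finite J" "K \<subseteq> J"
  shows "partial A J \<xi> - partial A K \<xi> = partial A (J - K) \<xi>"
  using assms by (simp add: partial_def sum_diff)

lemma represents_partial:
  assumes A: "A \<in> hilbert_schmidt" and J: "finite J" "J \<subseteq> some_onb"
  shows "represents (\<lambda>v. A (coord_proj J v)) (partial A J)"
  unfolding represents_def
proof (intro conjI allI)
  show "(\<lambda>v. A (coord_proj J v)) \<in> hilbert_schmidt" by (rule hs_comp_coord_proj[OF A J])
  show "partial A J \<in> L2_functions \<mu>" by (rule partial_L2)
  have "(L2_norm \<mu> (partial A J))\<^sup>2 = (hs_norm (\<lambda>v. A (coord_proj J v)))\<^sup>2"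
    by (simp add: L2_norm_partial[OF J] hs_norm_comp_coord_proj[OF hs_bounded_clinear[OF A] J])
  then show "L2_norm \<mu> (partial A J) = hs_norm (\<lambda>v. A (coord_proj J v))" by simp
  fix u v
  show "(LINT \<xi>|\<mu>. partial A J \<xi> * cnj (coef u v \<xi>)) = cinner (A (coord_proj J v)) u"
    unfolding integral_partial_coef
    by (simp add: coord_proj_def bounded_clinear_simps[OF hs_bounded_clinear[OF A]] cinner_sum_left
        cinner_scaleC_left mult.commute)
qed

text \<open>Norm and pairings are continuous in the operator and the function. The filter is
  arbitrary because the limit is taken both over finite subsets of the basis and along
  sequences.\<close>

lemma represents_limit:
  assumes rep: "\<forall>\<^sub>F n in F. represents (T n) (H n)" and F: "F \<noteq> bot"
    and A: "A \<in> hilbert_schmidt" and g: "g \<in> L2_functions \<mu>"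
    and lT: "((\<lambda>n. hs_dist (T n) A) \<longlongrightarrow> 0) F"
    and lH: "((\<lambda>n. L2_norm \<mu> (\<lambda>\<xi>. H n \<xi> - g \<xi>)) \<longlongrightarrow> 0) F"
  shows "represents A g"
  unfolding represents_def
proof (intro conjI allI A g)
  have "((\<lambda>n. L2_norm \<mu> (H n) - L2_norm \<mu> g) \<longlongrightarrow> 0) F"
  proof (rule Lim_null_comparison[OF _ lH])
    show "\<forall>\<^sub>F n in F. norm (L2_norm \<mu> (H n) - L2_norm \<mu> g) \<le> L2_norm \<mu> (\<lambda>\<xi>. H n \<xi> - g \<xi>)"
      using rep
    proof eventually_elim
      case (elim n)
      show ?case
        using L2_norm_triangle_diff[OF representsD(2)[OF elim] g] L2_norm_triangle_diff[OF g representsD(2)[OF elim]]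
          L2_norm_commute[of \<mu> g "H n"] by simp
    qed
  qed
  then have 1: "((\<lambda>n. L2_norm \<mu> (H n)) \<longlongrightarrow> L2_norm \<mu> g) F" by (simp add: LIM_zero_iff)
  have "((\<lambda>n. L2_norm \<mu> (H n) - hs_norm A) \<longlongrightarrow> 0) F"
  proof (rule Lim_null_comparison[OF _ lT])
    show "\<forall>\<^sub>F n in F. norm (L2_norm \<mu> (H n) - hs_norm A) \<le> hs_dist (T n) A"
      using rep
    proof eventually_elim
      case (elim n)
      note T = representsD(1)[OF elim]
      have "hs_norm (T n) \<le> hs_dist (T n) A + hs_norm A"
        using hs_add(2)[OF hs_diff(1)[OF T A] A] by (simp add: hs_dist_def)
      moreover have "hs_norm A \<le> hs_dist (T n) A + hs_norm (T n)"
        using hs_add(2)[OF hs_diff(1)[OF A T] T] hs.commute[of "T n" A] by (simp add: hs_dist_def)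
      ultimately show ?case using representsD(3)[OF elim] by simp
    qed
  qed
  then have 2: "((\<lambda>n. L2_norm \<mu> (H n)) \<longlongrightarrow> hs_norm A) F" by (simp add: LIM_zero_iff)
  show "L2_norm \<mu> g = hs_norm A" by (rule tendsto_unique[OF F 1 2])
  fix u v
  have "((\<lambda>n. (LINT \<xi>|\<mu>. H n \<xi> * cnj (coef u v \<xi>)) - (LINT \<xi>|\<mu>. g \<xi> * cnj (coef u v \<xi>))) \<longlongrightarrow> 0) F"
  proof (rule Lim_null_comparison)
    show "((\<lambda>n. L2_norm \<mu> (\<lambda>\<xi>. H n \<xi> - g \<xi>) * (norm u * norm v)) \<longlongrightarrow> 0) F"
      using tendsto_mult_right[OF lH, of "norm u * norm v"] by simp
    show "\<forall>\<^sub>F n in F. norm ((LINT \<xi>|\<mu>. H n \<xi> * cnj (coef u v \<xi>)) - (LINT \<xi>|\<mu>. g \<xi> * cnj (coef u v \<xi>)))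
       \<le> L2_norm \<mu> (\<lambda>\<xi>. H n \<xi> - g \<xi>) * (norm u * norm v)"
      using rep
    proof eventually_elim
      case (elim n)
      note H = representsD(2)[OF elim]
      have "(LINT \<xi>|\<mu>. H n \<xi> * cnj (coef u v \<xi>)) - (LINT \<xi>|\<mu>. g \<xi> * cnj (coef u v \<xi>)) =
         (LINT \<xi>|\<mu>. (H n \<xi> - g \<xi>) * cnj (coef u v \<xi>))"
        by (subst Bochner_Integration.integral_diff[symmetric])
          (auto intro!: L2_mult_integrable(3) H g simp: algebra_simps)
      then show ?case using L2_cinner_le(2)[OF L2_functions_diff[OF H g] coef_L2[of u v]] by simp
    qed
  qed
  then have 3: "((\<lambda>n. LINT \<xi>|\<mu>. H n \<xi> * cnj (coef u v \<xi>)) \<longlongrightarrow> (LINT \<xi>|\<mu>. g \<xi> * cnj (coef u v \<xi>))) F"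
    by (simp add: LIM_zero_iff)
  have "((\<lambda>n. (LINT \<xi>|\<mu>. H n \<xi> * cnj (coef u v \<xi>)) - cinner (A v) u) \<longlongrightarrow> 0) F"
  proof (rule Lim_null_comparison)
    show "((\<lambda>n. hs_dist (T n) A * (norm v * norm u)) \<longlongrightarrow> 0) F"
      using tendsto_mult_right[OF lT, of "norm v * norm u"] by simp
    show "\<forall>\<^sub>F n in F. norm ((LINT \<xi>|\<mu>. H n \<xi> * cnj (coef u v \<xi>)) - cinner (A v) u)
       \<le> hs_dist (T n) A * (norm v * norm u)"
      using rep
    proof eventually_elim
      case (elim n)
      have "norm ((LINT \<xi>|\<mu>. H n \<xi> * cnj (coef u v \<xi>)) - cinner (A v) u) = cmod (cinner (T n v - A v) u)"
        by (simp add: representsD(4)[OF elim] cinner_diff_left)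
      also have "\<dots> \<le> norm (T n v - A v) * norm u" by (rule norm_cinner_le)
      also have "\<dots> \<le> (hs_dist (T n) A * norm v) * norm u"
        unfolding hs_dist_def
        by (intro mult_right_mono norm_le_hs_norm[OF hs_diff(1)[OF representsD(1)[OF elim] A]]) auto
      finally show ?case by (simp add: mult.assoc)
    qed
  qed
  then have 4: "((\<lambda>n. LINT \<xi>|\<mu>. H n \<xi> * cnj (coef u v \<xi>)) \<longlongrightarrow> cinner (A v) u) F" by (simp add: LIM_zero_iff)
  show "(LINT \<xi>|\<mu>. g \<xi> * cnj (coef u v \<xi>)) = cinner (A v) u" by (rule tendsto_unique[OF F 3 4])
qed

text \<open>The pairings identify \<open>partial A J\<close> as an orthogonal projection of
  \<open>g\<close>, and the equality of norms turns the remaining distance into the tail of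
  \<open>A\<close>.\<close>

lemma represents_approx:
  assumes rep: "represents A g" and J: "finite J" "J \<subseteq> some_onb"
  shows "(L2_norm \<mu> (\<lambda>\<xi>. partial A J \<xi> - g \<xi>))\<^sup>2 = (hs_norm A)\<^sup>2 - (\<Sum>f\<in>J. (norm (A f))\<^sup>2)"
proof -
  note g = representsD(2)[OF rep]
  have "(LINT \<xi>|\<mu>. g \<xi> * cnj (partial A J \<xi>)) = (\<Sum>f\<in>J. complex_of_real ((norm (A f))\<^sup>2))"
    by (simp add: integral_partial_right[OF g] representsD(4)[OF rep] cinner_self)
  then have "Re (LINT \<xi>|\<mu>. g \<xi> * cnj (partial A J \<xi>)) = (\<Sum>f\<in>J. (norm (A f))\<^sup>2)" by simp
  then show ?thesis
    unfolding L2_norm_commute[of \<mu> "partial A J" g] L2_norm_diff_sq[OF g partial_L2]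
    by (simp add: L2_norm_partial[OF J] representsD(3)[OF rep])
qed

lemma tail_tendsto:
  assumes "A \<in> hilbert_schmidt"
  shows "((\<lambda>J. sqrt ((hs_norm A)\<^sup>2 - (\<Sum>f\<in>J. (norm (A f))\<^sup>2))) \<longlongrightarrow> 0) (finite_subsets_at_top some_onb)"
proof -
  have "((\<lambda>J. sqrt ((hs_norm A)\<^sup>2 - (\<Sum>f\<in>J. (norm (A f))\<^sup>2))) \<longlongrightarrow> sqrt ((hs_norm A)\<^sup>2 - (hs_norm A)\<^sup>2)) (finite_subsets_at_top some_onb)"
    by (intro tendsto_intros) (use hs_has_sum[OF assms] in \<open>simp add: has_sum_def\<close>)
  then show ?thesis by simp
qed

lemma hs_dist_coord_proj:
  assumes "A \<in> hilbert_schmidt" "finite J" "J \<subseteq> some_onb"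
  shows "hs_dist (\<lambda>v. A (coord_proj J v)) A = sqrt ((hs_norm A)\<^sup>2 - (\<Sum>f\<in>J. (norm (A f))\<^sup>2))"
  by (subst hs.commute) (simp add: hs_dist_def hs_coord_proj_tail(2)[OF assms, symmetric])

lemma eventually_finite_subset: "\<forall>\<^sub>F J in finite_subsets_at_top A. finite J \<and> J \<subseteq> A"
  by (rule eventually_finite_subsets_at_top_weakI) auto

text \<open>Pairings subtract at once, but the equality of norms does not; it is recovered in the
  limit from the truncations, which depend linearly on the operator.\<close>

lemma represents_diff:
  assumes A: "represents A g" and B: "represents B h"
  shows "represents (\<lambda>v. A v - B v) (\<lambda>\<xi>. g \<xi> - h \<xi>)"
proof (rule represents_limit)
  let ?F = "finite_subsets_at_top (some_onb :: 'h set)" and ?D = "\<lambda>v. A v - B v"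
  have D: "?D \<in> hilbert_schmidt" by (intro hs_diff(1) representsD(1)[OF A] representsD(1)[OF B])
  show "\<forall>\<^sub>F J in ?F. represents (\<lambda>v. ?D (coord_proj J v)) (partial ?D J)"
    using eventually_finite_subset by eventually_elim (use represents_partial[OF D] in auto)
  show "?F \<noteq> bot" by simp
  show "?D \<in> hilbert_schmidt" by (rule D)
  show "(\<lambda>\<xi>. g \<xi> - h \<xi>) \<in> L2_functions \<mu>" by (intro L2_functions_diff representsD(2)[OF A] representsD(2)[OF B])
  show "((\<lambda>J. hs_dist (\<lambda>v. ?D (coord_proj J v)) ?D) \<longlongrightarrow> 0) ?F"
    by (rule tendsto_cong[THEN iffD2, OF _ tail_tendsto[OF D]])
       (use eventually_finite_subset in \<open>eventually_elim, use hs_dist_coord_proj[OF D] in auto\<close>)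
  show "((\<lambda>J. L2_norm \<mu> (\<lambda>\<xi>. partial ?D J \<xi> - (g \<xi> - h \<xi>))) \<longlongrightarrow> 0) ?F"
  proof (rule Lim_null_comparison)
    show "((\<lambda>J. sqrt ((hs_norm A)\<^sup>2 - (\<Sum>f\<in>J. (norm (A f))\<^sup>2)) + sqrt ((hs_norm B)\<^sup>2 - (\<Sum>f\<in>J. (norm (B f))\<^sup>2))) \<longlongrightarrow> 0) ?F"
      using tendsto_add[OF tail_tendsto tail_tendsto, OF representsD(1)[OF A] representsD(1)[OF B]] by simp
    show "\<forall>\<^sub>F J in ?F. norm (L2_norm \<mu> (\<lambda>\<xi>. partial ?D J \<xi> - (g \<xi> - h \<xi>)))
       \<le> sqrt ((hs_norm A)\<^sup>2 - (\<Sum>f\<in>J. (norm (A f))\<^sup>2)) + sqrt ((hs_norm B)\<^sup>2 - (\<Sum>f\<in>J. (norm (B f))\<^sup>2))"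
      using eventually_finite_subset
    proof eventually_elim
      case (elim J)
      have eq: "partial ?D J \<xi> - (g \<xi> - h \<xi>) = (partial A J \<xi> - g \<xi>) + - (partial B J \<xi> - h \<xi>)" for \<xi>
        by (simp add: partial_def coef_def cinner_diff_left sum_subtractf)
      have "L2_norm \<mu> (\<lambda>\<xi>. partial ?D J \<xi> - (g \<xi> - h \<xi>))
         \<le> L2_norm \<mu> (\<lambda>\<xi>. partial A J \<xi> - g \<xi>) + L2_norm \<mu> (\<lambda>\<xi>. partial B J \<xi> - h \<xi>)"
        unfolding eq
        using L2_norm_triangle[OF L2_functions_diff[OF partial_L2[of A J] representsD(2)[OF A]]
          L2_functions_uminus[OF L2_functions_diff[OF partial_L2[of B J] representsD(2)[OF B]]]]
        unfolding L2_norm_uminus .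
      then show ?case using represents_approx[OF A, of J, symmetric] represents_approx[OF B, of J, symmetric] elim by simp
    qed
  qed
qed

lemma hs_dist_represents:
  assumes "represents A g" "represents B h"
  shows "hs_dist A B = L2_norm \<mu> (\<lambda>\<xi>. g \<xi> - h \<xi>)"
  using representsD(3)[OF represents_diff[OF assms]] by (simp add: hs_dist_def)

lemma represents_shift:
  assumes rep: "represents A g"
  shows "represents (op_shift U x A) (\<lambda>\<xi>. sig x \<xi> * g \<xi>)"
  unfolding represents_def
proof (intro conjI allI)
  note A = representsD(1)[OF rep] and g = representsD(2)[OF rep]
  note R = hs_unitary_right[OF A unitary_op_cadjoint[OF unitary[of x]]]
  have eq: "op_shift U x A = (\<lambda>v. U x (A (cadjoint (U x) v)))" by (simp add: op_shift_def fun_eq_iff)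
  show "op_shift U x A \<in> hilbert_schmidt" unfolding eq by (rule hs_unitary_left(1)[OF R(1) unitary])
  have "(\<lambda>\<xi>. sig x \<xi>) \<in> borel_measurable \<mu>"
    by (intro borel_measurable_continuous continuous_intros)
  then show "(\<lambda>\<xi>. sig x \<xi> * g \<xi>) \<in> L2_functions \<mu>" by (intro L2_functions_mult[OF g, of _ 1]) auto
  have "L2_norm \<mu> (\<lambda>\<xi>. sig x \<xi> * g \<xi>) = L2_norm \<mu> g" by (rule L2_norm_cong) (simp add: norm_mult)
  also have "\<dots> = hs_norm (op_shift U x A)"
    unfolding eq hs_unitary_left(2)[OF R(1) unitary] R(2) by (rule representsD(3)[OF rep])
  finally show "L2_norm \<mu> (\<lambda>\<xi>. sig x \<xi> * g \<xi>) = hs_norm (op_shift U x A)" .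
  fix u v
  \<comment> \<open>The phase is absorbed into the matrix coefficient by moving \<open>U x\<close>
    past \<open>U \<xi>\<close>, so the pairing formula for \<open>A\<close> applies at rotated
    vectors.\<close>
  have "sig x \<xi> * g \<xi> * cnj (coef u v \<xi>) = g \<xi> * cnj (coef (cadjoint (U x) u) (cadjoint (U x) v) \<xi>)" for \<xi>
  proof -
    have "coef (cadjoint (U x) u) (cadjoint (U x) v) \<xi> = cinner u (U x (U \<xi> (cadjoint (U x) v)))"
      by (simp add: coef_def cinner_cadjoint_left[OF bclinear_U])
    also have "\<dots> = cnj (sig x \<xi>) * coef u v \<xi>"
      by (simp add: U_commute[of x] cinner_scaleC_right coef_def)
    finally show ?thesis by simp
  qed
  then have "(LINT \<xi>|\<mu>. sig x \<xi> * g \<xi> * cnj (coef u v \<xi>)) = cinner (A (cadjoint (U x) v)) (cadjoint (U x) u)"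
    by (simp only: representsD(4)[OF rep])
  also have "\<dots> = cinner (op_shift U x A v) u"
    by (simp add: eq cinner_cadjoint[OF bclinear_U])
  finally show "(LINT \<xi>|\<mu>. sig x \<xi> * g \<xi> * cnj (coef u v \<xi>)) = cinner (op_shift U x A v) u" .
qed

lemma represents_right_translate:
  assumes rep: "represents A g"
  shows "represents (\<lambda>v. A (U \<eta> v)) (\<lambda>\<xi>. m (\<xi> - \<eta>) \<eta> * g (\<xi> - \<eta>))"
  unfolding represents_def
proof (intro conjI allI)
  note A = representsD(1)[OF rep] and g = representsD(2)[OF rep]
  note R = hs_unitary_right[OF A unitary[of \<eta>]]
  show "(\<lambda>v. A (U \<eta> v)) \<in> hilbert_schmidt" by (rule R(1))
  have mm: "(\<lambda>\<xi>. m (\<xi> - \<eta>) \<eta>) \<in> borel_measurable \<mu>" "(\<lambda>\<xi>. m \<xi> \<eta>) \<in> borel_measurable \<mu>"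
    by (intro borel_measurable_continuous continuous_intros)+
  show "(\<lambda>\<xi>. m (\<xi> - \<eta>) \<eta> * g (\<xi> - \<eta>)) \<in> L2_functions \<mu>"
    by (intro L2_functions_mult[OF L2_functions_translate[OF g] mm(1), of 1]) auto
  have "L2_norm \<mu> (\<lambda>\<xi>. m (\<xi> - \<eta>) \<eta> * g (\<xi> - \<eta>)) = L2_norm \<mu> (\<lambda>\<xi>. g (\<xi> - \<eta>))"
    by (rule L2_norm_cong) (simp add: norm_mult)
  also have "\<dots> = hs_norm (\<lambda>v. A (U \<eta> v))"
    unfolding L2_norm_translate[OF g] R(2) by (rule representsD(3)[OF rep])
  finally show "L2_norm \<mu> (\<lambda>\<xi>. m (\<xi> - \<eta>) \<eta> * g (\<xi> - \<eta>)) = hs_norm (\<lambda>v. A (U \<eta> v))" .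
  fix u v
  \<comment> \<open>Pairing with the coefficient at \<open>U \<eta> v\<close> is, by the
    multiplication rule of \<open>U\<close>, a pairing with a shifted coefficient; translation
    invariance then transfers the shift to \<open>g\<close>.\<close>
  define f where "f \<xi> = g \<xi> * cnj (coef u (U \<eta> v) \<xi>)" for \<xi>
  have f: "f \<xi> = m \<xi> \<eta> * g \<xi> * cnj (coef u v (\<xi> + \<eta>))" for \<xi>
    by (simp add: f_def coef_def U_U cinner_scaleC_right)
  have fm: "f \<in> borel_measurable \<mu>"
    using L2_mult_integrable(3)[OF g coef_L2[of u "U \<eta> v"]] unfolding f_def[abs_def] by auto
  have "(LINT \<xi>|\<mu>. m (\<xi> - \<eta>) \<eta> * g (\<xi> - \<eta>) * cnj (coef u v \<xi>)) = (LINT \<xi>|\<mu>. f (\<xi> - \<eta>))"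
    by (simp add: f)
  also have "\<dots> = (LINT \<xi>|\<mu>. f \<xi>)" by (rule integral_translate[OF fm])
  also have "\<dots> = cinner (A (U \<eta> v)) u" unfolding f_def by (rule representsD(4)[OF rep])
  finally show "(LINT \<xi>|\<mu>. m (\<xi> - \<eta>) \<eta> * g (\<xi> - \<eta>) * cnj (coef u v \<xi>)) = cinner (A (U \<eta> v)) u" .
qed

section \<open>The trace formula and the chosen representative\<close>

lemma partial_fast_Cauchy:
  assumes A: "A \<in> hilbert_schmidt" and J: "incseq J" "\<And>n. finite (J n)" "\<And>n. J n \<subseteq> some_onb"
    and tail: "\<And>n. (hs_norm A)\<^sup>2 - (\<Sum>e\<in>J n. (norm (A e))\<^sup>2) \<le> (1/16) ^ n" and le: "n \<le> k"
  shows "L2_norm \<mu> (\<lambda>\<xi>. partial A (J k) \<xi> - partial A (J n) \<xi>) \<le> (1/4) ^ n"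
proof (rule power2_le_imp_le)
  have sub: "J n \<subseteq> J k" by (rule incseqD[OF J(1) le])
  have "(L2_norm \<mu> (\<lambda>\<xi>. partial A (J k) \<xi> - partial A (J n) \<xi>))\<^sup>2 = (\<Sum>f\<in>J k - J n. (norm (A f))\<^sup>2)"
    unfolding partial_Diff[OF J(2) sub] by (rule L2_norm_partial) (use J in auto)
  also have "\<dots> = (\<Sum>f\<in>J k. (norm (A f))\<^sup>2) - (\<Sum>f\<in>J n. (norm (A f))\<^sup>2)"
    using sub J(2) by (simp add: sum_diff)
  also have "\<dots> \<le> (1/16) ^ n" using tail[of n] hs_sum_le[OF A J(2,3), of k] by simp
  also have "\<dots> = ((1/4) ^ n)\<^sup>2" by (simp add: power2_eq_square flip: power_mult_distrib)
  finally show "(L2_norm \<mu> (\<lambda>\<xi>. partial A (J k) \<xi> - partial A (J n) \<xi>))\<^sup>2 \<le> ((1/4) ^ n)\<^sup>2" .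
qed simp

text \<open>Identifies a pointwise limit of truncated transforms as a representative. It is applied
  to the trace formula, where the limit is explicit, and to an abstract limit when a representative
  has to be produced.\<close>

lemma represents_pointwise_limit:
  assumes A: "A \<in> hilbert_schmidt" and J: "incseq J" "\<And>n. finite (J n)" "\<And>n. J n \<subseteq> some_onb"
    and tail: "\<And>n. (hs_norm A)\<^sup>2 - (\<Sum>e\<in>J n. (norm (A e))\<^sup>2) \<le> (1/16) ^ n"
    and G: "G \<in> borel_measurable \<mu>" and lim: "AE \<xi> in \<mu>. (\<lambda>n. partial A (J n) \<xi>) \<longlonglongrightarrow> G \<xi>"
  shows "represents A G" "(\<lambda>n. L2_norm \<mu> (\<lambda>\<xi>. partial A (J n) \<xi> - G \<xi>)) \<longlonglongrightarrow> 0"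
    "(\<lambda>n. hs_dist (\<lambda>v. A (coord_proj (J n) v)) A) \<longlonglongrightarrow> 0"
proof -
  have close: "(\<lambda>\<xi>. G \<xi> - partial A (J n) \<xi>) \<in> L2_functions \<mu>"
    "L2_norm \<mu> (\<lambda>\<xi>. G \<xi> - partial A (J n) \<xi>) \<le> (1/4) ^ n" for n
    using L2_Fatou[OF partial_L2 G lim _ partial_fast_Cauchy[OF A J tail] partial_L2, of n] by auto
  have pow: "(\<lambda>n. (1/4) ^ n :: real) \<longlonglongrightarrow> 0" by (rule LIMSEQ_power_zero) simp
  have "(\<lambda>\<xi>. G \<xi> - partial A (J 0) \<xi> + partial A (J 0) \<xi>) \<in> L2_functions \<mu>"
    by (intro L2_functions_add close(1) partial_L2)
  then have G2: "G \<in> L2_functions \<mu>" by simp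
  show lH: "(\<lambda>n. L2_norm \<mu> (\<lambda>\<xi>. partial A (J n) \<xi> - G \<xi>)) \<longlonglongrightarrow> 0"
    by (rule Lim_null_comparison[OF _ pow])
       (use close(2) L2_norm_commute[of \<mu> G] in \<open>auto intro!: always_eventually\<close>)
  have "hs_dist (\<lambda>v. A (coord_proj (J n) v)) A \<le> (1/4) ^ n" for n
  proof -
    have "hs_dist (\<lambda>v. A (coord_proj (J n) v)) A \<le> sqrt ((1/16) ^ n)"
      unfolding hs_dist_coord_proj[OF A J(2,3)] by (intro real_sqrt_le_mono tail)
    also have "sqrt ((1/16) ^ n) = (1/4 :: real) ^ n"
      by (rule real_sqrt_unique) (simp_all add: power2_eq_square flip: power_mult_distrib)
    finally show ?thesis .
  qed
  then show lT: "(\<lambda>n. hs_dist (\<lambda>v. A (coord_proj (J n) v)) A) \<longlonglongrightarrow> 0"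
    by (intro Lim_null_comparison[OF _ pow]) (auto simp: hs_dist_def)
  show "represents A G"
    by (rule represents_limit[OF always_eventually[OF allI[OF represents_partial[OF A J(2,3)]]] _ A G2 lT lH]) simp
qed

lemma fourier_weyl_trace_has_sum:
  assumes "T \<in> trace_class"
  shows "((\<lambda>f. coef (T f) f \<xi>) has_sum fourier_weyl_trace U T \<xi>) some_onb"
  unfolding fourier_weyl_trace_def coef_def by (rule op_trace_comp_adjoint[OF assms unitary])

lemma represents_trace:
  assumes T: "T \<in> trace_class" "T \<in> hilbert_schmidt" and G: "fourier_weyl_trace U T \<in> L2_functions \<mu>"
  shows "represents T (fourier_weyl_trace U T)"
proof -
  obtain J where J: "incseq J" "\<And>n. finite (J n)" "\<And>n. J n \<subseteq> some_onb"
    "\<And>n. (hs_norm T)\<^sup>2 - (\<Sum>e\<in>J n. (norm (T e))\<^sup>2) \<le> (1/16) ^ n"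
    "\<And>e. e \<in> some_onb \<Longrightarrow> e \<notin> (\<Union>n. J n) \<Longrightarrow> T e = 0"
    by (rule hs_exhaust[OF T(2)]) blast
  have "(\<lambda>n. partial T (J n) \<xi>) \<longlonglongrightarrow> fourier_weyl_trace U T \<xi>" for \<xi>
    unfolding partial_def by (rule has_sum_incseq[OF fourier_weyl_trace_has_sum[OF T(1)] J(1-3)])
      (use J(5) in \<open>auto simp: coef_def\<close>)
  then show ?thesis
    by (intro represents_pointwise_limit(1)[OF T(2) J(1-4) L2_functionsD(1)[OF G]]) auto
qed

text \<open>The choice needs a witness, obtained from the finite-rank truncations of
  \<open>A\<close>. The chosen function, however, comes with a trace class sequence \<open>S\<close>
  of its own; every term of it in the Hilbert-Schmidt class is represented by its trace formula, and
  the limit inherits this.\<close>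

lemma fourier_weyl_represents:
  assumes A: "A \<in> hilbert_schmidt"
  shows "represents A (fourier_weyl \<mu> U A)"
proof -
  define P where "P g \<longleftrightarrow> g \<in> L2_functions \<mu> \<and>
        (\<exists>T :: nat \<Rightarrow> 'h \<Rightarrow> 'h.
           (\<forall>n. T n \<in> trace_class \<and> fourier_weyl_trace U (T n) \<in> L2_functions \<mu>) \<and>
           limitin hs_topology T A sequentially \<and>
           (\<lambda>n. L2_norm \<mu> (\<lambda>\<xi>. fourier_weyl_trace U (T n) \<xi> - g \<xi>)) \<longlonglongrightarrow> 0)" for g
  obtain J where J: "incseq J" "\<And>n. finite (J n)" "\<And>n. J n \<subseteq> some_onb"
    "\<And>n. (hs_norm A)\<^sup>2 - (\<Sum>e\<in>J n. (norm (A e))\<^sup>2) \<le> (1/16) ^ n"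
    by (rule hs_exhaust[OF A]) blast
  define T where "T n v = A (coord_proj (J n) v)" for n v
  have tc: "T n \<in> trace_class" for n
    unfolding T_def[abs_def] by (rule coord_proj_trace_class[OF hs_bounded_clinear[OF A] J(2,3)])
  have fT: "fourier_weyl_trace U (T n) = partial A (J n)" for n
  proof
    fix \<xi>
    have "((\<lambda>f. coef (T n f) f \<xi>) has_sum partial A (J n) \<xi>) some_onb"
      unfolding partial_def
      by (rule has_sum_finite_neutralI[OF J(2,3)])
         (use J(2,3) in \<open>auto simp: T_def coord_proj_onb[OF J(2,3)] subsetD[OF J(3)] bounded_clinear_simps[OF hs_bounded_clinear[OF A]] coef_def intro!: sum.cong\<close>)
    then show "fourier_weyl_trace U (T n) \<xi> = partial A (J n) \<xi>"
      using fourier_weyl_trace_has_sum[OF tc] has_sum_unique by blast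
  qed
  \<comment> \<open>Measurable on the whole group; the arbitrary values of \<open>lim\<close> where
    the sequence diverges affect a null set only.\<close>
  define G where "G \<xi> = lim (\<lambda>n. partial A (J n) \<xi>)" for \<xi>
  have Gm: "G \<in> borel_measurable \<mu>"
    unfolding G_def[abs_def] by (rule borel_measurable_lim_metric) (rule L2_functionsD(1)[OF partial_L2])
  have "AE \<xi> in \<mu>. convergent (\<lambda>n. partial A (J n) \<xi>)"
    by (rule L2_fast_Cauchy_AE_convergent[OF partial_L2 partial_fast_Cauchy[OF A J]]) simp
  then have lim: "AE \<xi> in \<mu>. (\<lambda>n. partial A (J n) \<xi>) \<longlonglongrightarrow> G \<xi>"
    by eventually_elim (simp add: G_def convergent_LIMSEQ_iff)
  note rp = represents_pointwise_limit[OF A J Gm lim]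
  have "P G"
    unfolding P_def
  proof (intro conjI exI[of _ T] allI)
    show "limitin hs_topology T A sequentially"
      unfolding hs_limitin using A hs_comp_coord_proj[OF A J(2,3)] rp(3) by (simp add: T_def[abs_def])
    show "(\<lambda>n. L2_norm \<mu> (\<lambda>\<xi>. fourier_weyl_trace U (T n) \<xi> - G \<xi>)) \<longlonglongrightarrow> 0" unfolding fT by (rule rp(2))
  qed (use representsD(2)[OF rp(1)] tc partial_L2 in \<open>auto simp: fT\<close>)
  then have "P (fourier_weyl \<mu> U A)" unfolding fourier_weyl_def P_def[symmetric] by (rule someI[of P])
  then obtain S where g: "fourier_weyl \<mu> U A \<in> L2_functions \<mu>"
    and S: "\<And>n. S n \<in> trace_class" "\<And>n. fourier_weyl_trace U (S n) \<in> L2_functions \<mu>"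
      "limitin hs_topology S A sequentially"
      "(\<lambda>n. L2_norm \<mu> (\<lambda>\<xi>. fourier_weyl_trace U (S n) \<xi> - fourier_weyl \<mu> U A \<xi>)) \<longlonglongrightarrow> 0"
    unfolding P_def by blast
  have S3: "\<forall>\<^sub>F n in sequentially. S n \<in> hilbert_schmidt" "(\<lambda>n. hs_dist (S n) A) \<longlonglongrightarrow> 0"
    using S(3) unfolding hs_limitin by auto
  have "\<forall>\<^sub>F n in sequentially. represents (S n) (fourier_weyl_trace U (S n))"
    using S3(1) by eventually_elim (rule represents_trace[OF S(1) _ S(2)])
  then show ?thesis by (rule represents_limit[OF _ _ A g S3(2) S(4)]) simp
qed

end

section \<open>Decay and equicontinuity\<close>

lemma uniformly_near_on_compact:
  fixes c :: "'a::topological_space \<Rightarrow> 'b::topological_space \<Rightarrow> complex"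
  assumes "continuous_on UNIV (\<lambda>p. c (fst p) (snd p))" "compact K" "e > 0"
  obtains V where "open V" "x \<in> V" "\<And>y t. y \<in> V \<Longrightarrow> t \<in> K \<Longrightarrow> cmod (c y t - c x t) \<le> e"
proof -
  have "continuous_on (UNIV \<times> K) (\<lambda>p. c (fst p) (snd p))"
    using assms(1) by (rule continuous_on_subset) auto
  from continuous_on_prod_compactE[OF this assms(2) UNIV_I assms(3), of x]
  obtain V where "x \<in> V" "open V" "\<forall>y\<in>V \<inter> UNIV. \<forall>t\<in>K. dist (c y t) (c x t) \<le> e" by auto
  then show ?thesis using that by (auto simp: dist_norm)
qed

lemma L2_norm_le_add:
  assumes f: "f \<in> L2_functions \<mu>" and a: "a \<in> L2_functions \<mu>" and b: "b \<in> L2_functions \<mu>"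
    and st: "s \<ge> 0" "t \<ge> 0" and le: "\<And>x. cmod (f x) \<le> s * cmod (a x) + t * cmod (b x)"
  shows "L2_norm \<mu> f \<le> s * L2_norm \<mu> a + t * L2_norm \<mu> b"
proof -
  have L: "(\<lambda>x. complex_of_real r * complex_of_real (cmod (g x))) \<in> L2_functions \<mu>" if "g \<in> L2_functions \<mu>" "r \<ge> 0" for g r
    using L2_functionsD(1)[OF that(1)] that(2)
    by (intro L2_functions_bound[OF that(1), of _ r]) (auto simp: norm_mult)
  have N: "L2_norm \<mu> (\<lambda>x. complex_of_real r * complex_of_real (cmod (g x))) = r * L2_norm \<mu> g" if "r \<ge> 0" for g r
    unfolding L2_norm_scale[OF that] by (simp add: L2_norm_def)
  have "L2_norm \<mu> f \<le> L2_norm \<mu> (\<lambda>x. complex_of_real s * complex_of_real (cmod (a x)) + complex_of_real t * complex_of_real (cmod (b x)))"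
    by (intro L2_norm_mono f L2_functions_add L a b st) (use le st in \<open>simp flip: of_real_mult of_real_add\<close>)
  also have "\<dots> \<le> s * L2_norm \<mu> a + t * L2_norm \<mu> b"
    using L2_norm_triangle[OF L[OF a st(1)] L[OF b st(2)]] by (simp only: N st)
  finally show ?thesis .
qed

text \<open>On \<open>K\<close> the phase is within \<open>e\<close> of 1; off \<open>K\<close> the
  trivial bound 2 is paid on the tail of \<open>g\<close> only.\<close>

lemma (in lca_group) L2_norm_phase_le:
  assumes g: "g \<in> L2_functions \<mu>" and h: "h \<in> borel_measurable \<mu>" "\<And>\<xi>. cmod (h \<xi>) = 1"
    and K: "compact K" "\<And>\<xi>. \<xi> \<in> K \<Longrightarrow> cmod (h \<xi> - 1) \<le> e" and e: "e \<ge> 0"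
  shows "(\<lambda>\<xi>. h \<xi> * g \<xi> - g \<xi>) \<in> L2_functions \<mu>"
    "L2_norm \<mu> (\<lambda>\<xi>. h \<xi> * g \<xi> - g \<xi>) \<le> e * L2_norm \<mu> g + 2 * L2_norm \<mu> (cut K g)"
proof -
  have hg: "(\<lambda>\<xi>. h \<xi> * g \<xi>) \<in> L2_functions \<mu>" by (rule L2_functions_mult[OF g h(1), of 1]) (auto simp: h)
  show 1: "(\<lambda>\<xi>. h \<xi> * g \<xi> - g \<xi>) \<in> L2_functions \<mu>" by (intro L2_functions_diff hg g)
  show "L2_norm \<mu> (\<lambda>\<xi>. h \<xi> * g \<xi> - g \<xi>) \<le> e * L2_norm \<mu> g + 2 * L2_norm \<mu> (cut K g)"
  proof (rule L2_norm_le_add[OF 1 g cut_L2[OF g K(1)]])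
    fix \<xi>
    have eq: "cmod (h \<xi> * g \<xi> - g \<xi>) = cmod (h \<xi> - 1) * cmod (g \<xi>)"
      by (simp add: norm_mult[symmetric] algebra_simps)
    show "cmod (h \<xi> * g \<xi> - g \<xi>) \<le> e * cmod (g \<xi>) + 2 * cmod (cut K g \<xi>)"
    proof (cases "\<xi> \<in> K")
      case True
      then show ?thesis unfolding eq using K(2) by (auto simp: cut_def intro: mult_right_mono)
    next
      case False
      have "cmod (h \<xi> - 1) \<le> 2" using norm_triangle_ineq4[of "h \<xi>" 1] by (simp add: h)
      then have "cmod (h \<xi> - 1) * cmod (g \<xi>) \<le> 2 * cmod (g \<xi>)" by (intro mult_right_mono) auto
      then show ?thesis unfolding eq using False e by (simp add: cut_def add_increasing)
    qed
  qed (use e in auto)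
qed

context weyl_rep
begin

text \<open>The operator counterpart of translation equicontinuity of the transforms, from which it
  differs by the phase \<open>m (\<xi> - \<eta>) \<eta>\<close>.\<close>

definition right_equicontinuous :: "('h \<Rightarrow> 'h) set \<Rightarrow> bool" where
  "right_equicontinuous F \<longleftrightarrow>
     (\<forall>\<epsilon>>0. \<exists>V. open V \<and> 0 \<in> V \<and> (\<forall>A\<in>F. \<forall>\<eta>\<in>V. hs_dist (\<lambda>v. A (U \<eta> v)) A < \<epsilon>))"

abbreviation FW :: "('h \<Rightarrow> 'h) \<Rightarrow> 'a \<Rightarrow> complex" where
  "FW A \<equiv> fourier_weyl \<mu> U A"

lemma FW_L2: "A \<in> hilbert_schmidt \<Longrightarrow> FW A \<in> L2_functions \<mu>"
  using fourier_weyl_represents representsD(2) by blast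

lemma L2_norm_FW: "A \<in> hilbert_schmidt \<Longrightarrow> L2_norm \<mu> (FW A) = hs_norm A"
  using fourier_weyl_represents representsD(3) by blast

lemma hs_dist_shift:
  assumes "A \<in> hilbert_schmidt"
  shows "hs_dist (op_shift U x A) A = L2_norm \<mu> (\<lambda>\<xi>. sig x \<xi> * FW A \<xi> - FW A \<xi>)"
  by (intro hs_dist_represents represents_shift fourier_weyl_represents assms)

lemma hs_dist_right:
  assumes "A \<in> hilbert_schmidt"
  shows "hs_dist (\<lambda>v. A (U \<eta> v)) A = L2_norm \<mu> (\<lambda>\<xi>. m (\<xi> - \<eta>) \<eta> * FW A (\<xi> - \<eta>) - FW A \<xi>)"
  by (intro hs_dist_represents represents_right_translate fourier_weyl_represents assms)

section \<open>Consequences of uniform decay for bounded families\<close>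

lemma L2_decay_FW_iff:
  assumes "F \<subseteq> hilbert_schmidt"
  shows "L2_decay \<mu> (FW ` F) \<longleftrightarrow> (\<forall>e>0. \<exists>K. compact K \<and> (\<forall>A\<in>F. L2_norm \<mu> (cut K (FW A)) < e))"
  by (subst L2_decay_iff) (use assms FW_L2 in auto)

lemma decay_imp_hs_equicontinuous:
  assumes F: "F \<subseteq> hilbert_schmidt" and B: "\<And>A. A \<in> F \<Longrightarrow> hs_norm A \<le> B" and dec: "L2_decay \<mu> (FW ` F)"
  shows "hs_equicontinuous U F"
  unfolding hs_equicontinuous_def
proof (intro allI impI)
  fix e :: real assume e: "e > 0"
  \<comment> \<open>The phase error on \<open>K\<close> then costs less than \<open>e / 2\<close>,
    and twice the tail bound \<open>e / 4\<close> costs the other half.\<close>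
  define \<delta> where "\<delta> = e / (2 * (\<bar>B\<bar> + 1))"
  have \<delta>: "\<delta> > 0" "\<delta> * \<bar>B\<bar> < e / 2" using e by (auto simp: \<delta>_def field_simps add_nonneg_pos)
  have "e / 4 > 0" using e by simp
  from dec[unfolded L2_decay_FW_iff[OF F], rule_format, OF this]
  obtain K where K: "compact K" "\<And>A. A \<in> F \<Longrightarrow> L2_norm \<mu> (cut K (FW A)) < e / 4"
    by (elim exE conjE) (erule that, erule bspec)
  have cs: "continuous_on UNIV (\<lambda>p. sig (fst p) (snd p))" by (intro continuous_intros)
  obtain V where V: "open V" "0 \<in> V" "\<And>x \<xi>. x \<in> V \<Longrightarrow> \<xi> \<in> K \<Longrightarrow> cmod (sig x \<xi> - sig 0 \<xi>) \<le> \<delta>"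
    by (rule uniformly_near_on_compact[OF cs K(1) \<delta>(1), of 0]) blast
  have "hs_dist (op_shift U x A) A < e" if "A \<in> F" "x \<in> V" for A x
  proof -
    have A: "A \<in> hilbert_schmidt" using that F by auto
    have "L2_norm \<mu> (\<lambda>\<xi>. sig x \<xi> * FW A \<xi> - FW A \<xi>) \<le> \<delta> * L2_norm \<mu> (FW A) + 2 * L2_norm \<mu> (cut K (FW A))"
      by (rule L2_norm_phase_le(2)[OF FW_L2[OF A] _ _ K(1)])
         (use V(3)[OF that(2)] \<delta> in \<open>auto intro!: borel_measurable_continuous continuous_intros\<close>)
    also have "\<delta> * L2_norm \<mu> (FW A) \<le> \<delta> * \<bar>B\<bar>"
      unfolding L2_norm_FW[OF A] using B[OF that(1)] \<delta> by (intro mult_left_mono) auto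
    finally show ?thesis unfolding hs_dist_shift[OF A] using \<delta>(2) K(2)[OF that(1)] by linarith
  qed
  then show "\<exists>V. open V \<and> 0 \<in> V \<and> (\<forall>A\<in>F. \<forall>x\<in>V. hs_dist (op_shift U x A) A < e)" using V by blast
qed

text \<open>The two functions compared differ by the translate of
  \<open>(m \<xi> \<eta> - 1) * FW A \<xi>\<close>. Translation invariance of the norm removes the
  shift, so that one compact \<open>K\<close> serves for every \<eta>.\<close>

lemma decay_imp_translate_close:
  assumes F: "F \<subseteq> hilbert_schmidt" and B: "\<And>A. A \<in> F \<Longrightarrow> hs_norm A \<le> B" and dec: "L2_decay \<mu> (FW ` F)"
    and e: "e > 0"
  obtains V where "open V" "0 \<in> V"
    "\<And>A \<eta>. A \<in> F \<Longrightarrow> \<eta> \<in> V \<Longrightarrow> \<bar>hs_dist (\<lambda>v. A (U \<eta> v)) A - L2_norm \<mu> (\<lambda>\<xi>. FW A (\<xi> - \<eta>) - FW A \<xi>)\<bar> < e"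
proof -
  define \<delta> where "\<delta> = e / (2 * (\<bar>B\<bar> + 1))"
  have \<delta>: "\<delta> > 0" "\<delta> * \<bar>B\<bar> < e / 2" using e by (auto simp: \<delta>_def field_simps add_nonneg_pos)
  have "e / 4 > 0" using e by simp
  from dec[unfolded L2_decay_FW_iff[OF F], rule_format, OF this]
  obtain K where K: "compact K" "\<And>A. A \<in> F \<Longrightarrow> L2_norm \<mu> (cut K (FW A)) < e / 4"
    by (elim exE conjE) (erule that, erule bspec)
  have cs: "continuous_on UNIV (\<lambda>p. m (snd p) (fst p))" by (intro continuous_intros)
  obtain V where V: "open V" "0 \<in> V" "\<And>\<eta> \<xi>. \<eta> \<in> V \<Longrightarrow> \<xi> \<in> K \<Longrightarrow> cmod (m \<xi> \<eta> - m \<xi> 0) \<le> \<delta>"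
    by (rule uniformly_near_on_compact[of "\<lambda>x y. m y x", OF cs K(1) \<delta>(1), of 0]) blast
  have "\<bar>hs_dist (\<lambda>v. A (U \<eta> v)) A - L2_norm \<mu> (\<lambda>\<xi>. FW A (\<xi> - \<eta>) - FW A \<xi>)\<bar> < e" if "A \<in> F" "\<eta> \<in> V" for A \<eta>
  proof -
    have A: "A \<in> hilbert_schmidt" using that F by auto
    note g = FW_L2[OF A]
    have mm: "(\<lambda>\<xi>. m \<xi> \<eta>) \<in> borel_measurable \<mu>" by (intro borel_measurable_continuous continuous_intros)
    have ph: "(\<lambda>\<xi>. m \<xi> \<eta> * FW A \<xi> - FW A \<xi>) \<in> L2_functions \<mu>"
      "L2_norm \<mu> (\<lambda>\<xi>. m \<xi> \<eta> * FW A \<xi> - FW A \<xi>) \<le> \<delta> * L2_norm \<mu> (FW A) + 2 * L2_norm \<mu> (cut K (FW A))"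
      using L2_norm_phase_le[OF g mm _ K(1), of \<delta>] V(3)[OF that(2)] \<delta> by auto
    define p where "p = (\<lambda>\<xi>. m (\<xi> - \<eta>) \<eta> * FW A (\<xi> - \<eta>) - FW A \<xi>)"
    define q where "q = (\<lambda>\<xi>. FW A (\<xi> - \<eta>) - FW A \<xi>)"
    define r where "r = (\<lambda>\<xi>. m (\<xi> - \<eta>) \<eta> * FW A (\<xi> - \<eta>) - FW A (\<xi> - \<eta>))"
    have r: "r \<in> L2_functions \<mu>" "L2_norm \<mu> r \<le> \<delta> * L2_norm \<mu> (FW A) + 2 * L2_norm \<mu> (cut K (FW A))"
      using L2_functions_translate[OF ph(1), of \<eta>] L2_norm_translate[OF ph(1), of \<eta>] ph(2) by (auto simp: r_def)
    have q: "q \<in> L2_functions \<mu>" unfolding q_def by (intro L2_functions_diff L2_functions_translate g)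
    have p: "p = (\<lambda>\<xi>. q \<xi> + r \<xi>)" by (auto simp: p_def q_def r_def)
    have pL: "p \<in> L2_functions \<mu>" unfolding p by (intro L2_functions_add q r)
    have "L2_norm \<mu> p \<le> L2_norm \<mu> q + L2_norm \<mu> r" unfolding p by (rule L2_norm_triangle[OF q r(1)])
    moreover have "L2_norm \<mu> q \<le> L2_norm \<mu> p + L2_norm \<mu> r"
      using L2_norm_triangle_diff[OF q pL] by (simp add: p L2_norm_uminus)
    moreover have "\<delta> * L2_norm \<mu> (FW A) \<le> \<delta> * \<bar>B\<bar>"
      unfolding L2_norm_FW[OF A] using B[OF that(1)] \<delta> by (intro mult_left_mono) auto
    ultimately have "\<bar>L2_norm \<mu> p - L2_norm \<mu> q\<bar> < e"
      using r(2) K(2)[OF that(1)] \<delta>(2) by linarith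
    then show ?thesis unfolding hs_dist_right[OF A] p_def q_def .
  qed
  then show ?thesis using that V by blast
qed

lemma decay_imp_equicontinuous_iff:
  assumes F: "F \<subseteq> hilbert_schmidt" and B: "\<And>A. A \<in> F \<Longrightarrow> hs_norm A \<le> B" and dec: "L2_decay \<mu> (FW ` F)"
  shows "L2_equicontinuous \<mu> (FW ` F) \<longleftrightarrow> right_equicontinuous F"
proof
  assume L: "L2_equicontinuous \<mu> (FW ` F)"
  show "right_equicontinuous F"
    unfolding right_equicontinuous_def
  proof (intro allI impI)
    fix e :: real assume "e > 0"
    then have e: "e / 2 > 0" by simp
    obtain V where V: "open V" "0 \<in> V"
      "\<And>A \<eta>. A \<in> F \<Longrightarrow> \<eta> \<in> V \<Longrightarrow> \<bar>hs_dist (\<lambda>v. A (U \<eta> v)) A - L2_norm \<mu> (\<lambda>\<xi>. FW A (\<xi> - \<eta>) - FW A \<xi>)\<bar> < e / 2"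
      by (rule decay_imp_translate_close[OF F B dec e]) auto
    obtain W where W: "open W" "0 \<in> W" "\<And>A \<eta>. A \<in> F \<Longrightarrow> \<eta> \<in> W \<Longrightarrow> L2_norm \<mu> (\<lambda>\<xi>. FW A (\<xi> - \<eta>) - FW A \<xi>) < e / 2"
      using L[unfolded L2_equicontinuous_def, rule_format, OF e] by auto
    have "hs_dist (\<lambda>v. A (U \<eta> v)) A < e" if "A \<in> F" "\<eta> \<in> V \<inter> W" for A \<eta>
    proof -
      have "\<bar>hs_dist (\<lambda>v. A (U \<eta> v)) A - L2_norm \<mu> (\<lambda>\<xi>. FW A (\<xi> - \<eta>) - FW A \<xi>)\<bar> < e / 2"
        using V(3) that by blast
      moreover have "\<eta> \<in> W" using that by simp
      note W(3)[OF that(1) this]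
      ultimately show ?thesis by linarith
    qed
    then show "\<exists>V. open V \<and> 0 \<in> V \<and> (\<forall>A\<in>F. \<forall>\<eta>\<in>V. hs_dist (\<lambda>v. A (U \<eta> v)) A < e)"
      using V W by (intro exI[of _ "V \<inter> W"]) auto
  qed
next
  assume R: "right_equicontinuous F"
  show "L2_equicontinuous \<mu> (FW ` F)"
    unfolding L2_equicontinuous_def
  proof (intro allI impI)
    fix e :: real assume "e > 0"
    then have e: "e / 2 > 0" by simp
    obtain V where V: "open V" "0 \<in> V"
      "\<And>A \<eta>. A \<in> F \<Longrightarrow> \<eta> \<in> V \<Longrightarrow> \<bar>hs_dist (\<lambda>v. A (U \<eta> v)) A - L2_norm \<mu> (\<lambda>\<xi>. FW A (\<xi> - \<eta>) - FW A \<xi>)\<bar> < e / 2"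
      by (rule decay_imp_translate_close[OF F B dec e]) auto
    obtain W where W: "open W" "0 \<in> W" "\<And>A \<eta>. A \<in> F \<Longrightarrow> \<eta> \<in> W \<Longrightarrow> hs_dist (\<lambda>v. A (U \<eta> v)) A < e / 2"
      using R[unfolded right_equicontinuous_def, rule_format, OF e] by auto
    have "L2_norm \<mu> (\<lambda>\<xi>. FW A (\<xi> - \<eta>) - FW A \<xi>) < e" if "A \<in> F" "\<eta> \<in> V \<inter> W" for A \<eta>
    proof -
      have "\<bar>hs_dist (\<lambda>v. A (U \<eta> v)) A - L2_norm \<mu> (\<lambda>\<xi>. FW A (\<xi> - \<eta>) - FW A \<xi>)\<bar> < e / 2"
        using V(3) that by blast
      moreover have "\<eta> \<in> W" using that by simp
      note W(3)[OF that(1) this]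
      ultimately show ?thesis by linarith
    qed
    then show "\<exists>V. open V \<and> 0 \<in> V \<and> (\<forall>g\<in>FW ` F. \<forall>\<eta>\<in>V. L2_norm \<mu> (\<lambda>\<xi>. g (\<xi> - \<eta>) - g \<xi>) < e)"
      using V W by (intro exI[of _ "V \<inter> W"]) auto
  qed
qed

section \<open>Single operators and finite nets\<close>

lemma hs_tail_small:
  assumes "A \<in> hilbert_schmidt" "e > 0"
  obtains J where "finite J" "J \<subseteq> some_onb" "hs_norm (\<lambda>v. A v - A (coord_proj J v)) < e"
proof -
  have "\<forall>\<^sub>F J in finite_subsets_at_top some_onb. sqrt ((hs_norm A)\<^sup>2 - (\<Sum>f\<in>J. (norm (A f))\<^sup>2)) < e \<and> finite J \<and> J \<subseteq> some_onb"
    using order_tendstoD(2)[OF tail_tendsto[OF assms(1)] assms(2)] eventually_finite_subset by (auto intro: eventually_conj)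
  then obtain J where J: "sqrt ((hs_norm A)\<^sup>2 - (\<Sum>f\<in>J. (norm (A f))\<^sup>2)) < e" "finite J" "J \<subseteq> some_onb"
    by (auto dest: eventually_happens)
  then show ?thesis using that unfolding hs_coord_proj_tail(2)[OF assms(1) J(2,3), symmetric] by simp
qed

text \<open>Regularity gives tails of bounded continuous functions; a general transform is close in
  norm to the continuous transform of a finite truncation.\<close>

lemma single_decay:
  assumes A: "A \<in> hilbert_schmidt" and e: "e > 0"
  obtains K where "compact K" "L2_norm \<mu> (cut K (FW A)) < e"
proof -
  note rep = fourier_weyl_represents[OF A]
  have e2: "e / 2 > 0" using e by simp
  obtain J where J: "finite J" "J \<subseteq> some_onb" "hs_norm (\<lambda>v. A v - A (coord_proj J v)) < e / 2"
    by (rule hs_tail_small[OF A e2])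
  have "hs_dist A (\<lambda>v. A (coord_proj J v)) = L2_norm \<mu> (\<lambda>\<xi>. FW A \<xi> - partial A J \<xi>)"
    by (rule hs_dist_represents[OF rep represents_partial[OF A J(1,2)]])
  then have d: "L2_norm \<mu> (\<lambda>\<xi>. FW A \<xi> - partial A J \<xi>) < e / 2" using J(3) by (simp add: hs_dist_def)
  obtain K where K: "compact K" "L2_norm \<mu> (cut K (partial A J)) < e / 2"
    using bounded_continuous_tail[OF partial_L2 continuous_partial norm_partial_le, of "e / 2"] e by (metis half_gt_zero)
  note g = FW_L2[OF A]
  have "L2_norm \<mu> (cut K (FW A)) \<le> 1 * L2_norm \<mu> (\<lambda>\<xi>. FW A \<xi> - partial A J \<xi>) + 1 * L2_norm \<mu> (cut K (partial A J))"
  proof (rule L2_norm_le_add[OF cut_L2[OF g K(1)] L2_functions_diff[OF g partial_L2] cut_L2[OF partial_L2 K(1)]])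
    show "cmod (cut K (FW A) \<xi>) \<le> 1 * cmod (FW A \<xi> - partial A J \<xi>) + 1 * cmod (cut K (partial A J) \<xi>)" for \<xi>
      using norm_triangle_ineq[of "FW A \<xi> - partial A J \<xi>" "partial A J \<xi>"] by (auto simp: cut_def)
  qed auto
  then show ?thesis using that K d by force
qed

text \<open>Strong continuity concerns \<open>U\<close> applied to vectors, so \<open>U\<close> has
  to stand on the left. With \<open>B\<close> the adjoint of \<open>A\<close>, the adjoint of
  \<open>A U - A\<close> becomes \<open>B - U B\<close> after multiplication by the unitary;
  finitely many columns \<open>B f\<close> are moved continuously and the remaining part
  \<open>D\<close> is small.\<close>

lemma single_right_equicontinuous:
  assumes A: "A \<in> hilbert_schmidt" and e: "e > 0"
  obtains V where "open V" "0 \<in> V" "\<And>\<eta>. \<eta> \<in> V \<Longrightarrow> hs_dist (\<lambda>v. A (U \<eta> v)) A < e"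
proof -
  define B where "B = cadjoint A"
  have B: "B \<in> hilbert_schmidt" unfolding B_def by (rule hs_cadjoint(1)[OF A])
  have bA: "bounded_clinear A" and bB: "bounded_clinear B" using A B hs_bounded_clinear by auto
  have e3: "e / 3 > 0" using e by simp
  obtain J where J: "finite J" "J \<subseteq> some_onb" "hs_norm (\<lambda>v. B v - B (coord_proj J v)) < e / 3"
    by (rule hs_tail_small[OF B e3])
  define D where "D v = B v - B (coord_proj J v)" for v
  have D: "D \<in> hilbert_schmidt" "hs_norm D < e / 3"
    unfolding D_def[abs_def] by (rule hs_coord_proj_tail(1)[OF B J(1,2)], rule J(3))
  define V where "V = {\<eta>. sqrt (\<Sum>f\<in>J. (norm (B f - U \<eta> (B f)))\<^sup>2) < e / 3}"
  have "open V" unfolding V_def by (intro open_Collect_less continuous_intros continuous_U)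
  moreover have "0 \<in> V" using e by (simp add: V_def)
  moreover have "hs_dist (\<lambda>v. A (U \<eta> v)) A < e" if "\<eta> \<in> V" for \<eta>
  proof -
    have AU: "(\<lambda>v. A (U \<eta> v)) \<in> hilbert_schmidt" by (rule hs_unitary_right(1)[OF A unitary])
    define X where "X v = cadjoint (U \<eta>) (B v) - B v" for v
    have adj: "cadjoint (\<lambda>v. A (U \<eta> v) - A v) = X"
      using cadjoint_diff[OF hs_bounded_clinear[OF AU] bA] cadjoint_comp[OF bA bclinear_U]
      by (simp add: X_def[abs_def] B_def)
    have X: "X \<in> hilbert_schmidt" unfolding adj[symmetric] by (rule hs_cadjoint(1)[OF hs_diff(1)[OF AU A]])
    note BP = hs_comp_coord_proj[OF B J(1,2)]
    have "hs_dist (\<lambda>v. A (U \<eta> v)) A = hs_norm X"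
      unfolding hs_dist_def adj[symmetric] by (rule hs_cadjoint(2)[OF hs_diff(1)[OF AU A], symmetric])
    also have "\<dots> = hs_norm (\<lambda>v. U \<eta> (X v))" by (rule hs_unitary_left(2)[OF X unitary, symmetric])
    also have "(\<lambda>v. U \<eta> (X v)) = (\<lambda>v. (B (coord_proj J v) - U \<eta> (B (coord_proj J v))) + (D v - U \<eta> (D v)))"
      by (simp add: X_def D_def U_simps)
    also have "hs_norm \<dots> \<le> hs_norm (\<lambda>v. B (coord_proj J v) - U \<eta> (B (coord_proj J v))) + hs_norm (\<lambda>v. D v - U \<eta> (D v))"
      by (rule hs_add(2)[OF hs_diff(1)[OF BP hs_unitary_left(1)[OF BP unitary]] hs_diff(1)[OF D(1) hs_unitary_left(1)[OF D(1) unitary]]])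
    also have "hs_norm (\<lambda>v. D v - U \<eta> (D v)) \<le> hs_norm D + hs_norm D"
      using hs_diff(2)[OF D(1) hs_unitary_left(1)[OF D(1) unitary]] hs_unitary_left(2)[OF D(1) unitary] by simp
    also have "hs_norm (\<lambda>v. B (coord_proj J v) - U \<eta> (B (coord_proj J v))) = sqrt (\<Sum>f\<in>J. (norm (B f - U \<eta> (B f)))\<^sup>2)"
      using hs_norm_comp_coord_proj[of "\<lambda>w. B w - U \<eta> (B w)", OF _ J(1,2)]
        bounded_clinear_diff[OF bB bounded_clinear_comp[OF bclinear_U bB]]
      by (metis hs_norm_nonneg real_sqrt_unique)
    finally show ?thesis using that D(2) by (simp add: V_def)
  qed
  ultimately show ?thesis using that by blast
qed

text \<open>Each single operator has the property; finite unions of compact sets make it uniform on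
  a net and the isometry carries it to the family.\<close>

lemma net_imp_decay:
  assumes F: "F \<subseteq> hilbert_schmidt"
    and net: "\<And>e. e > 0 \<Longrightarrow> \<exists>N. finite N \<and> N \<subseteq> hilbert_schmidt \<and> (\<forall>A\<in>F. \<exists>B\<in>N. hs_dist A B < e)"
  shows "L2_decay \<mu> (FW ` F)"
  unfolding L2_decay_FW_iff[OF F]
proof (intro allI impI)
  fix e :: real assume e: "e > 0"
  obtain N where N: "finite N" "N \<subseteq> hilbert_schmidt" "\<And>A. A \<in> F \<Longrightarrow> \<exists>B\<in>N. hs_dist A B < e / 2"
    using net[of "e / 2"] e by auto
  have "\<forall>B\<in>N. \<exists>K. compact K \<and> L2_norm \<mu> (cut K (FW B)) < e / 2"
    using single_decay[of _ "e / 2"] N(2) e by (metis half_gt_zero subsetD)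
  then obtain K where K: "\<And>B. B \<in> N \<Longrightarrow> compact (K B) \<and> L2_norm \<mu> (cut (K B) (FW B)) < e / 2" by metis
  define L where "L = (\<Union>B\<in>N. K B)"
  have L: "compact L" unfolding L_def using K N(1) by (intro compact_UN) auto
  have "L2_norm \<mu> (cut L (FW A)) < e" if A: "A \<in> F" for A
  proof -
    obtain B where B: "B \<in> N" "hs_dist A B < e / 2" using N(3)[OF A] by blast
    have hA: "A \<in> hilbert_schmidt" and hB: "B \<in> hilbert_schmidt" using A F B N by auto
    have KB: "compact (K B)" "L2_norm \<mu> (cut (K B) (FW B)) < e / 2" using K[OF B(1)] by auto
    note gA = FW_L2[OF hA] and gB = FW_L2[OF hB]
    have "L2_norm \<mu> (cut L (FW A)) \<le> 1 * L2_norm \<mu> (\<lambda>\<xi>. FW A \<xi> - FW B \<xi>) + 1 * L2_norm \<mu> (cut (K B) (FW B))"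
    proof (rule L2_norm_le_add[OF cut_L2[OF gA L] L2_functions_diff[OF gA gB] cut_L2[OF gB KB(1)]])
      show "cmod (cut L (FW A) \<xi>) \<le> 1 * cmod (FW A \<xi> - FW B \<xi>) + 1 * cmod (cut (K B) (FW B) \<xi>)" for \<xi>
        using norm_triangle_ineq[of "FW A \<xi> - FW B \<xi>" "FW B \<xi>"] B(1) by (auto simp: cut_def L_def)
    qed auto
    also have "L2_norm \<mu> (\<lambda>\<xi>. FW A \<xi> - FW B \<xi>) = hs_dist A B"
      by (intro hs_dist_represents[symmetric] fourier_weyl_represents hA hB)
    finally show ?thesis using KB(2) B(2) by simp
  qed
  then show "\<exists>K. compact K \<and> (\<forall>A\<in>F. L2_norm \<mu> (cut K (FW A)) < e)" using L by blast
qed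

lemma net_imp_right_equicontinuous:
  assumes F: "F \<subseteq> hilbert_schmidt"
    and net: "\<And>e. e > 0 \<Longrightarrow> \<exists>N. finite N \<and> N \<subseteq> hilbert_schmidt \<and> (\<forall>A\<in>F. \<exists>B\<in>N. hs_dist A B < e)"
  shows "right_equicontinuous F"
  unfolding right_equicontinuous_def
proof (intro allI impI)
  fix e :: real assume e: "e > 0"
  obtain N where N: "finite N" "N \<subseteq> hilbert_schmidt" "\<And>A. A \<in> F \<Longrightarrow> \<exists>B\<in>N. hs_dist A B < e / 3"
    using net[of "e / 3"] e by auto
  have "\<forall>B\<in>N. \<exists>V. open V \<and> 0 \<in> V \<and> (\<forall>\<eta>\<in>V. hs_dist (\<lambda>v. B (U \<eta> v)) B < e / 3)"
  proof
    fix B assume "B \<in> N"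
    then show "\<exists>V. open V \<and> 0 \<in> V \<and> (\<forall>\<eta>\<in>V. hs_dist (\<lambda>v. B (U \<eta> v)) B < e / 3)"
      using single_right_equicontinuous[of B "e / 3"] N(2) e by (metis divide_pos_pos subsetD zero_less_numeral)
  qed
  then obtain V where V: "\<And>B. B \<in> N \<Longrightarrow> open (V B) \<and> 0 \<in> V B \<and> (\<forall>\<eta>\<in>V B. hs_dist (\<lambda>v. B (U \<eta> v)) B < e / 3)" by metis
  define W where "W = (\<Inter>B\<in>N. V B)"
  have W: "open W" "0 \<in> W" unfolding W_def using V N(1) by auto
  have "hs_dist (\<lambda>v. A (U \<eta> v)) A < e" if A: "A \<in> F" and \<eta>: "\<eta> \<in> W" for A \<eta>
  proof -
    obtain B where B: "B \<in> N" "hs_dist A B < e / 3" using N(3)[OF A] by blast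
    have hA: "A \<in> hilbert_schmidt" and hB: "B \<in> hilbert_schmidt" using A F B N by auto
    note UA = hs_unitary_right(1)[OF hA unitary[of \<eta>]] and UB = hs_unitary_right(1)[OF hB unitary[of \<eta>]]
    have 1: "hs_dist (\<lambda>v. A (U \<eta> v)) (\<lambda>v. B (U \<eta> v)) = hs_dist A B"
      using hs_unitary_right(2)[OF hs_diff(1)[OF hA hB] unitary[of \<eta>]] by (simp add: hs_dist_def)
    have 2: "hs_dist (\<lambda>v. B (U \<eta> v)) B < e / 3" using V[OF B(1)] \<eta> B(1) by (auto simp: W_def)
    have "hs_dist (\<lambda>v. A (U \<eta> v)) A \<le> hs_dist (\<lambda>v. A (U \<eta> v)) (\<lambda>v. B (U \<eta> v)) + hs_dist (\<lambda>v. B (U \<eta> v)) A"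
      by (rule hs.triangle[OF UA UB hA])
    also have "hs_dist (\<lambda>v. B (U \<eta> v)) A \<le> hs_dist (\<lambda>v. B (U \<eta> v)) B + hs_dist B A"
      by (rule hs.triangle[OF UB hB hA])
    finally show ?thesis using 1 2 B(2) hs.commute[of A B] by simp
  qed
  then show "\<exists>V. open V \<and> 0 \<in> V \<and> (\<forall>A\<in>F. \<forall>\<eta>\<in>V. hs_dist (\<lambda>v. A (U \<eta> v)) A < e)" using W by blast
qed

end

section \<open>Averaging operators\<close>

context weyl_rep
begin

text \<open>\<open>B\<close> is the integral of \<open>k \<xi>\<close> times \<open>U \<xi>\<close>
  in the weak sense, that is, the inverse transform of \<open>k\<close>. It is Hilbert-Schmidt by
  duality with the transforms of finite-rank operators.\<close>

lemma weak_operator: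
  assumes k: "k \<in> L2_functions \<mu>"
  shows "\<exists>B\<in>hilbert_schmidt. \<forall>u w. cinner (B u) w = (LINT \<xi>|\<mu>. k \<xi> * cnj (coef w u \<xi>))"
proof -
  define \<psi> where "\<psi> u w = (LINT \<xi>|\<mu>. k \<xi> * cnj (coef w u \<xi>))" for u w
  have int: "integrable \<mu> (\<lambda>\<xi>. k \<xi> * cnj (coef w u \<xi>))" for u w
    by (rule L2_mult_integrable(3)[OF k coef_L2])
  have "\<exists>B. bounded_clinear B \<and> (\<forall>u w. cinner (B u) w = \<psi> u w) \<and> (\<forall>u. norm (B u) \<le> L2_norm \<mu> k * norm u)"
  proof (rule operator_of_form)
    fix u u' w w' :: 'h and c
    have "\<psi> (u + u') w = (LINT \<xi>|\<mu>. k \<xi> * cnj (coef w u \<xi>) + k \<xi> * cnj (coef w u' \<xi>))"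
      unfolding \<psi>_def by (simp add: coef_def U_simps cinner_add_right algebra_simps)
    then show "\<psi> (u + u') w = \<psi> u w + \<psi> u' w" unfolding \<psi>_def using int by simp
    have "\<psi> (c *\<^sub>C u) w = (LINT \<xi>|\<mu>. c * (k \<xi> * cnj (coef w u \<xi>)))"
      unfolding \<psi>_def by (simp add: coef_def U_simps cinner_scaleC_right algebra_simps)
    then show "\<psi> (c *\<^sub>C u) w = c * \<psi> u w" unfolding \<psi>_def by simp
    have "\<psi> u (w + w') = (LINT \<xi>|\<mu>. k \<xi> * cnj (coef w u \<xi>) + k \<xi> * cnj (coef w' u \<xi>))"
      unfolding \<psi>_def by (simp add: coef_def cinner_add_left algebra_simps)
    then show "\<psi> u (w + w') = \<psi> u w + \<psi> u w'" unfolding \<psi>_def using int by simp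
    have "\<psi> u (c *\<^sub>C w) = (LINT \<xi>|\<mu>. cnj c * (k \<xi> * cnj (coef w u \<xi>)))"
      unfolding \<psi>_def by (simp add: coef_def cinner_scaleC_left algebra_simps)
    then show "\<psi> u (c *\<^sub>C w) = cnj c * \<psi> u w" unfolding \<psi>_def by simp
    show "cmod (\<psi> u w) \<le> L2_norm \<mu> k * norm u * norm w"
      unfolding \<psi>_def using L2_cinner_le(2)[OF k coef_L2[of w u]] by (simp add: mult_ac)
  qed simp
  then obtain B where B: "bounded_clinear B" "\<And>u w. cinner (B u) w = \<psi> u w" by blast
  have "(\<Sum>e\<in>J. \<Sum>f\<in>K. (cmod (cinner (B e) f))\<^sup>2) \<le> (L2_norm \<mu> k)\<^sup>2"
    if J: "finite J" "J \<subseteq> some_onb" and K: "finite K" "K \<subseteq> some_onb" for J K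
  proof -
    \<comment> \<open>Testing \<open>k\<close> on the transform of the finite block itself produces
      the sum \<open>s\<close> of its squared entries, while that transform has norm
      \<open>sqrt s\<close>.\<close>
    define A where "A v = coord_proj K (B v)" for v
    define s where "s = (\<Sum>e\<in>J. (norm (A e))\<^sup>2)"
    have s0: "s \<ge> 0" by (simp add: s_def sum_nonneg)
    have nA: "(norm (A e))\<^sup>2 = (\<Sum>f\<in>K. (cmod (cinner (B e) f))\<^sup>2)" for e
      unfolding A_def coord_proj_def by (rule norm_orthonormal_sum[OF orthonormal_some_onb K])
    have ip: "cinner (B e) (A e) = complex_of_real ((norm (A e))\<^sup>2)" for e
      unfolding nA by (simp add: A_def coord_proj_def cinner_sum_right cinner_scaleC_right complex_norm_square mult.commute
         flip: of_real_power)
    have "(LINT \<xi>|\<mu>. k \<xi> * cnj (partial A J \<xi>)) = (\<Sum>e\<in>J. cinner (B e) (A e))"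
      unfolding integral_partial_right[OF k] B(2) \<psi>_def ..
    also have "\<dots> = complex_of_real s" by (simp add: ip s_def)
    finally have "s = cmod (LINT \<xi>|\<mu>. k \<xi> * cnj (partial A J \<xi>))" using s0 by simp
    also have "\<dots> \<le> L2_norm \<mu> k * L2_norm \<mu> (partial A J)" by (rule L2_cinner_le(2)[OF k partial_L2])
    also have "L2_norm \<mu> (partial A J) = sqrt s"
      using L2_norm_partial[OF J, of A] by (metis L2_norm_nonneg real_sqrt_unique s_def)
    finally have "s \<le> L2_norm \<mu> k * sqrt s" .
    then have "s \<le> (L2_norm \<mu> k)\<^sup>2" using s0 by (intro le_mult_sqrt_imp_le_square) auto
    then show ?thesis by (simp add: s_def nA)
  qed
  from hs_entryI(1)[OF B(1) L2_norm_nonneg this] B(2) show ?thesis unfolding \<psi>_def by blast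
qed

text \<open>Up to a small error \<open>B\<close> sees only finitely many coordinates of
  \<open>U \<xi> v\<close>, and each coordinate is a matrix coefficient up to conjugation, hence
  small off a compact set.\<close>

lemma hs_orbit_vanishes_at_infinity:
  assumes B: "B \<in> hilbert_schmidt" and e: "e > 0"
  obtains K where "compact K" "\<And>\<xi>. \<xi> \<notin> K \<Longrightarrow> cmod (cinner (B (U \<xi> v)) (U \<xi> v)) < e"
proof -
  \<comment> \<open>Both \<open>n\<close> and \<open>c\<close> strictly exceed the factor they are
    to absorb, so the truncation error and the finite part each stay below
    \<open>e / 2\<close>.\<close>
  define n where "n = norm v * norm v + 1"
  have n: "n > 0" "norm v * norm v < n" by (auto simp: n_def add_nonneg_pos)
  have bB: "bounded_clinear B" by (rule hs_bounded_clinear[OF B])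
  obtain J where J: "finite J" "J \<subseteq> some_onb" "hs_norm (\<lambda>w. B w - B (coord_proj J w)) < e / (2 * n)"
    by (rule hs_tail_small[OF B, of "e / (2 * n)"]) (use e n in auto)
  define c where "c = (\<Sum>f\<in>J. norm (B f)) * norm v + 1"
  have c: "c > 0" by (simp add: c_def add_nonneg_pos sum_nonneg)
  have "\<forall>f. \<exists>K. compact K \<and> (\<forall>\<xi>. \<xi> \<notin> K \<longrightarrow> cmod (coef f v \<xi>) < e / (2 * c))"
  proof
    fix f
    have "e / (2 * c) > 0" using e c by simp
    then show "\<exists>K. compact K \<and> (\<forall>\<xi>. \<xi> \<notin> K \<longrightarrow> cmod (coef f v \<xi>) < e / (2 * c))"
      by (rule coef_vanishes_at_infinity[where u = f and v = v]) blast
  qed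
  from choice[OF this] obtain K
    where K: "\<And>f. compact (K f)" "\<And>f \<xi>. \<xi> \<notin> K f \<Longrightarrow> cmod (coef f v \<xi>) < e / (2 * c)"
    by blast
  have "compact (\<Union>f\<in>J. K f)" using J(1) K(1) by (intro compact_UN) auto
  moreover have "cmod (cinner (B (U \<xi> v)) (U \<xi> v)) < e" if xi: "\<xi> \<notin> (\<Union>f\<in>J. K f)" for \<xi>
  proof -
    let ?w = "U \<xi> v"
    have "norm (B ?w - B (coord_proj J ?w)) \<le> e / (2 * n) * norm v"
      using norm_le_hs_norm[OF hs_coord_proj_tail(1)[OF B J(1,2)], of ?w]
        mult_right_mono[OF less_imp_le[OF J(3)] norm_ge_zero[of v]] by simp
    then have "norm (B ?w - B (coord_proj J ?w)) * norm v \<le> e / (2 * n) * norm v * norm v"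
      by (intro mult_right_mono) auto
    also have "\<dots> = e / (2 * n) * (norm v * norm v)" by (simp add: mult.assoc)
    also have "\<dots> < e / (2 * n) * n" using n e by (intro mult_strict_left_mono) auto
    also have "\<dots> = e / 2" using n by simp
    finally have 1: "norm (B ?w - B (coord_proj J ?w)) * norm v < e / 2" .
    have "norm (B (coord_proj J ?w)) \<le> (\<Sum>f\<in>J. cmod (cinner ?w f) * norm (B f))"
      unfolding coord_proj_def bounded_clinear_simps[OF bB]
      by (rule order.trans[OF norm_sum]) (simp add: norm_scaleC)
    also have "\<dots> \<le> (\<Sum>f\<in>J. e / (2 * c) * norm (B f))"
    proof (intro sum_mono mult_right_mono)
      fix f assume "f \<in> J"
      then have "cmod (coef f v \<xi>) < e / (2 * c)" using xi by (intro K(2)) auto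
      moreover have "cmod (cinner ?w f) = cmod (coef f v \<xi>)"
        unfolding coef_def by (metis cinner_commute complex_mod_cnj)
      ultimately show "cmod (cinner ?w f) \<le> e / (2 * c)" by simp
    qed auto
    finally have "norm (B (coord_proj J ?w)) \<le> e / (2 * c) * (\<Sum>f\<in>J. norm (B f))" by (simp add: sum_distrib_left)
    then have "norm (B (coord_proj J ?w)) * norm v \<le> e / (2 * c) * (\<Sum>f\<in>J. norm (B f)) * norm v"
      by (intro mult_right_mono) auto
    also have "\<dots> = e / (2 * c) * ((\<Sum>f\<in>J. norm (B f)) * norm v)" by (simp add: mult.assoc)
    also have "\<dots> < e / (2 * c) * c" using c e by (intro mult_strict_left_mono) (auto simp: c_def)
    also have "\<dots> = e / 2" using c by simp
    finally have 2: "norm (B (coord_proj J ?w)) * norm v < e / 2" .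
    have "cmod (cinner (B ?w) ?w) \<le> norm (B ?w) * norm v" using norm_cinner_le[of "B ?w" ?w] by simp
    also have "\<dots> \<le> (norm (B ?w - B (coord_proj J ?w)) + norm (B (coord_proj J ?w))) * norm v"
      using norm_triangle_ineq[of "B ?w - B (coord_proj J ?w)" "B (coord_proj J ?w)"] by (intro mult_right_mono) auto
    finally show ?thesis using 1 2 by (simp add: algebra_simps)
  qed
  ultimately show ?thesis using that by blast
qed

text \<open>The weight is a multiple of a squared matrix coefficient cut off to a small compact set: since
  \<open>\<sigma>(x,\<xi>)\<close> is absorbed by a diagonal coefficient at \<open>U\<^sub>\<xi> v\<close>, its Fourier transform is a matrix element
  of a Hilbert-Schmidt operator along an orbit, which replaces the Riemann-Lebesgue lemma.\<close>

lemma concentrated_weight: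
  assumes V: "open V" "0 \<in> V"
  obtains h :: "'a \<Rightarrow> real" and C K where "compact C" "C \<subseteq> V" "\<And>x. h x \<ge> 0" "\<And>x. x \<notin> C \<Longrightarrow> h x = 0"
    "integrable \<mu> h" "(LINT x|\<mu>. h x) = 1" "(\<lambda>x. complex_of_real (h x)) \<in> L2_functions \<mu>"
    "compact K" "\<And>\<xi>. \<xi> \<notin> K \<Longrightarrow> cmod (LINT x|\<mu>. complex_of_real (h x) * sig x \<xi>) < 1 / 2"
proof -
  obtain v0 :: 'h where v0: "v0 \<noteq> 0" using nontrivial by blast
  define v where "v = (1 / norm v0) *\<^sub>R v0"
  have v: "norm v = 1" using v0 by (simp add: v_def)
  define \<phi> where "\<phi> = coef v v"
  have \<phi>: "continuous_on UNIV \<phi>" "\<phi> \<in> L2_functions \<mu>" "\<And>x. cmod (\<phi> x) \<le> 1" "\<phi> 0 = 1"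
    using norm_coef_le[of v v] continuous_coef v by (auto simp: \<phi>_def) (simp add: coef_def cinner_self)
  obtain W C where W: "open W" "compact C" "0 \<in> W" "W \<subseteq> C" "C \<subseteq> V" by (rule compact_nbhd[OF V])
  have Cs [measurable]: "C \<in> sets \<mu>" by (rule compact_sets[OF W(2)])
  have \<phi>m [measurable]: "\<phi> \<in> borel_measurable \<mu>" by (rule L2_functionsD(1)[OF \<phi>(2)])
  define h0 where "h0 x = indicator C x * (cmod (\<phi> x))\<^sup>2" for x
  have h0_int: "integrable \<mu> h0"
    by (rule Bochner_Integration.integrable_bound[OF L2_functionsD(2)[OF \<phi>(2)]])
      (auto simp: h0_def[abs_def] indicator_def)
  define c where "c = (LINT x|\<mu>. h0 x)"
  \<comment> \<open>Here \<open>h0\<close> is at least 1/4, and \<open>W'\<close> is open and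
    nonempty, so the total mass \<open>c\<close> is positive and \<open>h0\<close> can be
    normalized.\<close>
  define W' where "W' = W \<inter> {x. cmod (\<phi> x) > 1 / 2}"
  have W': "open W'" "0 \<in> W'" unfolding W'_def using W \<phi>
    by (auto intro!: open_Int open_Collect_less continuous_intros)
  have W'f: "emeasure \<mu> W' < \<infinity>"
  proof -
    have "emeasure \<mu> W' \<le> emeasure \<mu> C" using W(4) Cs by (intro emeasure_mono) (auto simp: W'_def)
    then show ?thesis using emeasure_compact_finite[OF W(2)] by (rule le_less_trans)
  qed
  have "measure \<mu> W' > 0"
  proof -
    have "emeasure \<mu> W' = ennreal (measure \<mu> W')" using W'f by (simp add: emeasure_eq_ennreal_measure)
    then show ?thesis using emeasure_open_pos[OF W'(1)] W'(2) by auto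
  qed
  moreover have "(1/4) * measure \<mu> W' \<le> c"
  proof -
    have iW: "integrable \<mu> (\<lambda>x. indicator W' x :: real)" using W'f W'(1) by (intro integrable_real_indicator) auto
    have "(LINT x|\<mu>. (1/4) * indicator W' x) \<le> (LINT x|\<mu>. h0 x)"
    proof (rule integral_mono[OF _ h0_int])
      show "(1/4) * indicator W' x \<le> h0 x" for x
      proof (cases "x \<in> W'")
        case True
        then have "(1/2)\<^sup>2 \<le> (cmod (\<phi> x))\<^sup>2" by (intro power_mono) (auto simp: W'_def)
        then show ?thesis using True W(4) by (auto simp: h0_def W'_def power2_eq_square)
      qed (simp add: h0_def)
    qed (use iW in auto)
    then show ?thesis using W'(1) by (simp add: c_def)
  qed
  ultimately have c: "c > 0" by linarith
  define h where "h x = h0 x / c" for x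
  have h0: "h x \<ge> 0" for x using c by (simp add: h_def h0_def)
  have hC: "h x = 0" if "x \<notin> C" for x using that by (simp add: h_def h0_def)
  have h_int: "integrable \<mu> h" unfolding h_def[abs_def] using h0_int by simp
  have h1: "(LINT x|\<mu>. h x) = 1" using c by (simp add: h_def c_def)
  have hL2: "(\<lambda>x. complex_of_real (h x)) \<in> L2_functions \<mu>"
  proof (rule L2_functions_bound[OF \<phi>(2), of _ "1 / c"])
    show "(\<lambda>x. complex_of_real (h x)) \<in> borel_measurable \<mu>" using h_int by measurable
    fix x
    have "(cmod (\<phi> x))\<^sup>2 \<le> cmod (\<phi> x)" using \<phi>(3)[of x] by (simp add: power2_eq_square mult_left_le)
    then show "cmod (complex_of_real (h x)) \<le> 1 / c * cmod (\<phi> x)"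
      using c by (auto simp: h_def h0_def indicator_def norm_divide divide_right_mono norm_power)
  qed (use c in auto)
  \<comment> \<open>Only one factor \<phi> goes into \<open>k\<close>; its conjugate is supplied by
    the diagonal coefficient in \<open>hat\<close>, which restores the squared modulus in
    \<open>h\<close>.\<close>
  define k where "k x = complex_of_real (indicator C x / c) * \<phi> x" for x
  have k: "k \<in> L2_functions \<mu>" unfolding k_def
    by (rule L2_functions_mult[OF \<phi>(2), of _ "1 / c"]) (use c in \<open>auto simp: indicator_def norm_divide\<close>)
  obtain B where B: "B \<in> hilbert_schmidt" "\<And>u w. cinner (B u) w = (LINT \<xi>|\<mu>. k \<xi> * cnj (coef w u \<xi>))"
    using weak_operator[OF k] by blast
  have hat: "cinner (B (U \<xi> v)) (U \<xi> v) = (LINT x|\<mu>. complex_of_real (h x) * sig x \<xi>)" for \<xi>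
    unfolding B(2)
  proof (rule Bochner_Integration.integral_cong[OF refl])
    fix x
    have "coef (U \<xi> v) (U \<xi> v) x = cnj (sig x \<xi>) * \<phi> x"
      by (simp add: coef_def \<phi>_def U_commute[of x] cinner_scaleC_right)
    then have "k x * cnj (coef (U \<xi> v) (U \<xi> v) x) = complex_of_real (indicator C x / c) * (\<phi> x * cnj (\<phi> x)) * sig x \<xi>"
      by (simp add: k_def)
    then show "k x * cnj (coef (U \<xi> v) (U \<xi> v) x) = complex_of_real (h x) * sig x \<xi>"
      by (simp add: complex_norm_square[symmetric] h_def h0_def)
  qed
  obtain K where K: "compact K" "\<And>\<xi>. \<xi> \<notin> K \<Longrightarrow> cmod (cinner (B (U \<xi> v)) (U \<xi> v)) < 1 / 2"
    by (rule hs_orbit_vanishes_at_infinity[OF B(1), of "1 / 2"]) auto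
  show ?thesis
    by (rule that[OF W(2,5) h0 hC h_int h1 hL2 K(1)]) (use K(2) hat in auto)
qed

end

section \<open>Equicontinuity and decay imply precompactness\<close>

context weyl_rep
begin

text \<open>Finitely many nodes suffice on a compact set of frequencies; this stands in for an exchange of
  integrals, which is not available since neither \<open>\<mu>\<close> is \<open>\<sigma>\<close>-finite nor is \<open>sig\<close> measurable for
  the product \<open>\<sigma>\<close>-algebra in general.\<close>

lemma quadrature:
  assumes C: "compact C" and h: "\<And>x. h x \<ge> 0" "\<And>x. x \<notin> C \<Longrightarrow> h x = 0" "integrable \<mu> h"
    and K: "compact K" and d: "\<delta> > 0"
  obtains X and w :: "'a \<Rightarrow> real" where "finite X" "X \<subseteq> C" "\<And>x. w x \<ge> 0" "(\<Sum>x\<in>X. w x) = (LINT x|\<mu>. h x)"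
    "\<And>\<xi>. \<xi> \<in> K \<Longrightarrow> cmod ((LINT x|\<mu>. complex_of_real (h x) * sig x \<xi>) - (\<Sum>x\<in>X. complex_of_real (w x) * sig x \<xi>))
        \<le> \<delta> * (LINT x|\<mu>. h x)"
proof -
  have cs: "continuous_on UNIV (\<lambda>p. sig (fst p) (snd p))" by (intro continuous_intros)
  have "\<forall>x. \<exists>V. open V \<and> x \<in> V \<and> (\<forall>y\<in>V. \<forall>\<xi>\<in>K. cmod (sig y \<xi> - sig x \<xi>) \<le> \<delta>)"
  proof
    fix x
    show "\<exists>V. open V \<and> x \<in> V \<and> (\<forall>y\<in>V. \<forall>\<xi>\<in>K. cmod (sig y \<xi> - sig x \<xi>) \<le> \<delta>)"
      by (rule uniformly_near_on_compact[OF cs K d, of x]) blast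
  qed
  from choice[OF this] obtain V where V: "\<And>x. open (V x)" "\<And>x. x \<in> V x"
    "\<And>x y \<xi>. y \<in> V x \<Longrightarrow> \<xi> \<in> K \<Longrightarrow> cmod (sig y \<xi> - sig x \<xi>) \<le> \<delta>" by blast
  obtain X where X: "X \<subseteq> C" "finite X" "C \<subseteq> (\<Union>x\<in>X. V x)"
    by (rule compactE_image[OF C, of C V]) (use V(1,2) in auto)
  \<comment> \<open>An enumeration of the nodes makes the cover disjoint: \<open>D x\<close> is the
    cell of the node \<open>x\<close>, and \<open>w x\<close> below is the mass of \<open>h\<close>
    on that cell.\<close>
  obtain b where b: "bij_betw b {0..<card X} X" using ex_bij_betw_nat_finite[OF X(2)] by blast
  define D where "D x = C \<inter> disjointed (\<lambda>i. V (b i)) (inv_into {0..<card X} b x)" for x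
  have bX: "b (inv_into {0..<card X} b x) = x" "inv_into {0..<card X} b x < card X" if "x \<in> X" for x
    using b that bij_betw_inv_into_right[OF b that] inv_into_into[of x b "{0..<card X}"]
    by (auto simp: bij_betw_def)
  have DV: "D x \<subseteq> V x" if "x \<in> X" for x
    using disjointed_subset[of "\<lambda>i. V (b i)" "inv_into {0..<card X} b x"] bX(1)[OF that] by (auto simp: D_def)
  have Ds: "D x \<in> sets \<mu>" for x
    unfolding D_def disjointed_def using compact_sets[OF C] V(1) by (intro sets.Int sets.Diff sets.finite_UN) auto
  have ind: "(\<Sum>x\<in>X. indicator (D x) y) = (indicator C y :: real)" for y
  proof (cases "y \<in> C")
    case True
    then obtain x where x: "x \<in> X" "y \<in> V x" using X(3) by blast
    have "x \<in> b ` {0..<card X}" using b x(1) by (simp add: bij_betw_def)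
    then have "y \<in> (\<Union>i\<in>{0..<card X}. V (b i))" using x(2) by blast
    then have "y \<in> (\<Union>i\<in>{0..<card X}. disjointed (\<lambda>i. V (b i)) i)" by (simp only: finite_UN_disjointed_eq)
    then obtain i where i: "i < card X" "y \<in> disjointed (\<lambda>i. V (b i)) i" by auto
    have bi: "b i \<in> X" "inv_into {0..<card X} b (b i) = i"
      using b i(1) bij_betw_inv_into_left[OF b, of i] by (auto simp: bij_betw_def)
    have "indicator (D x) y = (if x = b i then 1 else 0 :: real)" if "x \<in> X" for x
    proof (cases "x = b i")
      case True
      then show ?thesis using i bi \<open>y \<in> C\<close> by (simp add: D_def)
    next
      case False
      then have "inv_into {0..<card X} b x \<noteq> i" using bX(1)[OF that] by auto
      then have "y \<notin> disjointed (\<lambda>i. V (b i)) (inv_into {0..<card X} b x)"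
        using disjoint_family_disjointed[of "\<lambda>i. V (b i)"] i(2) unfolding disjoint_family_on_def by blast
      then show ?thesis using False by (simp add: D_def)
    qed
    then have "(\<Sum>x\<in>X. indicator (D x) y) = (\<Sum>x\<in>X. if x = b i then 1 else 0 :: real)" by (intro sum.cong) auto
    then show ?thesis using X(2) bi(1) True by simp
  qed (auto simp: D_def intro!: sum.neutral)
  define w where "w x = (LINT y|\<mu>. h y * indicator (D x) y)" for x
  have hD: "integrable \<mu> (\<lambda>y. h y * indicator (D x) y)" for x
    using integrable_real_mult_indicator[OF Ds h(3)] by simp
  have hsum: "(\<Sum>x\<in>X. h y * indicator (D x) y) = h y" for y
    unfolding sum_distrib_left[symmetric] ind using h(2) by (auto simp: indicator_def)
  have w0: "w x \<ge> 0" for x unfolding w_def by (intro integral_nonneg_AE AE_I2) (auto simp: h(1))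
  have wsum: "(\<Sum>x\<in>X. w x) = (LINT x|\<mu>. h x)"
    unfolding w_def by (subst Bochner_Integration.integral_sum[symmetric]) (auto simp: hsum hD)
  have "cmod ((LINT x|\<mu>. complex_of_real (h x) * sig x \<xi>) - (\<Sum>x\<in>X. complex_of_real (w x) * sig x \<xi>))
        \<le> \<delta> * (LINT x|\<mu>. h x)" if xi: "\<xi> \<in> K" for \<xi>
  proof -
    define p where "p x y = complex_of_real (h y * indicator (D x) y)" for x y
    have p: "integrable \<mu> (p x)" for x unfolding p_def[abs_def] using hD by (intro integrable_of_real)
    have sm [measurable]: "(\<lambda>y. sig y \<xi>) \<in> borel_measurable \<mu>" by (intro borel_measurable_continuous continuous_intros)
    have ps: "integrable \<mu> (\<lambda>y. p x y * sig y \<xi>)" for x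
      by (rule Bochner_Integration.integrable_bound[OF p[of x]])
        (use borel_measurable_integrable[OF p[of x]] in \<open>auto simp: norm_mult\<close>)
    have "(LINT x|\<mu>. complex_of_real (h x) * sig x \<xi>) = (LINT y|\<mu>. (\<Sum>x\<in>X. p x y * sig y \<xi>))"
      unfolding sum_distrib_right[symmetric] p_def of_real_sum[symmetric] hsum ..
    also have "\<dots> = (\<Sum>x\<in>X. LINT y|\<mu>. p x y * sig y \<xi>)"
      by (rule Bochner_Integration.integral_sum[OF ps])
    finally have "(LINT x|\<mu>. complex_of_real (h x) * sig x \<xi>) - (\<Sum>x\<in>X. complex_of_real (w x) * sig x \<xi>)
       = (\<Sum>x\<in>X. (LINT y|\<mu>. p x y * sig y \<xi>) - complex_of_real (w x) * sig x \<xi>)"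
      by (simp add: sum_subtractf)
    also have "cmod \<dots> \<le> (\<Sum>x\<in>X. \<delta> * w x)"
    proof (intro order.trans[OF norm_sum] sum_mono)
      fix x assume x: "x \<in> X"
      have "complex_of_real (w x) = (LINT y|\<mu>. p x y)"
        unfolding w_def p_def by (rule integral_complex_of_real[symmetric])
      then have "(LINT y|\<mu>. p x y * sig y \<xi>) - complex_of_real (w x) * sig x \<xi>
          = (LINT y|\<mu>. p x y * sig y \<xi>) - (LINT y|\<mu>. p x y * sig x \<xi>)" using p by simp
      also have "\<dots> = (LINT y|\<mu>. p x y * sig y \<xi> - p x y * sig x \<xi>)"
        by (rule Bochner_Integration.integral_diff[symmetric]) (use ps p in auto)
      also have "cmod \<dots> \<le> (LINT y|\<mu>. \<delta> * (h y * indicator (D x) y))"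
      proof (rule order.trans[OF integral_norm_bound integral_mono])
        show "integrable \<mu> (\<lambda>y. cmod (p x y * sig y \<xi> - p x y * sig x \<xi>))"
          using ps p by (intro integrable_norm Bochner_Integration.integrable_diff) auto
        show "integrable \<mu> (\<lambda>y. \<delta> * (h y * indicator (D x) y))" using hD by simp
        fix y
        have "cmod (p x y * sig y \<xi> - p x y * sig x \<xi>) = (h y * indicator (D x) y) * cmod (sig y \<xi> - sig x \<xi>)"
          unfolding right_diff_distrib[symmetric] norm_mult p_def norm_of_real using h(1)[of y] by (simp add: abs_mult)
        also have "\<dots> \<le> (h y * indicator (D x) y) * \<delta>"
          using V(3)[OF subsetD[OF DV[OF x]] xi] h(1)[of y] by (cases "y \<in> D x") (auto intro: mult_left_mono)
        finally show "cmod (p x y * sig y \<xi> - p x y * sig x \<xi>) \<le> \<delta> * (h y * indicator (D x) y)" by (simp add: mult.commute)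
      qed
      also have "\<dots> = \<delta> * w x" by (simp add: w_def)
      finally show "cmod ((LINT y|\<mu>. p x y * sig y \<xi>) - complex_of_real (w x) * sig x \<xi>) \<le> \<delta> * w x" .
    qed
    finally show ?thesis by (simp add: sum_distrib_left[symmetric] wsum)
  qed
  then show ?thesis using that[OF X(2,1) w0 wsum] by blast
qed

text \<open>Where the average of \<sigma> is well below 1 in modulus, the weighted mean of
  \<open>(cmod (sig x \<xi> - 1))\<^sup>2\<close> is bounded below, so
  \<open>(cmod (g \<xi>))\<^sup>2\<close> is dominated there by an average of the squared
  differences for the shifts, whose integrals are small by equicontinuity.\<close>

lemma hs_equicontinuous_imp_decay:
  assumes F: "F \<subseteq> hilbert_schmidt" and eq: "hs_equicontinuous U F"
  shows "L2_decay \<mu> (FW ` F)"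
  unfolding L2_decay_FW_iff[OF F]
proof (intro allI impI)
  fix e :: real assume e: "e > 0"
  \<comment> \<open>The final bound is three times the square of \<open>d\<close> and has to stay
    below the square of \<open>e\<close>.\<close>
  define d where "d = e / 2"
  have d: "d > 0" using e by (simp add: d_def)
  obtain V where V: "open V" "0 \<in> V" "\<And>A x. A \<in> F \<Longrightarrow> x \<in> V \<Longrightarrow> hs_dist (op_shift U x A) A < d"
    using eq[unfolded hs_equicontinuous_def, rule_format, OF d] by auto
  \<comment> \<open>The weight and \<open>K\<close> depend on \<open>V\<close> only and so serve all
    operators; \<open>K'\<close>, \<open>X\<close> and \<open>w\<close> below depend on
    \<open>A\<close>.\<close>
  obtain h :: "'a \<Rightarrow> real" and C K where h: "compact C" "C \<subseteq> V" "\<And>x. h x \<ge> 0" "\<And>x. x \<notin> C \<Longrightarrow> h x = 0"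
    "integrable \<mu> h" "(LINT x|\<mu>. h x) = 1"
    and K: "compact K" "\<And>\<xi>. \<xi> \<notin> K \<Longrightarrow> cmod (LINT x|\<mu>. complex_of_real (h x) * sig x \<xi>) < 1 / 2"
    by (rule concentrated_weight[OF V(1,2)]) blast
  have "L2_norm \<mu> (cut K (FW A)) < e" if A: "A \<in> F" for A
  proof -
    have hA: "A \<in> hilbert_schmidt" using A F by auto
    define g where "g = FW A"
    have g: "g \<in> L2_functions \<mu>" unfolding g_def by (rule FW_L2[OF hA])
    obtain K' where K': "compact K'" "L2_norm \<mu> (cut K' g) < d" unfolding g_def by (rule single_decay[OF hA d])
    have "(1/4 :: real) > 0" by simp
    obtain X w where X: "finite X" "X \<subseteq> C" "\<And>x. w x \<ge> (0::real)" "(\<Sum>x\<in>X. w x) = 1"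
      and q: "\<And>\<xi>. \<xi> \<in> K' \<Longrightarrow> cmod ((LINT x|\<mu>. complex_of_real (h x) * sig x \<xi>) - (\<Sum>x\<in>X. complex_of_real (w x) * sig x \<xi>)) \<le> 1/4"
    proof (rule quadrature[OF h(1,3,4,5) K'(1) \<open>(1/4 :: real) > 0\<close>])
      fix X and w :: "'a \<Rightarrow> real"
      assume a: "finite X" "X \<subseteq> C" "\<And>x. 0 \<le> w x" "sum w X = integral\<^sup>L \<mu> h"
        "\<And>\<xi>. \<xi> \<in> K' \<Longrightarrow> cmod ((LINT x|\<mu>. complex_of_real (h x) * sig x \<xi>) - (\<Sum>x\<in>X. complex_of_real (w x) * sig x \<xi>))
            \<le> 1/4 * integral\<^sup>L \<mu> h"
      show thesis
        by (rule that[of X w, OF a(1,2,3)]) (use a(4,5) in \<open>simp_all add: h(6)\<close>)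
    qed
    \<comment> \<open>Off \<open>K\<close> the integral is below 1/2 and the quadrature error is at
      most 1/4, so the weighted mean has real part at most 3/4; the mean of
      \<open>2 - 2 * Re (sig x \<xi>)\<close> is then at least 1/2.\<close>
    have low: "1/2 \<le> (\<Sum>x\<in>X. w x * (cmod (sig x \<xi> - 1))\<^sup>2)" if "\<xi> \<in> K'" "\<xi> \<notin> K" for \<xi>
    proof -
      have "cmod (\<Sum>x\<in>X. complex_of_real (w x) * sig x \<xi>) \<le> 3/4"
        using q[OF that(1)] K(2)[OF that(2)]
          norm_triangle_ineq2[of "\<Sum>x\<in>X. complex_of_real (w x) * sig x \<xi>" "LINT x|\<mu>. complex_of_real (h x) * sig x \<xi>"]
        by (simp add: norm_minus_commute)
      then have "Re (\<Sum>x\<in>X. complex_of_real (w x) * sig x \<xi>) \<le> 3/4"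
        using complex_Re_le_cmod order.trans by blast
      then have re: "(\<Sum>x\<in>X. w x * Re (sig x \<xi>)) \<le> 3/4" by simp
      have sq: "(cmod (sig x \<xi> - 1))\<^sup>2 = 2 - 2 * Re (sig x \<xi>)" for x
      proof -
        have "(cmod (sig x \<xi> - 1))\<^sup>2 = (cmod (sig x \<xi>))\<^sup>2 + 1 - 2 * Re (sig x \<xi>)"
          unfolding cmod_power2 by (simp add: power2_eq_square algebra_simps)
        then show ?thesis by simp
      qed
      have "(\<Sum>x\<in>X. w x * (cmod (sig x \<xi> - 1))\<^sup>2) = 2 * (\<Sum>x\<in>X. w x) - 2 * (\<Sum>x\<in>X. w x * Re (sig x \<xi>))"
        unfolding sq sum_distrib_left sum_subtractf[symmetric] by (intro sum.cong refl) (simp add: algebra_simps)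
      then show ?thesis using re X(4) by simp
    qed
    have sL: "(\<lambda>\<xi>. sig x \<xi> * g \<xi> - g \<xi>) \<in> L2_functions \<mu>" for x
      by (intro L2_functions_diff L2_functions_mult[OF g, of _ 1] g)
        (auto intro!: borel_measurable_continuous continuous_intros)
    have sn: "(L2_norm \<mu> (\<lambda>\<xi>. sig x \<xi> * g \<xi> - g \<xi>))\<^sup>2 \<le> d\<^sup>2" if "x \<in> X" for x
      using V(3)[OF A, of x] that X(2) h(2) hs_dist_shift[OF hA, of x] by (intro power_mono) (auto simp: g_def less_imp_le)
    \<comment> \<open>A point outside \<open>K\<close> lies either outside \<open>K'\<close>, where
      the tail of this particular \<open>g\<close> takes over, or in \<open>K'\<close>, where
      \<open>low\<close> applies.\<close>
    have "(L2_norm \<mu> (cut K g))\<^sup>2 \<le> (LINT \<xi>|\<mu>. (cmod (cut K' g \<xi>))\<^sup>2 + 2 * (\<Sum>x\<in>X. w x * (cmod (sig x \<xi> * g \<xi> - g \<xi>))\<^sup>2))"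
      unfolding L2_norm_sq
    proof (rule integral_mono)
      show "integrable \<mu> (\<lambda>\<xi>. (cmod (cut K g \<xi>))\<^sup>2)" by (rule L2_functionsD(2)[OF cut_L2[OF g K(1)]])
      show "integrable \<mu> (\<lambda>\<xi>. (cmod (cut K' g \<xi>))\<^sup>2 + 2 * (\<Sum>x\<in>X. w x * (cmod (sig x \<xi> * g \<xi> - g \<xi>))\<^sup>2))"
        using L2_functionsD(2)[OF cut_L2[OF g K'(1)]] L2_functionsD(2)[OF sL] by simp
      fix \<xi>
      have eq: "(\<Sum>x\<in>X. w x * (cmod (sig x \<xi> * g \<xi> - g \<xi>))\<^sup>2) = (\<Sum>x\<in>X. w x * (cmod (sig x \<xi> - 1))\<^sup>2) * (cmod (g \<xi>))\<^sup>2"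
        unfolding sum_distrib_right
      proof (intro sum.cong refl)
        fix x
        have "sig x \<xi> * g \<xi> - g \<xi> = (sig x \<xi> - 1) * g \<xi>" by (simp add: algebra_simps)
        then show "w x * (cmod (sig x \<xi> * g \<xi> - g \<xi>))\<^sup>2 = w x * (cmod (sig x \<xi> - 1))\<^sup>2 * (cmod (g \<xi>))\<^sup>2"
          by (simp add: norm_mult power_mult_distrib)
      qed
      have nn: "0 \<le> (\<Sum>x\<in>X. w x * (cmod (sig x \<xi> * g \<xi> - g \<xi>))\<^sup>2)" by (intro sum_nonneg mult_nonneg_nonneg X(3)) auto
      show "(cmod (cut K g \<xi>))\<^sup>2 \<le> (cmod (cut K' g \<xi>))\<^sup>2 + 2 * (\<Sum>x\<in>X. w x * (cmod (sig x \<xi> * g \<xi> - g \<xi>))\<^sup>2)"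
      proof (cases "\<xi> \<in> K' \<and> \<xi> \<notin> K")
        case True
        then have "1/2 * (cmod (g \<xi>))\<^sup>2 \<le> (\<Sum>x\<in>X. w x * (cmod (sig x \<xi> * g \<xi> - g \<xi>))\<^sup>2)"
          unfolding eq using low by (intro mult_right_mono) auto
        then show ?thesis using True by (simp add: cut_def)
      qed (use nn in \<open>auto simp: cut_def\<close>)
    qed
    also have "\<dots> = (L2_norm \<mu> (cut K' g))\<^sup>2 + 2 * (\<Sum>x\<in>X. w x * (L2_norm \<mu> (\<lambda>\<xi>. sig x \<xi> * g \<xi> - g \<xi>))\<^sup>2)"
      using L2_functionsD(2)[OF cut_L2[OF g K'(1)]] L2_functionsD(2)[OF sL] by (simp add: L2_norm_sq)
    also have "\<dots> \<le> d\<^sup>2 + 2 * (\<Sum>x\<in>X. w x * d\<^sup>2)"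
      using K'(2) by (intro add_mono mult_left_mono sum_mono sn power_mono X(3)) auto
    also have "\<dots> = 3 * d\<^sup>2" unfolding sum_distrib_right[symmetric] X(4) by simp
    also have "\<dots> < e\<^sup>2" using e by (simp add: d_def power2_eq_square)
    finally show ?thesis unfolding g_def using e by (simp add: power_less_imp_less_base)
  qed
  then show "\<exists>K. compact K \<and> (\<forall>A\<in>F. L2_norm \<mu> (cut K (FW A)) < e)" using K(1) by blast
qed


text \<open>\<open>Q\<close> is the average of \<open>U\<close> over the weight. Then
  \<open>A - A Q\<close> is an average of \<open>A - A U\<close>, hence small, and cutting it to
  \<open>J\<close> does not enlarge it; \<open>A Q\<close> is truncated through the tail of
  \<open>Q\<close>, at the cost of the bound on \<open>A\<close>. Since \<open>J\<close> is chosen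
  for \<open>Q\<close>, it is common to the whole family.\<close>

lemma right_equicontinuous_imp_tight:
  assumes F: "F \<subseteq> hilbert_schmidt" and B: "\<And>A. A \<in> F \<Longrightarrow> hs_norm A \<le> B"
    and eq: "right_equicontinuous F" and e: "e > 0"
  obtains J where "finite J" "J \<subseteq> some_onb" "\<And>A. A \<in> F \<Longrightarrow> hs_norm (\<lambda>v. A v - A (coord_proj J v)) < e"
proof -
  define d where "d = e / 2"
  have d: "d > 0" using e by (simp add: d_def)
  obtain V where V: "open V" "0 \<in> V" "\<And>A x. A \<in> F \<Longrightarrow> x \<in> V \<Longrightarrow> hs_dist (\<lambda>v. A (U x v)) A < d"
    using eq[unfolded right_equicontinuous_def, rule_format, OF d] by auto
  obtain h :: "'a \<Rightarrow> real" and C where h: "C \<subseteq> V" "\<And>x. h x \<ge> 0" "\<And>x. x \<notin> C \<Longrightarrow> h x = 0"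
    "integrable \<mu> h" "(LINT x|\<mu>. h x) = 1" "(\<lambda>x. complex_of_real (h x)) \<in> L2_functions \<mu>"
    by (rule concentrated_weight[OF V(1,2)]) blast
  obtain Q where Q: "Q \<in> hilbert_schmidt"
    "\<And>u w. cinner (Q u) w = (LINT x|\<mu>. complex_of_real (h x) * cnj (coef w u x))"
    using weak_operator[OF h(6)] by blast
  define b where "b = \<bar>B\<bar> + 1"
  have b: "b > 0" by (simp add: b_def add_nonneg_pos)
  obtain J where J: "finite J" "J \<subseteq> some_onb" "hs_norm (\<lambda>v. Q v - Q (coord_proj J v)) < d / b"
    by (rule hs_tail_small[OF Q(1), of "d / b"]) (use d b in auto)
  have "hs_norm (\<lambda>v. A v - A (coord_proj J v)) < e" if A: "A \<in> F" for A
  proof -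
    have hA: "A \<in> hilbert_schmidt" using A F by auto
    have bA: "bounded_clinear A" by (rule hs_bounded_clinear[OF hA])
    have opA: "norm (A v) \<le> hs_norm A * norm v" for v by (rule norm_le_hs_norm[OF hA])
    define D where "D v = A v - A (Q v)" for v
    have AQ: "(\<lambda>v. A (Q v)) \<in> hilbert_schmidt" by (rule hs_comp_left(1)[OF Q(1) bA hs_norm_nonneg opA])
    have D: "D \<in> hilbert_schmidt" unfolding D_def[abs_def] by (rule hs_diff(1)[OF hA AQ])
    have cH: "integrable \<mu> (\<lambda>x. complex_of_real (h x))" using h(4) by (rule integrable_of_real)
    have weak: "integrable \<mu> (\<lambda>x. complex_of_real (h x) * cinner (A u - A (U x u)) w)"
       "cinner (D u) w = (LINT x|\<mu>. complex_of_real (h x) * cinner (A u - A (U x u)) w)" for u w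
    proof -
      have c: "cinner (A (U x u)) w = cnj (coef (cadjoint A w) u x)" for x
        unfolding coef_def cinner_cadjoint[OF bA] by (rule cinner_commute)
      have i1: "integrable \<mu> (\<lambda>x. complex_of_real (h x) * cinner (A u) w)" using cH by simp
      have i2: "integrable \<mu> (\<lambda>x. complex_of_real (h x) * cinner (A (U x u)) w)"
        unfolding c by (rule L2_mult_integrable(3)[OF h(6) coef_L2])
      show "integrable \<mu> (\<lambda>x. complex_of_real (h x) * cinner (A u - A (U x u)) w)"
        using Bochner_Integration.integrable_diff[OF i1 i2] by (simp add: cinner_diff_left right_diff_distrib)
      have "(LINT x|\<mu>. complex_of_real (h x)) = 1" using h(5) by simp
      then have "cinner (A u) w = (LINT x|\<mu>. complex_of_real (h x) * cinner (A u) w)" by simp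
      moreover have "cinner (A (Q u)) w = (LINT x|\<mu>. complex_of_real (h x) * cinner (A (U x u)) w)"
        unfolding cinner_cadjoint[OF bA, of "Q u"] Q(2) c ..
      ultimately show "cinner (D u) w = (LINT x|\<mu>. complex_of_real (h x) * cinner (A u - A (U x u)) w)"
        using Bochner_Integration.integral_diff[OF i1 i2] by (simp add: D_def cinner_diff_left right_diff_distrib)
    qed
    \<comment> \<open>Minkowski's integral inequality by duality: a finite block of \<open>D\<close>
      is paired with itself, so that only scalar integrals occur.\<close>
    have "(\<Sum>i\<in>L. (norm (D i))\<^sup>2) \<le> d\<^sup>2" if L: "finite L" "L \<subseteq> some_onb" for L
    proof -
      define s where "s = (\<Sum>i\<in>L. (norm (D i))\<^sup>2)"
      have s0: "s \<ge> 0" by (simp add: s_def sum_nonneg)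
      define p where "p x = (\<Sum>i\<in>L. cinner (A i - A (U x i)) (D i))" for x
      have hp: "complex_of_real (h x) * p x = (\<Sum>i\<in>L. complex_of_real (h x) * cinner (A i - A (U x i)) (D i))" for x
        by (simp add: p_def sum_distrib_left)
      have ip: "integrable \<mu> (\<lambda>x. complex_of_real (h x) * p x)"
        unfolding hp by (intro Bochner_Integration.integrable_sum weak(1))
      have "complex_of_real s = (\<Sum>i\<in>L. cinner (D i) (D i))" by (simp add: s_def cinner_self)
      also have "\<dots> = (LINT x|\<mu>. complex_of_real (h x) * p x)"
        unfolding hp weak(2) by (rule Bochner_Integration.integral_sum[symmetric]) (rule weak(1))
      finally have seq: "complex_of_real s = (LINT x|\<mu>. complex_of_real (h x) * p x)" .
      have pb: "cmod (p x) \<le> d * sqrt s" if "x \<in> C" for x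
      proof -
        have AU: "(\<lambda>v. A v - A (U x v)) \<in> hilbert_schmidt" by (rule hs_diff(1)[OF hA hs_unitary_right(1)[OF hA unitary]])
        have "cmod (p x) \<le> (\<Sum>i\<in>L. \<bar>norm (A i - A (U x i))\<bar> * \<bar>norm (D i)\<bar>)"
          unfolding p_def by (rule order.trans[OF norm_sum sum_mono]) (simp add: norm_cinner_le)
        also have "\<dots> \<le> L2_set (\<lambda>i. norm (A i - A (U x i))) L * L2_set (\<lambda>i. norm (D i)) L" by (rule L2_set_mult_ineq)
        also have "L2_set (\<lambda>i. norm (D i)) L = sqrt s" by (simp add: L2_set_def s_def)
        also have "L2_set (\<lambda>i. norm (A i - A (U x i))) L \<le> hs_norm (\<lambda>v. A v - A (U x v))"
          unfolding L2_set_def by (rule real_le_lsqrt[OF _ hs_sum_le[OF AU L]]) (auto simp: sum_nonneg)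
        also have "\<dots> \<le> d" using V(3)[OF A, of x] that h(1) hs.commute[of A] by (auto simp: hs_dist_def)
        finally show ?thesis using s0 by (simp add: mult_right_mono)
      qed
      have "s = cmod (LINT x|\<mu>. complex_of_real (h x) * p x)" unfolding seq[symmetric] using s0 by simp
      also have "\<dots> \<le> (LINT x|\<mu>. h x * (d * sqrt s))"
      proof (rule order.trans[OF integral_norm_bound integral_mono])
        show "integrable \<mu> (\<lambda>x. cmod (complex_of_real (h x) * p x))" using ip by (rule integrable_norm)
        show "integrable \<mu> (\<lambda>x. h x * (d * sqrt s))" using h(4) by simp
        show "cmod (complex_of_real (h x) * p x) \<le> h x * (d * sqrt s)" for x
          using pb[of x] h(2)[of x] h(3)[of x] by (cases "x \<in> C") (auto simp: norm_mult intro: mult_left_mono)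
      qed
      also have "\<dots> = d * sqrt s" using h(5) by simp
      finally have "s \<le> d * sqrt s" .
      then have "s \<le> d\<^sup>2" using s0 d by (intro le_mult_sqrt_imp_le_square) auto
      then show ?thesis by (simp add: s_def)
    qed
    then have nD: "hs_norm D \<le> d" using hsI(2)[OF hs_bounded_clinear[OF D], of d] d by auto
    define R where "R v = Q v - Q (coord_proj J v)" for v
    have R: "R \<in> hilbert_schmidt" "hs_norm R < d / b"
      unfolding R_def[abs_def] by (rule hs_coord_proj_tail(1)[OF Q(1) J(1,2)], rule J(3))
    have dec: "(\<lambda>v. A v - A (coord_proj J v)) = (\<lambda>v. (D v - D (coord_proj J v)) + A (R v))"
      by (simp add: D_def R_def bounded_clinear_simps[OF bA])
    have "hs_norm (\<lambda>v. A v - A (coord_proj J v)) \<le> hs_norm (\<lambda>v. D v - D (coord_proj J v)) + hs_norm (\<lambda>v. A (R v))"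
      unfolding dec by (rule hs_add(2)[OF hs_coord_proj_tail(1)[OF D J(1,2)] hs_comp_left(1)[OF R(1) bA hs_norm_nonneg opA]])
    also have "hs_norm (\<lambda>v. D v - D (coord_proj J v)) \<le> hs_norm D"
      by (rule power2_le_imp_le) (simp_all add: hs_coord_proj_tail(2)[OF D J(1,2)] sum_nonneg)
    also have "hs_norm (\<lambda>v. A (R v)) \<le> hs_norm A * hs_norm R"
      by (rule hs_comp_left(2)[OF R(1) bA hs_norm_nonneg opA])
    also have "\<dots> \<le> b * hs_norm R" using B[OF A] by (intro mult_right_mono) (auto simp: b_def)
    also have "\<dots> < d" using R(2) b by (simp add: field_simps)
    finally show ?thesis using nD by (simp add: d_def)
  qed
  then show ?thesis using that J by blast
qed

text \<open>Under adjoints the claim is that \<open>U A\<close> is close to \<open>A\<close>. One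
  passes through \<open>A U\<close>, which is close to \<open>A\<close> by assumption, and
  \<open>A U - U A\<close> is \<open>A - op_shift U x A\<close> followed on the right by a
  unitary.\<close>

lemma left_equicontinuous:
  assumes F: "F \<subseteq> hilbert_schmidt" and sh: "hs_equicontinuous U F" and R: "right_equicontinuous F"
  shows "right_equicontinuous (cadjoint ` F)"
  unfolding right_equicontinuous_def
proof (intro allI impI)
  fix e :: real assume "e > 0"
  then have e: "e / 2 > 0" by simp
  obtain V where V: "open V" "0 \<in> V" "\<And>A x. A \<in> F \<Longrightarrow> x \<in> V \<Longrightarrow> hs_dist (op_shift U x A) A < e / 2"
    using sh[unfolded hs_equicontinuous_def, rule_format, OF e] by auto
  obtain W where W: "open W" "0 \<in> W" "\<And>A x. A \<in> F \<Longrightarrow> x \<in> W \<Longrightarrow> hs_dist (\<lambda>v. A (U x v)) A < e / 2"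
    using R[unfolded right_equicontinuous_def, rule_format, OF e] by auto
  have "hs_dist (\<lambda>v. cadjoint A (U x v)) (cadjoint A) < e" if A: "A \<in> F" and x: "x \<in> V \<inter> W" for A x
  proof -
    have hA: "A \<in> hilbert_schmidt" using A F by auto
    have bA: "bounded_clinear A" by (rule hs_bounded_clinear[OF hA])
    note UA = hs_unitary_left(1)[OF hA unitary[of x]] and AU = hs_unitary_right(1)[OF hA unitary[of x]]
    have sA: "op_shift U x A \<in> hilbert_schmidt"
      using representsD(1)[OF represents_shift[OF fourier_weyl_represents[OF hA]]] .
    note Ua = unitary_op_cadjoint[OF unitary[of x]]
    have adj: "cadjoint (\<lambda>v. cadjoint (U x) (A v) - A v) = (\<lambda>v. cadjoint A (U x v) - cadjoint A v)"
      using cadjoint_diff[OF bounded_clinear_comp[OF unitary_op_bounded_clinear[OF Ua] bA] bA]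
        cadjoint_comp[OF unitary_op_bounded_clinear[OF Ua] bA] cadjoint_cadjoint[OF bclinear_U[of x]] by simp
    note X = hs_diff(1)[OF hs_unitary_left(1)[OF hA Ua] hA]
    have "hs_dist (\<lambda>v. cadjoint A (U x v)) (cadjoint A) = hs_norm (\<lambda>v. cadjoint (U x) (A v) - A v)"
      unfolding hs_dist_def adj[symmetric] by (rule hs_cadjoint(2)[OF X])
    also have "\<dots> = hs_norm (\<lambda>v. U x (cadjoint (U x) (A v) - A v))"
      by (rule hs_unitary_left(2)[OF X unitary, symmetric])
    also have "\<dots> = hs_dist A (\<lambda>v. U x (A v))" by (simp add: U_simps hs_dist_def)
    also have "\<dots> \<le> hs_dist A (\<lambda>v. A (U x v)) + hs_dist (\<lambda>v. A (U x v)) (\<lambda>v. U x (A v))"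
      by (rule hs.triangle[OF hA AU UA])
    also have "hs_dist (\<lambda>v. A (U x v)) (\<lambda>v. U x (A v)) = hs_dist A (op_shift U x A)"
      using hs_unitary_right(2)[OF hs_diff(1)[OF hA sA] unitary[of x]] by (simp add: hs_dist_def op_shift_def)
    finally show ?thesis using V(3)[OF A, of x] W(3)[OF A, of x] x
      by (simp add: hs.commute[of A])
  qed
  then show "\<exists>V. open V \<and> 0 \<in> V \<and> (\<forall>A\<in>cadjoint ` F. \<forall>x\<in>V. hs_dist (\<lambda>v. A (U x v)) A < e)"
    using V W by (intro exI[of _ "V \<inter> W"]) auto
qed

end

section \<open>Total boundedness\<close>

text \<open>On a finite part of the basis, \<open>c f e\<close> is the entry in column
  \<open>f\<close> and row \<open>e\<close>.\<close>

definition matrix_op :: "'h::complex_hilbert_space set \<Rightarrow> 'h set \<Rightarrow> ('h \<Rightarrow> 'h \<Rightarrow> complex) \<Rightarrow> 'h \<Rightarrow> 'h" where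
  "matrix_op J K c v = (\<Sum>f\<in>J. cinner v f *\<^sub>C (\<Sum>e\<in>K. c f e *\<^sub>C e))"

lemma matrix_op_hs:
  assumes J: "finite J" "J \<subseteq> some_onb" and K: "finite K" "K \<subseteq> some_onb"
    and b: "b \<ge> 0" "(\<Sum>f\<in>J. \<Sum>e\<in>K. (cmod (c f e))\<^sup>2) \<le> b\<^sup>2"
  shows "matrix_op J K c \<in> hilbert_schmidt" "hs_norm (matrix_op J K c) \<le> b"
proof -
  have bc: "bounded_clinear (matrix_op J K c)"
    unfolding matrix_op_def[abs_def] by (intro bounded_clinear_sum bounded_clinear_rank_one)
  have val: "matrix_op J K c i = (if i \<in> J then (\<Sum>e\<in>K. c i e *\<^sub>C e) else 0)" if i: "i \<in> some_onb" for i
  proof -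
    have "matrix_op J K c i = (\<Sum>f\<in>J. if f = i then (\<Sum>e\<in>K. c i e *\<^sub>C e) else 0)"
      unfolding matrix_op_def
    proof (intro sum.cong refl)
      fix f assume "f \<in> J"
      then have "cinner i f = (if i = f then 1 else 0)"
        using i J(2) orthonormal_some_onb unfolding orthonormal_def by blast
      then show "cinner i f *\<^sub>C (\<Sum>e\<in>K. c f e *\<^sub>C e) = (if f = i then (\<Sum>e\<in>K. c i e *\<^sub>C e) else 0)" by auto
    qed
    then show ?thesis using J(1) by simp
  qed
  have "(\<Sum>i\<in>L. (norm (matrix_op J K c i))\<^sup>2) \<le> b\<^sup>2" if L: "finite L" "L \<subseteq> some_onb" for L
  proof -
    have "(\<Sum>i\<in>L. (norm (matrix_op J K c i))\<^sup>2) = (\<Sum>i\<in>L \<inter> J. (norm (matrix_op J K c i))\<^sup>2)"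
      using L by (intro sum.mono_neutral_right) (auto simp: val subset_iff)
    also have "\<dots> \<le> (\<Sum>i\<in>J. (norm (matrix_op J K c i))\<^sup>2)" using J(1) by (intro sum_mono2) auto
    also have "\<dots> = (\<Sum>f\<in>J. \<Sum>e\<in>K. (cmod (c f e))\<^sup>2)"
      using J(2) by (intro sum.cong refl) (auto simp: val subset_iff norm_orthonormal_sum[OF orthonormal_some_onb K])
    finally show ?thesis using b(2) by simp
  qed
  from hsI[OF bc b(1) this] show "matrix_op J K c \<in> hilbert_schmidt" "hs_norm (matrix_op J K c) \<le> b" by auto
qed

text \<open>Truncating columns to \<open>J\<close> and rows to \<open>K\<close> leaves a finite
  matrix whose entries are bounded by the bound on the norms; rounding the entries to a finite grid
  in a disc gives the net.\<close>

lemma tight_imp_net: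
  fixes F :: "('h::complex_hilbert_space \<Rightarrow> 'h) set"
  assumes F: "F \<subseteq> hilbert_schmidt" and B: "\<And>A. A \<in> F \<Longrightarrow> hs_norm A \<le> B"
    and right: "\<And>e. e > 0 \<Longrightarrow> \<exists>J. finite J \<and> J \<subseteq> some_onb \<and> (\<forall>A\<in>F. hs_norm (\<lambda>v. A v - A (coord_proj J v)) < e)"
    and left: "\<And>e. e > 0 \<Longrightarrow> \<exists>J. finite J \<and> J \<subseteq> some_onb \<and> (\<forall>A\<in>F. hs_norm (\<lambda>v. cadjoint A v - cadjoint A (coord_proj J v)) < e)"
    and e: "e > 0"
  shows "\<exists>N. finite N \<and> N \<subseteq> hilbert_schmidt \<and> (\<forall>A\<in>F. \<exists>X\<in>N. hs_dist A X < e)"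
proof -
  have e3: "e / 3 > 0" using e by simp
  obtain J where J: "finite J" "J \<subseteq> some_onb" "\<And>A. A \<in> F \<Longrightarrow> hs_norm (\<lambda>v. A v - A (coord_proj J v)) < e / 3"
    using right[OF e3] by blast
  obtain K where K: "finite K" "K \<subseteq> some_onb" "\<And>A. A \<in> F \<Longrightarrow> hs_norm (\<lambda>v. cadjoint A v - cadjoint A (coord_proj K v)) < e / 3"
    using left[OF e3] by blast
  \<comment> \<open>Since \<open>n\<close> is at least 1 and at least the number of entries,
    \<open>\<delta> * n\<close> dominates the norm of a matrix with entries of size at most
    \<delta>.\<close>
  define n where "n = real (card J) * real (card K) + 1"
  have n: "n > 0" by (simp add: n_def add_nonneg_pos)
  define \<delta> where "\<delta> = e / (3 * n)"
  have \<delta>: "\<delta> > 0" using e n by (simp add: \<delta>_def)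
  have "compact (cball (0::complex) \<bar>B\<bar>)" by simp
  then obtain Z where Z: "finite Z" "cball (0::complex) \<bar>B\<bar> \<subseteq> (\<Union>z\<in>Z. ball z \<delta>)"
    unfolding compact_eq_totally_bounded using \<delta> by blast
  \<comment> \<open>Extensional choice functions on \<open>J \<times> K\<close> keep the set of grid
    matrices finite.\<close>
  define N where "N = (\<lambda>p. matrix_op J K (\<lambda>f x. p (f, x))) ` (PiE (J \<times> K) (\<lambda>_. Z))"
  have "finite N" unfolding N_def using J(1) K(1) Z(1) by (intro finite_imageI finite_PiE) auto
  moreover have mhs: "matrix_op J K c \<in> hilbert_schmidt" for c :: "'h \<Rightarrow> 'h \<Rightarrow> complex"
    by (rule matrix_op_hs(1)[OF J(1,2) K(1,2), of "sqrt (\<Sum>f\<in>J. \<Sum>e\<in>K. (cmod (c f e))\<^sup>2)"]) (auto simp: sum_nonneg)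
  moreover have "\<exists>X\<in>N. hs_dist A X < e" if A: "A \<in> F" for A
  proof -
    have hA: "A \<in> hilbert_schmidt" using A F by auto
    have bA: "bounded_clinear A" by (rule hs_bounded_clinear[OF hA])
    have close: "\<exists>z\<in>Z. dist z (cinner (A f) x) < \<delta>" if "f \<in> J" "x \<in> K" for f x
    proof -
      have "cmod (cinner (A f) x) \<le> norm (A f) * norm x" by (rule norm_cinner_le)
      also have "\<dots> \<le> hs_norm A * norm f * norm x" by (intro mult_right_mono norm_le_hs_norm hA) auto
      also have "norm f = 1" using that J(2) by (intro norm_some_onb) auto
      also have "norm x = 1" using that K(2) by (intro norm_some_onb) auto
      also have "hs_norm A * 1 * 1 = hs_norm A" by simp
      also have "\<dots> \<le> \<bar>B\<bar>" using B[OF A] by simp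
      finally have "cinner (A f) x \<in> cball 0 \<bar>B\<bar>" by simp
      from subsetD[OF Z(2) this] show ?thesis by simp
    qed
    have "\<forall>q\<in>J \<times> K. \<exists>z. z \<in> Z \<and> dist z (cinner (A (fst q)) (snd q)) < \<delta>"
    proof
      fix q assume "q \<in> J \<times> K"
      then show "\<exists>z. z \<in> Z \<and> dist z (cinner (A (fst q)) (snd q)) < \<delta>"
        using close[of "fst q" "snd q"] unfolding mem_Times_iff by blast
    qed
    from bchoice[OF this] obtain p0 where p0: "\<forall>q\<in>J \<times> K. p0 q \<in> Z \<and> dist (p0 q) (cinner (A (fst q)) (snd q)) < \<delta>" by blast
    define p where "p = restrict p0 (J \<times> K)"
    have p: "p \<in> PiE (J \<times> K) (\<lambda>_. Z)" using p0 by (auto simp: p_def)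
    have pd: "cmod (cinner (A f) x - p (f, x)) \<le> \<delta>" if "f \<in> J" "x \<in> K" for f x
      using bspec[OF p0, of "(f, x)"] that by (auto simp: p_def dist_norm norm_minus_commute)
    define X where "X = matrix_op J K (\<lambda>f x. p (f, x))"
    have XN: "X \<in> N" unfolding N_def X_def using p by blast
    have hX: "X \<in> hilbert_schmidt" unfolding X_def by (rule mhs)
    define M where "M = matrix_op J K (\<lambda>f x. cinner (A f) x)"
    have hM: "M \<in> hilbert_schmidt" unfolding M_def by (rule mhs)
    have M: "M v = coord_proj K (A (coord_proj J v))" for v
    proof -
      have bP: "bounded_clinear (coord_proj K)" by (rule bounded_clinear_coord_proj)
      show ?thesis
        unfolding coord_proj_def[of J] bounded_clinear_simps[OF bA] bounded_clinear_simps[OF bP]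
        by (simp add: M_def matrix_op_def coord_proj_def)
    qed
    have "hs_dist M X \<le> \<delta> * n"
    proof -
      have "(\<lambda>v. M v - X v) = matrix_op J K (\<lambda>f x. cinner (A f) x - p (f, x))"
        by (rule ext) (simp add: M_def X_def matrix_op_def sum_subtractf scaleC_diff_right
          bounded_bilinear.diff_left[OF bounded_bilinear_scaleC])
      moreover have "(\<Sum>f\<in>J. \<Sum>x\<in>K. (cmod (cinner (A f) x - p (f, x)))\<^sup>2) \<le> (\<delta> * n)\<^sup>2"
      proof -
        have "(\<Sum>f\<in>J. \<Sum>x\<in>K. (cmod (cinner (A f) x - p (f, x)))\<^sup>2) \<le> (\<Sum>f\<in>J. \<Sum>x\<in>K. \<delta>\<^sup>2)"
          by (intro sum_mono power_mono pd) auto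
        also have "\<dots> = (real (card J) * real (card K)) * \<delta>\<^sup>2" by simp
        also have "\<dots> \<le> n\<^sup>2 * \<delta>\<^sup>2"
        proof (intro mult_right_mono)
          have "real (card J) * real (card K) \<le> n * 1" by (simp add: n_def)
          also have "\<dots> \<le> n * n" using n by (intro mult_left_mono) (auto simp: n_def)
          finally show "real (card J) * real (card K) \<le> n\<^sup>2" by (simp add: power2_eq_square)
        qed simp
        finally show ?thesis by (simp add: power_mult_distrib mult.commute)
      qed
      ultimately show ?thesis
        unfolding hs_dist_def using matrix_op_hs(2)[OF J(1,2) K(1,2), of "\<delta> * n"] \<delta> n by auto
    qed
    then have 1: "hs_dist M X \<le> e / 3" using n by (simp add: \<delta>_def)
    define L where "L v = A v - coord_proj K (A v)" for v
    have L: "L \<in> hilbert_schmidt" "hs_norm L < e / 3"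
    proof -
      \<comment> \<open>Cutting columns of the adjoint is cutting rows of \<open>A\<close>, because
        the projection is self-adjoint.\<close>
      have "cadjoint (\<lambda>v. cadjoint A v - cadjoint A (coord_proj K v)) = L"
        using cadjoint_diff[OF bounded_clinear_cadjoint[OF bA] bounded_clinear_comp[OF bounded_clinear_cadjoint[OF bA] bounded_clinear_coord_proj]]
          cadjoint_comp[OF bounded_clinear_cadjoint[OF bA] bounded_clinear_coord_proj]
        by (simp add: L_def[abs_def] cadjoint_cadjoint[OF bA] cadjoint_coord_proj)
      then show "L \<in> hilbert_schmidt" "hs_norm L < e / 3"
        using hs_cadjoint[OF hs_coord_proj_tail(1)[OF hs_cadjoint(1)[OF hA] K(1,2)]] K(3)[OF A] by auto
    qed
    have "hs_dist A M \<le> hs_norm (\<lambda>v. A v - A (coord_proj J v)) + hs_norm (\<lambda>v. L (coord_proj J v))"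
    proof -
      have "(\<lambda>v. A v - M v) = (\<lambda>v. (A v - A (coord_proj J v)) + L (coord_proj J v))"
        by (simp add: M L_def)
      then show ?thesis unfolding hs_dist_def
        using hs_add(2)[OF hs_coord_proj_tail(1)[OF hA J(1,2)] hs_comp_coord_proj[OF L(1) J(1,2)]] by simp
    qed
    moreover have "hs_norm (\<lambda>v. L (coord_proj J v)) \<le> 1 * hs_norm L"
      by (rule hs_comp_right(2)[OF L(1) bounded_clinear_coord_proj]) (auto simp: norm_coord_proj_le[OF J(1,2)])
    ultimately have "hs_dist A M < e / 3 + e / 3" using J(3)[OF A] L(2) by linarith
    moreover have "hs_dist A X \<le> hs_dist A M + hs_dist M X" by (rule hs.triangle[OF hA hM hX])
    ultimately have "hs_dist A X < e" using 1 by linarith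
    then show ?thesis using XN by blast
  qed
  ultimately show ?thesis unfolding N_def by blast
qed

text \<open>Completeness turns compact closure into total boundedness. There the centres must lie in
  \<open>F\<close>; allowing them anywhere costs a factor 2 in the radius.\<close>

lemma hs_precompact_iff_net:
  fixes F :: "('h::complex_hilbert_space \<Rightarrow> 'h) set"
  assumes F: "F \<subseteq> hilbert_schmidt"
  shows "hs_precompact F \<longleftrightarrow>
    (\<forall>e>0. \<exists>N. finite N \<and> N \<subseteq> hilbert_schmidt \<and> (\<forall>A\<in>F. \<exists>X\<in>N. hs_dist A X < e))"
proof -
  have "hs_precompact F \<longleftrightarrow> hs.mtotally_bounded F"
    unfolding hs_precompact_def using hs.mtotally_bounded_eq_compact_closure_of[OF hs_mcomplete, of F] F by simp
  also have "\<dots> \<longleftrightarrow> (\<forall>e>0. \<exists>N. finite N \<and> N \<subseteq> hilbert_schmidt \<and> (\<forall>A\<in>F. \<exists>X\<in>N. hs_dist A X < e))"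
  proof
    assume tb: "hs.mtotally_bounded F"
    show "\<forall>e>0. \<exists>N. finite N \<and> N \<subseteq> hilbert_schmidt \<and> (\<forall>A\<in>F. \<exists>X\<in>N. hs_dist A X < e)"
    proof (intro allI impI)
      fix e :: real assume "e > 0"
      from tb[unfolded hs.mtotally_bounded_def, rule_format, OF this]
      obtain N where N: "finite N" "N \<subseteq> F" "F \<subseteq> (\<Union>x\<in>N. hs.mball x e)"
        by (elim exE conjE) (rule that)
      have "\<exists>X\<in>N. hs_dist A X < e" if A: "A \<in> F" for A
      proof -
        obtain X where "X \<in> N" "A \<in> hs.mball X e" using N(3) A by auto
        then show ?thesis by (auto simp: hs.commute)
      qed
      then show "\<exists>N. finite N \<and> N \<subseteq> hilbert_schmidt \<and> (\<forall>A\<in>F. \<exists>X\<in>N. hs_dist A X < e)"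
        using N F by blast
    qed
  next
    assume net: "\<forall>e>0. \<exists>N. finite N \<and> N \<subseteq> hilbert_schmidt \<and> (\<forall>A\<in>F. \<exists>X\<in>N. hs_dist A X < e)"
    show "hs.mtotally_bounded F"
      unfolding hs.mtotally_bounded_def
    proof (intro allI impI)
      fix e :: real assume "e > 0"
      then have "e / 2 > 0" by simp
      from net[rule_format, OF this]
      obtain N where N: "finite N" "N \<subseteq> hilbert_schmidt" "\<forall>A\<in>F. \<exists>X\<in>N. hs_dist A X < e / 2"
        by (elim exE conjE) (rule that)
      \<comment> \<open>Only net points close to \<open>F\<close> are kept, each replaced by a
        nearby member of \<open>F\<close>.\<close>
      define N' where "N' = {X \<in> N. \<exists>A\<in>F. hs_dist A X < e / 2}"
      have "\<forall>X\<in>N'. \<exists>A. A \<in> F \<and> hs_dist A X < e / 2" by (auto simp: N'_def)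
      from bchoice[OF this] obtain a where "\<forall>X\<in>N'. a X \<in> F \<and> hs_dist (a X) X < e / 2" by (elim exE)
      then have a: "\<And>X. X \<in> N' \<Longrightarrow> a X \<in> F \<and> hs_dist (a X) X < e / 2" by (rule bspec)
      have "A \<in> (\<Union>x\<in>a ` N'. hs.mball x e)" if A: "A \<in> F" for A
      proof -
        obtain X where X: "X \<in> N" "hs_dist A X < e / 2" using bspec[OF N(3) A] by (elim bexE) (rule that)
        then have X': "X \<in> N'" using A by (auto simp: N'_def)
        have h: "A \<in> hilbert_schmidt" "X \<in> hilbert_schmidt" "a X \<in> hilbert_schmidt" using A F X N(2) a[OF X'] by auto
        have "hs_dist (a X) A \<le> hs_dist (a X) X + hs_dist X A" by (rule hs.triangle[OF h(3,2,1)])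
        then have "hs_dist (a X) A < e" using a[OF X'] X(2) hs.commute[of A X] by simp
        then show ?thesis using X' h by auto
      qed
      moreover have "finite (a ` N')" "a ` N' \<subseteq> F" using N(1) a by (auto simp: N'_def)
      ultimately show "\<exists>K. finite K \<and> K \<subseteq> F \<and> F \<subseteq> (\<Union>x\<in>K. hs.mball x e)" by blast
    qed
  qed
  finally show ?thesis .
qed

lemma hs_bounded_norm:
  assumes "hs_bounded F"
  obtains B where "\<And>A. A \<in> F \<Longrightarrow> hs_norm A \<le> B"
proof -
  from assms obtain C r where F: "F \<subseteq> hs.mcball C r" unfolding hs.mbounded_def by blast
  have "hs_norm A \<le> r + hs_norm C" if "A \<in> F" for A
  proof -
    have h: "A \<in> hilbert_schmidt" "C \<in> hilbert_schmidt" "hs_dist C A \<le> r" using that F by auto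
    have "hs_norm A \<le> hs_dist A C + hs_norm C"
      using hs_add(2)[OF hs_diff(1)[OF h(1,2)] h(2)] by (simp add: hs_dist_def)
    then show ?thesis using h(3) hs.commute[of A C] by simp
  qed
  then show ?thesis using that by blast
qed

theorem theorem4p10:
  fixes m :: "'a::{topological_ab_group_add,t2_space} \<Rightarrow> 'a \<Rightarrow> complex"
    and U :: "'a \<Rightarrow> 'h::complex_hilbert_space \<Rightarrow> 'h"
    and \<mu> :: "'a measure"
    and F :: "('h \<Rightarrow> 'h) set"
  assumes "locally_compact_space (euclidean :: 'a topology)"
    and "heisenberg_multiplier m"
    and "projective_rep m U"
    and "irreducible_rep U"
    and "strongly_continuous_rep U"
    and "haar_measure \<mu>"
    and "square_integrable_rep \<mu> U"
    and "orthogonality_relations \<mu> U"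
    and "integrable_rep \<mu> U"
    and "F \<subseteq> hilbert_schmidt"
    and "hs_bounded F"
  shows "(hs_precompact F \<longleftrightarrow>
            hs_equicontinuous U F \<and> L2_equicontinuous \<mu> (fourier_weyl \<mu> U ` F)) \<and>
         (hs_precompact F \<longleftrightarrow>
            L2_decay \<mu> (fourier_weyl \<mu> U ` F) \<and> L2_equicontinuous \<mu> (fourier_weyl \<mu> U ` F))"
proof -
  have nt: "\<exists>v::'h. v \<noteq> 0" using assms(4) unfolding irreducible_rep_def by auto
  interpret weyl_rep \<mu> m U
    using assms(1-9) nt by unfold_locales (auto simp: heisenberg_multiplier_def)
  note F = assms(10)
  obtain B where B: "\<And>A. A \<in> F \<Longrightarrow> hs_norm A \<le> B" by (rule hs_bounded_norm[OF assms(11)]) blast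
  have i_iii: "L2_decay \<mu> (FW ` F) \<and> L2_equicontinuous \<mu> (FW ` F)" if "hs_precompact F"
  proof -
    note net = that[unfolded hs_precompact_iff_net[OF F], rule_format]
    have dec: "L2_decay \<mu> (FW ` F)" by (rule net_imp_decay[OF F net])
    show ?thesis
      using dec net_imp_right_equicontinuous[OF F net] decay_imp_equicontinuous_iff[OF F B dec] by blast
  qed
  \<comment> \<open>Assertions (ii) and (iii) share the condition on translates, so their
    equivalence reduces to that of decay and equicontinuity under \<open>op_shift\<close>.\<close>
  have iii_ii: "hs_equicontinuous U F" if "L2_decay \<mu> (FW ` F)"
    by (rule decay_imp_hs_equicontinuous[OF F B that])
  have ii_iii: "L2_decay \<mu> (FW ` F)" if "hs_equicontinuous U F"
    by (rule hs_equicontinuous_imp_decay[OF F that])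
  have iii_i: "hs_precompact F" if dec: "L2_decay \<mu> (FW ` F)" and eq: "L2_equicontinuous \<mu> (FW ` F)"
    unfolding hs_precompact_iff_net[OF F]
  proof (intro allI impI)
    fix e :: real assume e: "e > 0"
    have R: "right_equicontinuous F" using eq decay_imp_equicontinuous_iff[OF F B dec] by blast
    \<comment> \<open>Equicontinuity under \<open>op_shift\<close>, available from decay, transfers
      the right-hand estimate to the adjoints; it truncates the rows as \<open>R\<close> truncates
      the columns.\<close>
    have L: "right_equicontinuous (cadjoint ` F)" by (rule left_equicontinuous[OF F iii_ii[OF dec] R])
    have F': "cadjoint ` F \<subseteq> hilbert_schmidt" using F hs_cadjoint(1) by blast
    have B': "hs_norm A \<le> B" if "A \<in> cadjoint ` F" for A using that B F hs_cadjoint(2) by fastforce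
    show "\<exists>N. finite N \<and> N \<subseteq> hilbert_schmidt \<and> (\<forall>A\<in>F. \<exists>X\<in>N. hs_dist A X < e)"
    proof (rule tight_imp_net[OF F B _ _ e])
      fix r :: real assume r: "r > 0"
      show "\<exists>J. finite J \<and> J \<subseteq> some_onb \<and> (\<forall>A\<in>F. hs_norm (\<lambda>v. A v - A (coord_proj J v)) < r)"
        by (rule right_equicontinuous_imp_tight[OF F B R r]) blast+
      show "\<exists>J. finite J \<and> J \<subseteq> some_onb \<and> (\<forall>A\<in>F. hs_norm (\<lambda>v. cadjoint A v - cadjoint A (coord_proj J v)) < r)"
        by (rule right_equicontinuous_imp_tight[OF F' B' L r]) blast+
    qed
  qed
  show ?thesis using i_iii iii_ii ii_iii iii_i by blast
qed

end
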